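(* Let $\Omega\subset\mathbb{R}^N$ be a bounded domain with Lipschitz boundary, $0<s<1$ and $2\le p<\infty$. Let $f=f(x,t,\eta,\zeta):\Omega\times\mathbb{R}\times\mathbb{R}^N\times\mathbb{R}\to\mathbb{R}$ be continuous with respect to $x,t,\eta,\zeta$, and Lipschitz continuous with respect to $\eta$ and $\zeta$, i.e. there is $L>0$ with $|f(x,t,\eta_1,\zeta_1)-f(x,t,\eta_2,\zeta_2)|\le L(|\eta_1-\eta_2|+|\zeta_1-\zeta_2|)$ for all $x,t,\eta_1,\eta_2,\zeta_1,\zeta_2$. Assume that the comparison principle for the equation $\mathfrak{L}_{s,p}u=f(x,u,\nabla u,D_s^pu)$ holds in every open set $\Omega'\subset\Omega$. Then every continuous weak supersolution to $\mathfrak{L}_{s,p}u=f(x,u,\nabla u,D_s^pu)$ in $\Omega$ is a viscosity supersolution to $\mathfrak{L}_{s,p}u=f(x,u,\nabla u,D_s^pu)$ in $\Omega$.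
   Context: Operator. $N\ge2$, $\mathfrak{L}_{s,p}=-\Delta_p+(-\Delta_p)^s$, where $\Delta_pu=\operatorname{div}(|\nabla u|^{p-2}\nabla u)$ and $(-\Delta_p)^su(x)=2\,\mathrm{P.V.}\int_{\mathbb{R}^N}|u(x)-u(y)|^{p-2}(u(x)-u(y))K_{s,p}(x,y)\,dy$. The kernel $K_{s,p}:\mathbb{R}^N\times\mathbb{R}^N\to\mathbb{R}$ is a fixed measurable function such that: $K_{s,p}(x,y)=K_{s,p}(y,x)$; $K_{s,p}(x+z,y+z)=K_{s,p}(x,y)$ for all $x,y,z$; there is $\Lambda>0$ with $\Lambda^{-1}|x-y|^{-N-ps}\le K_{s,p}(x,y)\le\Lambda|x-y|^{-N-ps}$ for all $x\ne y$; and $x\mapsto K_{s,p}(x,y)$ is continuous on $\mathbb{R}^N\setminus\{y\}$ for every $y$. Further $D_s^pu(x)=\int_{\mathbb{R}^N}\frac{|u(x)-u(y)|^p}{|x-y|^{N+sp}}\,dy$. Spaces. $L_{s,p}^{p-1}(\mathbb{R}^N)=\{h\in L^{p-1}_{\mathrm{loc}}(\mathbb{R}^N):\int_{\mathbb{R}^N}\frac{|h(x)|^{p-1}}{(1+|x|)^{N+sp}}dx<\infty\}$. For open $U$, $\mathbb{X}_0^{s,p}(U)=\{w\in W^{1,p}(\mathbb{R}^N): w=0\text{ in }\mathbb{R}^N\setminus U\}$. Weak solutions. For open $U\subset\Omega$, a function $u\in W^{1,p}_{\mathrm{loc}}(U)\cap L_{s,p}^{p-1}(\mathbb{R}^N)$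 is a weak supersolution (subsolution) in $U$ if for every $v\in\mathbb{X}_0^{s,p}(U)$ with $v\ge0$, $$\int_U|\nabla u|^{p-2}\nabla u\cdot\nabla v\,dx+\int_{\mathbb{R}^N}\int_{\mathbb{R}^N}h(u(x)-u(y))(v(x)-v(y))K_{s,p}(x,y)\,dy\,dx\ \ge(\le)\ \int_Uf(x,u,\nabla u,D_s^pu)v\,dx,$$ where $h(\tau)=|\tau|^{p-2}\tau$. Comparison principle. A weak supersolution $u$ in an open set $\Omega'\subset\Omega$ satisfies the comparison principle in $\Omega'$ if for every weak subsolution $w$ in $\Omega'$ with $u\ge w$ in $\mathbb{R}^N\setminus\Omega'$ one has $u\ge w$ in $\mathbb{R}^N$. The comparison principle holds in $\Omega'$ if every weak supersolution in $\Omega'$ satisfies it. Viscosity supersolution (for $p\ge2$). A lower semicontinuous $u:\mathbb{R}^N\to[-\infty,\infty]$ is a viscosity supersolution in $\Omega$ if: (a) $u_-=\max\{0,-u\}\in L_{s,p}^{p-1}(\mathbb{R}^N)$; (b) $u<\infty$ a.e. in $\mathbb{R}^N$ and $u>-\infty$ in $\Omega$; (c) whenever $B_r(x_0)\subset\Omega$ and $\psi\in C^2(B_r(x_0))\cap L_{s,p}^{p-1}(\mathbb{R}^N)$ satisfies $\psi\le u$ in $\mathbb{R}^N$ and $\psi(x_0)=u(x_0)$, one has $$\lim_{\rho\to0}\ \sup_{x\in B_\rho(x_0)\setminus\{x_0\}}\big(-\Delta_p\psi(x)\big)+(-\Delta_p)^s\psi(x_0)\ge f(x_0,\psi(x_0),\nabla\psi(x_0),D_s^p\psi(x_0)).$$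 *)

theory Defs
  imports "HOL-Analysis.Analysis"
begin

section \<open>Domains and classical differentiability\<close>

text \<open>Near each boundary point the set is the strict epigraph, in some direction \<open>e\<close>, of a
  Lipschitz function on the hyperplane orthogonal to \<open>e\<close>.\<close>

definition lipschitz_boundary :: "'a::euclidean_space set \<Rightarrow> bool" where
  "lipschitz_boundary \<Omega> \<longleftrightarrow>
     (\<forall>z\<in>frontier \<Omega>. \<exists>r>0. \<exists>e \<gamma> M. norm e = 1 \<and> M-lipschitz_on {y. y \<bullet> e = 0} (\<gamma> :: 'a \<Rightarrow> real) \<and>
        \<Omega> \<inter> ball z r = {x \<in> ball z r. \<gamma> (x - (x \<bullet> e) *\<^sub>R e) < x \<bullet> e})"

text \<open>The class \<open>C\<^sup>k(U)\<close>, for open \<open>U\<close>.\<close>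

primrec Ck_on :: "nat \<Rightarrow> ('a::euclidean_space \<Rightarrow> real) \<Rightarrow> 'a set \<Rightarrow> bool" where
  "Ck_on 0 \<phi> U \<longleftrightarrow> continuous_on U \<phi>"
| "Ck_on (Suc k) \<phi> U \<longleftrightarrow> (\<forall>x\<in>U. \<phi> differentiable (at x)) \<and>
     (\<forall>b\<in>Basis. Ck_on k (\<lambda>x. frechet_derivative \<phi> (at x) b) U)"

definition gradient :: "('a::euclidean_space \<Rightarrow> real) \<Rightarrow> 'a \<Rightarrow> 'a" where
  "gradient \<phi> x = (\<Sum>b\<in>Basis. frechet_derivative \<phi> (at x) b *\<^sub>R b)"

definition divergence :: "('a::euclidean_space \<Rightarrow> 'a) \<Rightarrow> 'a \<Rightarrow> real" where
  "divergence F x = (\<Sum>b\<in>Basis. frechet_derivative F (at x) b \<bullet> b)"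

text \<open>\<open>C\<^sub>c\<^sup>\<infinity>(U)\<close>\<close>

definition test_functions :: "'a::euclidean_space set \<Rightarrow> ('a \<Rightarrow> real) set" where
  "test_functions U = {\<phi>. (\<forall>k. Ck_on k \<phi> UNIV) \<and>
     compact (closure {x. \<phi> x \<noteq> 0}) \<and> closure {x. \<phi> x \<noteq> 0} \<subseteq> U}"

section \<open>Function spaces\<close>

text \<open>Elements of Lebesgue and Sobolev spaces are represented by functions; (in)equalities
  between them are understood almost everywhere.\<close>

definition Lp_on :: "real \<Rightarrow> 'a::euclidean_space set \<Rightarrow> ('a \<Rightarrow> 'b::euclidean_space) \<Rightarrow> bool" where
  "Lp_on p S g \<longleftrightarrow> set_borel_measurable lebesgue S g \<and>
     set_integrable lebesgue S (\<lambda>x. norm (g x) powr p)"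

definition Lp_loc :: "real \<Rightarrow> 'a::euclidean_space set \<Rightarrow> ('a \<Rightarrow> 'b::euclidean_space) \<Rightarrow> bool" where
  "Lp_loc p U g \<longleftrightarrow> (\<forall>C. compact C \<and> C \<subseteq> U \<longrightarrow> Lp_on p C g)"

definition has_weak_gradient ::
    "'a::euclidean_space set \<Rightarrow> ('a \<Rightarrow> real) \<Rightarrow> ('a \<Rightarrow> 'a) \<Rightarrow> bool" where
  "has_weak_gradient U u Du \<longleftrightarrow> Lp_loc 1 U u \<and> Lp_loc 1 U Du \<and>
     (\<forall>\<phi>\<in>test_functions U. \<forall>b\<in>Basis.
        (LINT x:U|lebesgue. u x * frechet_derivative \<phi> (at x) b)
        = - (LINT x:U|lebesgue. (Du x \<bullet> b) * \<phi> x))"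

text \<open>\<open>u \<in> W\<^sup>1\<^sup>,\<^sup>p\<^sub>l\<^sub>o\<^sub>c(U)\<close> with weak gradient \<open>Du\<close> (which is unique up to a null set).\<close>

definition W1p_loc_grad ::
    "real \<Rightarrow> 'a::euclidean_space set \<Rightarrow> ('a \<Rightarrow> real) \<Rightarrow> ('a \<Rightarrow> 'a) \<Rightarrow> bool" where
  "W1p_loc_grad p U u Du \<longleftrightarrow> Lp_loc p U u \<and> Lp_loc p U Du \<and> has_weak_gradient U u Du"

text \<open>\<open>v \<in> W\<^sup>1\<^sup>,\<^sup>p(\<real>\<^sup>N)\<close> with weak gradient \<open>Dv\<close>.\<close>

definition W1p_grad :: "real \<Rightarrow> ('a::euclidean_space \<Rightarrow> real) \<Rightarrow> ('a \<Rightarrow> 'a) \<Rightarrow> bool" where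
  "W1p_grad p v Dv \<longleftrightarrow> Lp_on p UNIV v \<and> Lp_on p UNIV Dv \<and> has_weak_gradient UNIV v Dv"

definition X0 :: "real \<Rightarrow> 'a::euclidean_space set \<Rightarrow> ('a \<Rightarrow> real) set" where
  "X0 p U = {v. (\<exists>Dv. W1p_grad p v Dv) \<and> (AE x in lebesgue. x \<notin> U \<longrightarrow> v x = 0)}"

text \<open>The tail space \<open>L\<^sub>s\<^sub>,\<^sub>p\<^sup>p\<^sup>-\<^sup>1(\<real>\<^sup>N)\<close>.\<close>

definition tail_space :: "real \<Rightarrow> real \<Rightarrow> ('a::euclidean_space \<Rightarrow> real) set" where
  "tail_space s p = {h. Lp_loc (p - 1) UNIV h \<and>
     integrable lebesgue
       (\<lambda>x. \<bar>h x\<bar> powr (p - 1) / (1 + norm x) powr (real DIM('a) + s * p))}"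

section \<open>The operators\<close>

definition admissible_kernel ::
    "real \<Rightarrow> real \<Rightarrow> ('a::euclidean_space \<Rightarrow> 'a \<Rightarrow> real) \<Rightarrow> bool" where
  "admissible_kernel s p K \<longleftrightarrow>
     (\<lambda>(x, y). K x y) \<in> borel_measurable lebesgue \<and>
     (\<forall>x y. K x y = K y x) \<and>
     (\<forall>x y z. K (x + z) (y + z) = K x y) \<and>
     (\<exists>\<Lambda>>0. \<forall>x y. x \<noteq> y \<longrightarrow>
        inverse \<Lambda> * norm (x - y) powr (- real DIM('a) - p * s) \<le> K x y \<and>
        K x y \<le> \<Lambda> * norm (x - y) powr (- real DIM('a) - p * s)) \<and>
     (\<forall>y. continuous_on (UNIV - {y}) (\<lambda>x. K x y))"

text \<open>\<open>|\<xi>|\<^sup>p\<^sup>-\<^sup>2 \<xi>\<close>; on the reals this is the function \<open>h\<close> of the nonlocal term. Although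
  \<open>0 powr 0 = 0\<close>, the value at \<open>\<xi> = 0\<close> is the right one also for \<open>p = 2\<close>.\<close>

definition p_power :: "real \<Rightarrow> 'b::euclidean_space \<Rightarrow> 'b" where
  "p_power p \<xi> = norm \<xi> powr (p - 2) *\<^sub>R \<xi>"

definition p_laplacian :: "real \<Rightarrow> ('a::euclidean_space \<Rightarrow> real) \<Rightarrow> 'a \<Rightarrow> real" where
  "p_laplacian p u x = divergence (\<lambda>z. p_power p (gradient u z)) x"

text \<open>\<open>(-\<Delta>\<^sub>p)\<^sup>s u(x)\<close>, the limit expressing the principal value.\<close>

definition frac_p_laplacian ::
    "real \<Rightarrow> ('a::euclidean_space \<Rightarrow> 'a \<Rightarrow> real) \<Rightarrow> ('a \<Rightarrow> real) \<Rightarrow> 'a \<Rightarrow> real" where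
  "frac_p_laplacian p K u x =
     2 * Lim (at_right 0) (\<lambda>\<epsilon>. LINT y:- ball x \<epsilon>|lebesgue. p_power p (u x - u y) * K x y)"

definition Dsp_integrand ::
    "real \<Rightarrow> real \<Rightarrow> ('a::euclidean_space \<Rightarrow> real) \<Rightarrow> 'a \<Rightarrow> 'a \<Rightarrow> real" where
  "Dsp_integrand s p u x y = \<bar>u x - u y\<bar> powr p / norm (x - y) powr (real DIM('a) + s * p)"

definition Dsp :: "real \<Rightarrow> real \<Rightarrow> ('a::euclidean_space \<Rightarrow> real) \<Rightarrow> 'a \<Rightarrow> real" where
  "Dsp s p u x = (LINT y|lebesgue. Dsp_integrand s p u x y)"

text \<open>Membership in the tail space does not make \<open>D\<^sub>s\<^sup>p u(x)\<close> finite, whereas the last argument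
  of \<open>f\<close> is a real number. The expression \<open>f(x, u, \<nabla>u, D\<^sub>s\<^sup>p u)\<close> is meaningful at \<open>x\<close> if
  \<open>D\<^sub>s\<^sup>p u(x)\<close> is finite, or if \<open>f\<close> does not involve its last argument at all (on the set \<open>U\<close>
  where the equation is posed).\<close>

definition rhs_meaningful ::
    "real \<Rightarrow> real \<Rightarrow> ('a::euclidean_space \<Rightarrow> real \<Rightarrow> 'a \<Rightarrow> real \<Rightarrow> real) \<Rightarrow> 'a set
      \<Rightarrow> ('a \<Rightarrow> real) \<Rightarrow> 'a \<Rightarrow> bool" where
  "rhs_meaningful s p f U u x \<longleftrightarrow>
     integrable lebesgue (Dsp_integrand s p u x) \<or>
     (\<forall>z\<in>U. \<forall>t \<eta> \<zeta>\<^sub>1 \<zeta>\<^sub>2. f z t \<eta> \<zeta>\<^sub>1 = f z t \<eta> \<zeta>\<^sub>2)"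

section \<open>Weak solutions and the comparison principle\<close>

definition local_integrand ::
    "real \<Rightarrow> ('a::euclidean_space \<Rightarrow> 'a) \<Rightarrow> ('a \<Rightarrow> 'a) \<Rightarrow> 'a \<Rightarrow> real" where
  "local_integrand p Du Dv x = p_power p (Du x) \<bullet> Dv x"

definition nonlocal_integrand ::
    "real \<Rightarrow> ('a::euclidean_space \<Rightarrow> 'a \<Rightarrow> real) \<Rightarrow> ('a \<Rightarrow> real) \<Rightarrow> ('a \<Rightarrow> real)
      \<Rightarrow> 'a \<Rightarrow> 'a \<Rightarrow> real" where
  "nonlocal_integrand p K u v x y = p_power p (u x - u y) * (v x - v y) * K x y"

definition rhs_integrand ::
    "real \<Rightarrow> real \<Rightarrow> ('a::euclidean_space \<Rightarrow> real \<Rightarrow> 'a \<Rightarrow> real \<Rightarrow> real)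
      \<Rightarrow> ('a \<Rightarrow> real) \<Rightarrow> ('a \<Rightarrow> 'a) \<Rightarrow> ('a \<Rightarrow> real) \<Rightarrow> 'a \<Rightarrow> real" where
  "rhs_integrand s p f u Du v x = f x (u x) (Du x) (Dsp s p u x) * v x"

text \<open>Test functions are only in \<open>W\<^sup>1\<^sup>,\<^sup>p\<close>, so for \<open>u \<in> W\<^sup>1\<^sup>,\<^sup>p\<^sub>l\<^sub>o\<^sub>c(U)\<close> the integrals need not
  converge. That they all do is part of the notion of weak super- or subsolution. (Without it,
  divergent integrals would silently have the value \<open>0\<close>.)\<close>

definition weak_form_meaningful ::
    "real \<Rightarrow> real \<Rightarrow> ('a::euclidean_space \<Rightarrow> 'a \<Rightarrow> real)
      \<Rightarrow> ('a \<Rightarrow> real \<Rightarrow> 'a \<Rightarrow> real \<Rightarrow> real) \<Rightarrow> 'a set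
      \<Rightarrow> ('a \<Rightarrow> real) \<Rightarrow> ('a \<Rightarrow> 'a) \<Rightarrow> ('a \<Rightarrow> real) \<Rightarrow> ('a \<Rightarrow> 'a) \<Rightarrow> bool" where
  "weak_form_meaningful s p K f U u Du v Dv \<longleftrightarrow>
     set_integrable lebesgue U (local_integrand p Du Dv) \<and>
     integrable lebesgue (\<lambda>(x, y). nonlocal_integrand p K u v x y) \<and>
     set_integrable lebesgue U (rhs_integrand s p f u Du v)"

definition weak_lhs ::
    "real \<Rightarrow> ('a::euclidean_space \<Rightarrow> 'a \<Rightarrow> real) \<Rightarrow> 'a set
      \<Rightarrow> ('a \<Rightarrow> real) \<Rightarrow> ('a \<Rightarrow> 'a) \<Rightarrow> ('a \<Rightarrow> real) \<Rightarrow> ('a \<Rightarrow> 'a) \<Rightarrow> real" where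
  "weak_lhs p K U u Du v Dv =
     (LINT x:U|lebesgue. local_integrand p Du Dv x)
     + (LINT x|lebesgue. LINT y|lebesgue. nonlocal_integrand p K u v x y)"

definition weak_rhs ::
    "real \<Rightarrow> real \<Rightarrow> ('a::euclidean_space \<Rightarrow> real \<Rightarrow> 'a \<Rightarrow> real \<Rightarrow> real) \<Rightarrow> 'a set
      \<Rightarrow> ('a \<Rightarrow> real) \<Rightarrow> ('a \<Rightarrow> 'a) \<Rightarrow> ('a \<Rightarrow> real) \<Rightarrow> real" where
  "weak_rhs s p f U u Du v = (LINT x:U|lebesgue. rhs_integrand s p f u Du v x)"

definition weak_supersolution ::
    "real \<Rightarrow> real \<Rightarrow> ('a::euclidean_space \<Rightarrow> 'a \<Rightarrow> real)
      \<Rightarrow> ('a \<Rightarrow> real \<Rightarrow> 'a \<Rightarrow> real \<Rightarrow> real) \<Rightarrow> 'a set \<Rightarrow> ('a \<Rightarrow> real) \<Rightarrow> bool" where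
  "weak_supersolution s p K f U u \<longleftrightarrow>
     u \<in> tail_space s p \<and> (AE x in lebesgue. x \<in> U \<longrightarrow> rhs_meaningful s p f U u x) \<and>
     (\<exists>Du. W1p_loc_grad p U u Du \<and>
        (\<forall>v Dv. v \<in> X0 p U \<and> W1p_grad p v Dv \<and> (AE x in lebesgue. 0 \<le> v x) \<longrightarrow>
           weak_form_meaningful s p K f U u Du v Dv \<and>
           weak_lhs p K U u Du v Dv \<ge> weak_rhs s p f U u Du v))"

definition weak_subsolution ::
    "real \<Rightarrow> real \<Rightarrow> ('a::euclidean_space \<Rightarrow> 'a \<Rightarrow> real)
      \<Rightarrow> ('a \<Rightarrow> real \<Rightarrow> 'a \<Rightarrow> real \<Rightarrow> real) \<Rightarrow> 'a set \<Rightarrow> ('a \<Rightarrow> real) \<Rightarrow> bool" where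
  "weak_subsolution s p K f U u \<longleftrightarrow>
     u \<in> tail_space s p \<and> (AE x in lebesgue. x \<in> U \<longrightarrow> rhs_meaningful s p f U u x) \<and>
     (\<exists>Du. W1p_loc_grad p U u Du \<and>
        (\<forall>v Dv. v \<in> X0 p U \<and> W1p_grad p v Dv \<and> (AE x in lebesgue. 0 \<le> v x) \<longrightarrow>
           weak_form_meaningful s p K f U u Du v Dv \<and>
           weak_lhs p K U u Du v Dv \<le> weak_rhs s p f U u Du v))"

definition satisfies_comparison ::
    "real \<Rightarrow> real \<Rightarrow> ('a::euclidean_space \<Rightarrow> 'a \<Rightarrow> real)
      \<Rightarrow> ('a \<Rightarrow> real \<Rightarrow> 'a \<Rightarrow> real \<Rightarrow> real) \<Rightarrow> 'a set \<Rightarrow> ('a \<Rightarrow> real) \<Rightarrow> bool" where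
  "satisfies_comparison s p K f U u \<longleftrightarrow>
     (\<forall>w. weak_subsolution s p K f U w \<and> (AE x in lebesgue. x \<notin> U \<longrightarrow> w x \<le> u x) \<longrightarrow>
        (AE x in lebesgue. w x \<le> u x))"

definition comparison_principle ::
    "real \<Rightarrow> real \<Rightarrow> ('a::euclidean_space \<Rightarrow> 'a \<Rightarrow> real)
      \<Rightarrow> ('a \<Rightarrow> real \<Rightarrow> 'a \<Rightarrow> real \<Rightarrow> real) \<Rightarrow> 'a set \<Rightarrow> bool" where
  "comparison_principle s p K f U \<longleftrightarrow>
     (\<forall>u. weak_supersolution s p K f U u \<longrightarrow> satisfies_comparison s p K f U u)"

section \<open>Viscosity supersolutions\<close>

definition lower_semicontinuous :: "('a::topological_space \<Rightarrow> ereal) \<Rightarrow> bool" where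
  "lower_semicontinuous u \<longleftrightarrow> (\<forall>t. open {x. t < u x})"

text \<open>The first condition is \<open>u\<^sub>- \<in> L\<^sub>s\<^sub>,\<^sub>p\<^sup>p\<^sup>-\<^sup>1(\<real>\<^sup>N)\<close>; since \<open>real_of_ereal \<infinity> = 0\<close>, finiteness
  almost everywhere of the negative part has to be stated separately.\<close>

definition viscosity_supersolution ::
    "real \<Rightarrow> real \<Rightarrow> ('a::euclidean_space \<Rightarrow> 'a \<Rightarrow> real)
      \<Rightarrow> ('a \<Rightarrow> real \<Rightarrow> 'a \<Rightarrow> real \<Rightarrow> real) \<Rightarrow> 'a set \<Rightarrow> ('a \<Rightarrow> ereal) \<Rightarrow> bool" where
  "viscosity_supersolution s p K f \<Omega> u \<longleftrightarrow>
     lower_semicontinuous u \<and>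
     ((AE x in lebesgue. max 0 (- u x) < \<infinity>) \<and>
      (\<lambda>x. real_of_ereal (max 0 (- u x))) \<in> tail_space s p) \<and>
     (AE x in lebesgue. u x < \<infinity>) \<and> (\<forall>x\<in>\<Omega>. - \<infinity> < u x) \<and>
     (\<forall>x\<^sub>0 r \<psi>. 0 < r \<and> ball x\<^sub>0 r \<subseteq> \<Omega> \<and> Ck_on 2 \<psi> (ball x\<^sub>0 r) \<and> \<psi> \<in> tail_space s p \<and>
        (\<forall>x. ereal (\<psi> x) \<le> u x) \<and> ereal (\<psi> x\<^sub>0) = u x\<^sub>0 \<and> rhs_meaningful s p f \<Omega> \<psi> x\<^sub>0 \<longrightarrow>
        Lim (at_right 0) (\<lambda>\<rho>. SUP x\<in>ball x\<^sub>0 \<rho> - {x\<^sub>0}. ereal (- p_laplacian p \<psi> x))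
          + ereal (frac_p_laplacian p K \<psi> x\<^sub>0)
        \<ge> ereal (f x\<^sub>0 (\<psi> x\<^sub>0) (gradient \<psi> x\<^sub>0) (Dsp s p \<psi> x\<^sub>0)))"

end

theory Submission
  imports Defs
begin

text \<open>Suppose that \<open>\<psi>\<close> touches the weak supersolution \<open>u\<close> from below at \<open>x\<^sub>0\<close> and violates the
  viscosity inequality there. Let \<open>q\<close> be the second Taylor polynomial of \<open>\<psi>\<close> at \<open>x\<^sub>0\<close> minus
  \<open>2\<epsilon>|x - x\<^sub>0|\<^sup>2\<close>, so that \<open>q + \<epsilon>|x - x\<^sub>0|\<^sup>2 \<le> \<psi>\<close> near \<open>x\<^sub>0\<close>. For small \<open>\<epsilon>\<close> and \<open>\<delta>\<close> the function equal to
  \<open>q\<close> in \<open>B\<^sub>\<delta>(x\<^sub>0)\<close> and to \<open>\<psi>\<close> elsewhere still satisfies the strict opposite inequality at \<open>x\<^sub>0\<close>, and by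
  continuity, for small \<open>r\<close>, so does \<open>w\<close> in all of \<open>B\<^sub>r(x\<^sub>0)\<close>, where \<open>w = q + \<epsilon>r\<^sup>2\<close> in \<open>B\<^sub>\<delta>(x\<^sub>0)\<close> and
  \<open>w = \<psi>\<close> elsewhere. Since \<open>w\<close> is smooth near the closure of \<open>B\<^sub>r(x\<^sub>0)\<close>, it is a weak subsolution
  there, and \<open>w \<le> \<psi> \<le> u\<close> outside. The comparison principle gives \<open>w \<le> u\<close>, contradicting
  \<open>w(x\<^sub>0) > u(x\<^sub>0)\<close>.

  Passing to a quadratic polynomial has the advantage over adding a bump to \<open>\<psi>\<close> that the (regularised)
  flux is \<open>C\<^sup>\<infinity>\<close> and can be tested directly against the weak gradient. The nonlocal form of \<open>w\<close> converges
  absolutely because \<open>|w(x) - w(x + z)|\<^sup>p\<^sup>-\<^sup>1 = O(|z|\<^sup>p\<^sup>-\<^sup>1)\<close> near the support of a test function \<open>v\<close>, while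
  \<open>\<integral> |v(x + z) - v(x)| dx = O(|z|)\<close>.\<close>

subsection \<open>Smooth functions\<close>

text \<open>Of the \<open>2 \<epsilon>\<close> subtracted in q, one \<open>\<epsilon>\<close>
  absorbs the Taylor remainder; the other leaves a gap \<open>\<epsilon>\<close> |x - x0|^2 below
  \<open>\<psi>\<close>, which outside the ball of radius r pays for the lift by
  \<open>\<epsilon>\<close> r^2. The function w jumps across the sphere of radius
  \<open>\<delta>\<close>, but 2 r <= \<open>\<delta>\<close> keeps that sphere away from every test
  function, and at positive distance the nonlocal terms ask only for measurability and a tail
  majorant. For p >= 2 the map h is locally Lipschitz, so the symmetrised second difference of a
  smooth function is O(|z|^p), integrable against |z|^(-N-sp) because s < 1. All limits are
  dominated convergence, split at a fixed radius into a singular part and a tail; the inequality on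
  a whole ball is obtained by contradiction along points converging to x0. The same split serves
  D_s^p, whose integrand is O(|z|^p) without symmetrisation. Its tail requires the power p instead
  of p - 1, and finiteness of D_s^p \<open>\<psi>\<close>(x0) supplies it.\<close>

definition smooth_on :: "('a::euclidean_space \<Rightarrow> real) \<Rightarrow> 'a set \<Rightarrow> bool" where
  "smooth_on f U \<longleftrightarrow> (\<forall>k. Ck_on k f U)"

lemma Ck_on_cong:
  assumes "open U" "\<And>x. x \<in> U \<Longrightarrow> f x = g x"
  shows "Ck_on k f U \<longleftrightarrow> Ck_on k g U"
  using assms(2)
proof (induction k arbitrary: f g)
  case 0
  then show ?case by (auto intro: continuous_on_cong[THEN iffD1])
next
  case (Suc k)
  have d: "(f has_derivative D) (at x) \<longleftrightarrow> (g has_derivative D) (at x)" if "x \<in> U" for x D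
    using has_derivative_transform_within_open[OF _ assms(1) that, of f D UNIV g]
      has_derivative_transform_within_open[OF _ assms(1) that, of g D UNIV f] Suc.prems by auto
  have diff: "f differentiable (at x) \<longleftrightarrow> g differentiable (at x)" if "x \<in> U" for x
    using d[OF that] by (simp add: differentiable_def)
  have fd: "frechet_derivative f (at x) = frechet_derivative g (at x)" if "x \<in> U" for x
    using d[OF that] by (simp add: frechet_derivative_def)
  have "Ck_on k (\<lambda>x. frechet_derivative f (at x) b) U \<longleftrightarrow>
      Ck_on k (\<lambda>x. frechet_derivative g (at x) b) U" for b
    by (rule Suc.IH) (simp add: fd)
  then show ?case using diff by auto
qed

lemma Ck_on_SucD: "Ck_on (Suc k) f U \<Longrightarrow> Ck_on k f U"
proof (induction k arbitrary: f)
  case 0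
  then show ?case
    by (auto intro!: continuous_at_imp_continuous_on differentiable_imp_continuous_within)
next
  case (Suc k)
  then show ?case by (metis Ck_on.simps(2))
qed

text \<open>\<open>Ck_on\<close> speaks of \<open>frechet_derivative\<close>, an object given by
  choice; this rule accepts an explicit derivative instead, and the closure properties go through
  it.\<close>

lemma Ck_on_SucI:
  assumes "open U" "\<And>x. x \<in> U \<Longrightarrow> (f has_derivative f' x) (at x)"
    "\<And>b. b \<in> Basis \<Longrightarrow> Ck_on k (\<lambda>x. f' x b) U"
  shows "Ck_on (Suc k) f U"
proof -
  have fd: "frechet_derivative f (at x) = f' x" if "x \<in> U" for x
    using frechet_derivative_at[OF assms(2)[OF that]] by simp
  have "Ck_on k (\<lambda>x. frechet_derivative f (at x) b) U" if "b \<in> Basis" for b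
    using Ck_on_cong[OF assms(1), of "\<lambda>x. frechet_derivative f (at x) b" "\<lambda>x. f' x b"]
      fd assms(3)[OF that] by auto
  then show ?thesis using assms(2) by (auto simp: differentiable_def)
qed

lemma Ck_on_has_derivative:
  "Ck_on (Suc k) f U \<Longrightarrow> x \<in> U \<Longrightarrow> (f has_derivative frechet_derivative f (at x)) (at x)"
  by (simp flip: frechet_derivative_works)

lemma Ck_on_const: "open U \<Longrightarrow> Ck_on k (\<lambda>x. c) U"
proof (induction k arbitrary: c)
  case (Suc k)
  show ?case by (rule Ck_on_SucI[where f'="\<lambda>x h. 0"]) (auto intro: Suc simp: Suc.prems)
qed auto

lemma Ck_on_linear: "open U \<Longrightarrow> bounded_linear f \<Longrightarrow> Ck_on k f U"
proof (induction k arbitrary: f)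
  case 0
  then show ?case by (simp add: linear_continuous_on)
next
  case (Suc k)
  show ?case
    by (rule Ck_on_SucI[where f'="\<lambda>x. f"])
      (auto intro!: bounded_linear_imp_has_derivative Ck_on_const Suc.prems)
qed

lemma Ck_on_add:
  "open U \<Longrightarrow> Ck_on k f U \<Longrightarrow> Ck_on k g U \<Longrightarrow> Ck_on k (\<lambda>x. f x + g x) U"
proof (induction k arbitrary: f g)
  case 0
  then show ?case by (auto intro: continuous_intros)
next
  case (Suc k)
  show ?case
  proof (rule Ck_on_SucI[OF Suc.prems(1)])
    fix x assume "x \<in> U"
    then show "((\<lambda>x. f x + g x) has_derivative
        (\<lambda>h. frechet_derivative f (at x) h + frechet_derivative g (at x) h)) (at x)"
      using Suc.prems by (intro has_derivative_add Ck_on_has_derivative)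
  qed (use Suc in auto)
qed

lemma Ck_on_mult:
  "open U \<Longrightarrow> Ck_on k f U \<Longrightarrow> Ck_on k g U \<Longrightarrow> Ck_on k (\<lambda>x. f x * g x) U"
proof (induction k arbitrary: f g)
  case 0
  then show ?case by (auto intro: continuous_intros)
next
  case (Suc k)
  show ?case
  proof (rule Ck_on_SucI[OF Suc.prems(1)])
    fix x assume "x \<in> U"
    then show "((\<lambda>x. f x * g x) has_derivative
        (\<lambda>h. f x * frechet_derivative g (at x) h + frechet_derivative f (at x) h * g x)) (at x)"
      using Suc.prems by (intro has_derivative_mult Ck_on_has_derivative)
  next
    fix b :: 'a assume "b \<in> Basis"
    then show "Ck_on k (\<lambda>x. f x * frechet_derivative g (at x) b
        + frechet_derivative f (at x) b * g x) U"
      using Suc.prems Ck_on_SucD[OF Suc.prems(2)] Ck_on_SucD[OF Suc.prems(3)]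
      by (intro Ck_on_add Suc.IH) auto
  qed
qed

lemma Ck_on_sum:
  "open U \<Longrightarrow> (\<And>i. i \<in> I \<Longrightarrow> Ck_on k (f i) U) \<Longrightarrow> Ck_on k (\<lambda>x. \<Sum>i\<in>I. f i x) U"
  by (induction I rule: infinite_finite_induct) (auto intro: Ck_on_const Ck_on_add)

text \<open>The outer function lives on the line, so its derivative is multiplication by the number
  \<open>frechet_derivative g (at y) 1\<close>. That number is a \<open>Ck_on k\<close> function of
  y, so the induction hypothesis applies to it.\<close>

lemma Ck_on_compose:
  fixes g :: "real \<Rightarrow> real"
  shows "open U \<Longrightarrow> Ck_on k g V \<Longrightarrow> Ck_on k f U \<Longrightarrow> f ` U \<subseteq> V \<Longrightarrow> Ck_on k (\<lambda>x. g (f x)) U"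
proof (induction k arbitrary: f g)
  case 0
  then show ?case by (auto intro: continuous_on_compose2)
next
  case (Suc k)
  show ?case
  proof (rule Ck_on_SucI[OF Suc.prems(1)])
    fix x assume x: "x \<in> U"
    have 1: "((\<lambda>x. g (f x)) has_derivative
        (\<lambda>h. frechet_derivative g (at (f x)) (frechet_derivative f (at x) h))) (at x)"
      by (rule has_derivative_compose[OF Ck_on_has_derivative[OF Suc.prems(3) x] Ck_on_has_derivative[OF Suc.prems(2)]])
        (use Suc.prems x in auto)
    have 2: "frechet_derivative g (at (f x)) t = t * frechet_derivative g (at (f x)) 1" for t
    proof -
      have "linear (frechet_derivative g (at (f x)))"
        using Suc.prems x by (intro linear_frechet_derivative) auto
      from linear_cmul[OF this, of t 1] show ?thesis by simp
    qed
    show "((\<lambda>x. g (f x)) has_derivative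
        (\<lambda>h. frechet_derivative f (at x) h * frechet_derivative g (at (f x)) 1)) (at x)"
      by (rule has_derivative_eq_rhs[OF 1]) (rule ext, rule 2)
  next
    fix b :: 'a assume "b \<in> Basis"
    then show "Ck_on k (\<lambda>x. frechet_derivative f (at x) b * frechet_derivative g (at (f x)) 1) U"
      using Suc.prems Ck_on_SucD[OF Suc.prems(3)]
      by (intro Ck_on_mult Suc.IH[of "\<lambda>y. frechet_derivative g (at y) 1"]) auto
  qed
qed

lemma Ck_on_powr: "Ck_on k (\<lambda>t::real. t powr a) {0<..}"
proof (induction k arbitrary: a)
  case 0
  then show ?case by (auto intro!: continuous_intros)
next
  case (Suc k)
  show ?case
    by (rule Ck_on_SucI[where f'="\<lambda>t h. h * (a * t powr (a - 1))"])
      (auto intro!: has_derivative_eq_rhs[OF has_real_derivative_powr[unfolded has_field_derivative_def]]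
        Ck_on_mult Ck_on_const Suc simp: fun_eq_iff)
qed

lemma smooth_on_const: "open U \<Longrightarrow> smooth_on (\<lambda>x. c) U"
  by (simp add: smooth_on_def Ck_on_const)

lemma smooth_on_linear: "open U \<Longrightarrow> bounded_linear f \<Longrightarrow> smooth_on f U"
  by (simp add: smooth_on_def Ck_on_linear)

lemma smooth_on_add: "open U \<Longrightarrow> smooth_on f U \<Longrightarrow> smooth_on g U \<Longrightarrow> smooth_on (\<lambda>x. f x + g x) U"
  by (simp add: smooth_on_def Ck_on_add)

lemma smooth_on_mult: "open U \<Longrightarrow> smooth_on f U \<Longrightarrow> smooth_on g U \<Longrightarrow> smooth_on (\<lambda>x. f x * g x) U"
  by (simp add: smooth_on_def Ck_on_mult)

lemma smooth_on_compose:
  "open U \<Longrightarrow> smooth_on h V \<Longrightarrow> smooth_on f U \<Longrightarrow> f ` U \<subseteq> V \<Longrightarrow> smooth_on (\<lambda>x. h (f x)) U"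
  unfolding smooth_on_def using Ck_on_compose[of U _ h V f] by blast

lemma smooth_on_sum:
  "open U \<Longrightarrow> (\<And>i. i \<in> I \<Longrightarrow> smooth_on (F i) U) \<Longrightarrow> smooth_on (\<lambda>x. \<Sum>i\<in>I. F i x) U"
  by (simp add: smooth_on_def Ck_on_sum)

lemma smooth_on_powr: "open U \<Longrightarrow> smooth_on f U \<Longrightarrow> (\<And>x. x \<in> U \<Longrightarrow> 0 < f x) \<Longrightarrow> smooth_on (\<lambda>x. f x powr a) U"
  by (rule smooth_on_compose[where V="{0<..}"]) (auto simp: smooth_on_def Ck_on_powr)

lemma smooth_on_polynomial: "real_polynomial_function f \<Longrightarrow> smooth_on f UNIV"
  by (induction rule: real_polynomial_function.induct)
    (auto intro: smooth_on_const smooth_on_linear smooth_on_add smooth_on_mult)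

lemma smooth_onD:
  assumes "smooth_on f U" "x \<in> U"
  shows "(f has_derivative frechet_derivative f (at x)) (at x)"
  using assms Ck_on_has_derivative unfolding smooth_on_def by blast

lemma smooth_on_frechet_derivative:
  "smooth_on f U \<Longrightarrow> b \<in> Basis \<Longrightarrow> smooth_on (\<lambda>x. frechet_derivative f (at x) b) U"
  unfolding smooth_on_def by (metis Ck_on.simps(2))

lemma smooth_on_continuous: "smooth_on f U \<Longrightarrow> continuous_on U f"
  unfolding smooth_on_def by (metis Ck_on.simps(1))

subsection \<open>Cutoff functions\<close>

text \<open>The functions exp(-1/t) t^(-m), extended by 0. The extra index m makes the family closed
  under differentiation up to linear combinations, so one simultaneous induction proves all members
  smooth.\<close>

definition flat :: "nat \<Rightarrow> real \<Rightarrow> real" where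
  "flat m t = (if t > 0 then exp (- inverse t) * inverse t ^ m else 0)"

lemma flat_tendsto_0: "((\<lambda>t. exp (- inverse t) * inverse t ^ m) \<longlongrightarrow> 0) (at_right (0::real))"
proof -
  have "((\<lambda>x::real. x ^ m / exp x) \<longlongrightarrow> 0) at_top" by (rule tendsto_power_div_exp_0)
  then have "((\<lambda>x::real. x ^ m * exp (- x)) \<longlongrightarrow> 0) at_top" by (simp add: exp_minus divide_inverse)
  from filterlim_compose[OF this filterlim_inverse_at_top_right] show ?thesis by (simp add: mult.commute)
qed

lemma flat_has_derivative:
  "(flat m has_real_derivative (flat (m + 2) t - m * flat (m + 1) t)) (at t)"
proof (cases t "0::real" rule: linorder_cases)
  case less
  have "((\<lambda>_. 0) has_real_derivative 0) (at t)" by simp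
  then have "(flat m has_real_derivative 0) (at t)"
    by (rule has_field_derivative_transform_within_open[of _ _ _ "{..<0}"])
      (use less in \<open>auto simp: flat_def\<close>)
  then show ?thesis using less by (simp add: flat_def)
next
  case greater
  have "((\<lambda>t. exp (- inverse t) * inverse t ^ m) has_real_derivative
      (flat (m + 2) t - m * flat (m + 1) t)) (at t)"
  proof -
    have "((\<lambda>t. exp (- inverse t) * inverse t ^ m) has_real_derivative
        exp (- inverse t) * (inverse t * inverse t) * inverse t ^ m
        + exp (- inverse t) * (m * inverse t ^ (m - 1) * - (inverse t * inverse t))) (at t)"
      using greater by (auto intro!: derivative_eq_intros)
    then show ?thesis
      using greater by (cases m) (simp_all add: flat_def algebra_simps)
  qed
  then show ?thesis
    by (rule has_field_derivative_transform_within_open[of _ _ _ "{0<..}"])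
      (use greater in \<open>auto simp: flat_def\<close>)
next
  case equal
  have "((\<lambda>y. (flat m y - flat m 0) / (y - 0)) \<longlongrightarrow> 0) (at 0)"
  proof (rule filterlim_split_at)
    show "((\<lambda>y. (flat m y - flat m 0) / (y - 0)) \<longlongrightarrow> 0) (at_left 0)"
      by (rule tendsto_eventually) (auto simp: eventually_at_filter flat_def)
    \<comment> \<open>Dividing by y only raises the index: for y > 0 the quotient is the formula of
      \<open>flat (Suc m)\<close>, which tends to 0.\<close>
    show "((\<lambda>y. (flat m y - flat m 0) / (y - 0)) \<longlongrightarrow> 0) (at_right 0)"
      by (rule Lim_transform_eventually[OF flat_tendsto_0[of "Suc m"]])
        (auto simp: eventually_at_filter flat_def divide_inverse)
  qed
  then show ?thesis using equal by (simp add: has_field_derivative_iff flat_def)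
qed

lemma smooth_on_flat: "smooth_on (flat m) UNIV"
proof -
  have "Ck_on k (flat m) UNIV" for k
  proof (induction k arbitrary: m)
    case 0
    then show ?case
      by (auto simp: continuous_on_eq_continuous_at intro!: DERIV_isCont[OF flat_has_derivative])
  next
    case (Suc k)
    show ?case
    proof (rule Ck_on_SucI)
      show "(flat m has_derivative (\<lambda>h. h * (flat (m + 2) x + (- m) * flat (m + 1) x))) (at x)" for x
        using flat_has_derivative[of m x] unfolding has_field_derivative_def
        by (rule has_derivative_eq_rhs) (auto simp: fun_eq_iff)
    next
      show "Ck_on k (\<lambda>x. b * (flat (m + 2) x + (- m) * flat (m + 1) x)) UNIV" for b
        by (intro Ck_on_mult Ck_on_const Ck_on_add Suc open_UNIV)
    qed auto
  qed
  then show ?thesis by (simp add: smooth_on_def)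
qed

text \<open>A smooth transition from 0 on t <= 0 to 1 on t >= 1. The denominator is positive because
  t > 0 or 1 - t > 0; it is written with \<open>powr (-1)\<close> so that
  \<open>smooth_on_powr\<close> applies.\<close>

definition step :: "real \<Rightarrow> real" where
  "step t = flat 0 t * (flat 0 t + flat 0 (1 - t)) powr (-1)"

lemma step_bounds: "0 \<le> step t" "step t \<le> 1" "t \<le> 0 \<Longrightarrow> step t = 0" "t \<ge> 1 \<Longrightarrow> step t = 1"
proof -
  have pos: "0 < flat 0 t + flat 0 (1 - t)"
    by (cases "t > 0") (auto simp: flat_def add_pos_nonneg)
  have nn: "0 \<le> flat 0 t" "0 \<le> flat 0 (1 - t)" by (auto simp: flat_def)
  have s: "step t = flat 0 t / (flat 0 t + flat 0 (1 - t))"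
    using pos by (simp add: step_def powr_minus divide_inverse)
  show "0 \<le> step t" "step t \<le> 1" using pos nn by (auto simp: s)
  show "step t = 0" if "t \<le> 0" using that by (simp add: step_def flat_def)
  show "step t = 1" if "t \<ge> 1"
  proof -
    have "flat 0 (1 - t) = 0" using that by (simp add: flat_def)
    then show ?thesis using pos by (simp add: s)
  qed
qed

lemma smooth_on_step: "smooth_on step UNIV"
proof -
  have pos: "0 < flat 0 t + flat 0 (1 - t)" for t
    by (cases "t > 0") (auto simp: flat_def add_pos_nonneg)
  have "smooth_on (\<lambda>t::real. 1 + (-1) * t) UNIV"
    by (intro smooth_on_add smooth_on_const smooth_on_mult smooth_on_linear bounded_linear_ident) auto
  then have "smooth_on (\<lambda>t. flat 0 (1 - t)) UNIV"
    using smooth_on_compose[OF _ smooth_on_flat[of 0], of UNIV "\<lambda>t. 1 + (-1) * t"] by simp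
  then have "smooth_on (\<lambda>t. flat 0 t * (flat 0 t + flat 0 (1 - t)) powr (-1)) UNIV"
    by (intro smooth_on_mult smooth_on_powr smooth_on_add smooth_on_flat pos) auto
  then show ?thesis by (simp add: step_def[abs_def])
qed

lemma smooth_on_dist_sq: "smooth_on (\<lambda>x::'a::euclidean_space. (norm (x - a))\<^sup>2) UNIV"
proof -
  have "smooth_on (\<lambda>x::'a. \<Sum>b\<in>Basis. ((x \<bullet> b) + (- (a \<bullet> b))) * ((x \<bullet> b) + (- (a \<bullet> b)))) UNIV"
    by (intro smooth_on_sum smooth_on_mult smooth_on_add smooth_on_const smooth_on_linear bounded_linear_intros) auto
  moreover have "(norm (x - a))\<^sup>2 = (\<Sum>b\<in>Basis. ((x \<bullet> b) + (- (a \<bullet> b))) * ((x \<bullet> b) + (- (a \<bullet> b))))" for x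
    unfolding power2_norm_eq_inner by (subst euclidean_inner) (simp add: inner_diff_left)
  ultimately show ?thesis by presburger
qed

text \<open>For 0 <= a < b this is 1 on the closed ball of radius a and 0 off the open ball of
  radius b. The squared norm makes the argument of \<open>step\<close> a polynomial, hence smooth
  also at the centre.\<close>

definition cutoff :: "'a::euclidean_space \<Rightarrow> real \<Rightarrow> real \<Rightarrow> 'a \<Rightarrow> real" where
  "cutoff x0 a b x = step ((b\<^sup>2 + (-1) * (norm (x - x0))\<^sup>2) * inverse (b\<^sup>2 - a\<^sup>2))"

lemma smooth_on_cutoff: "smooth_on (cutoff x0 a b) UNIV"
proof -
  have "smooth_on (\<lambda>x. (b\<^sup>2 + (-1) * (norm (x - x0))\<^sup>2) * inverse (b\<^sup>2 - a\<^sup>2)) UNIV"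
    by (intro smooth_on_mult smooth_on_add smooth_on_const smooth_on_dist_sq) auto
  from smooth_on_compose[OF _ smooth_on_step this] show ?thesis by (simp add: cutoff_def[abs_def])
qed

lemma cutoff_bounds: "0 \<le> cutoff x0 a b x" "cutoff x0 a b x \<le> 1"
  by (simp_all add: cutoff_def step_bounds)

lemma cutoff_eq_1: "0 \<le> a \<Longrightarrow> a < b \<Longrightarrow> x \<in> cball x0 a \<Longrightarrow> cutoff x0 a b x = 1"
  unfolding cutoff_def
  by (rule step_bounds(4))
    (simp add: divide_simps dist_norm norm_minus_commute power_strict_mono[of a b 2] flip: divide_inverse)

lemma cutoff_eq_0: "0 \<le> a \<Longrightarrow> a < b \<Longrightarrow> x \<notin> ball x0 b \<Longrightarrow> cutoff x0 a b x = 0"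
  unfolding cutoff_def
  by (rule step_bounds(3))
    (simp add: divide_simps dist_norm norm_minus_commute power_strict_mono[of a b 2] flip: divide_inverse)

lemma test_functionsI:
  assumes "smooth_on \<phi> UNIV" "compact S" "S \<subseteq> U" "\<And>x. x \<notin> S \<Longrightarrow> \<phi> x = 0"
  shows "\<phi> \<in> test_functions U"
proof -
  have "closure {x. \<phi> x \<noteq> 0} \<subseteq> S"
    using assms by (intro closure_minimal) (auto simp: compact_imp_closed)
  moreover have "compact (closure {x. \<phi> x \<noteq> 0})"
    using \<open>closure {x. \<phi> x \<noteq> 0} \<subseteq> S\<close> assms(2) closed_closure compact_Int_closed by (metis inf.absorb_iff2)
  ultimately show ?thesis using assms by (auto simp: test_functions_def smooth_on_def)
qed

lemma test_functionsD:
  assumes "\<phi> \<in> test_functions U"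
  shows "smooth_on \<phi> UNIV" "compact (closure {x. \<phi> x \<noteq> 0})" "closure {x. \<phi> x \<noteq> 0} \<subseteq> U"
    "\<And>x. x \<notin> closure {x. \<phi> x \<noteq> 0} \<Longrightarrow> \<phi> x = 0"
    "\<And>x. x \<notin> closure {x. \<phi> x \<noteq> 0} \<Longrightarrow> frechet_derivative \<phi> (at x) b = 0"
proof -
  show "smooth_on \<phi> UNIV" "compact (closure {x. \<phi> x \<noteq> 0})" "closure {x. \<phi> x \<noteq> 0} \<subseteq> U"
    using assms by (auto simp: test_functions_def smooth_on_def)
  define S where "S = closure {x. \<phi> x \<noteq> 0}"
  have "closed S" by (simp add: S_def)
  have z: "\<phi> x = 0" if "x \<notin> S" for x
    using that closure_subset[of "{x. \<phi> x \<noteq> 0}"] by (auto simp: S_def)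
  show "\<phi> x = 0" if "x \<notin> closure {x. \<phi> x \<noteq> 0}" for x
    by (rule z) (use that in \<open>simp only: S_def not_False_eq_True\<close>)
  have fz: "frechet_derivative \<phi> (at x) b = 0" if "x \<notin> S" for x
  proof -
    have "((\<lambda>_. 0) has_derivative (\<lambda>_. 0)) (at x)" by simp
    then have "(\<phi> has_derivative (\<lambda>_. 0)) (at x)"
      by (rule has_derivative_transform_within_open[of _ _ _ _ "- S"])
        (use that z \<open>closed S\<close> in \<open>auto simp: open_Compl\<close>)
    then show ?thesis using frechet_derivative_at by metis
  qed
  show "frechet_derivative \<phi> (at x) b = 0" if "x \<notin> closure {x. \<phi> x \<noteq> 0}" for x
    by (rule fz) (use that in \<open>simp only: S_def not_False_eq_True\<close>)
qed

section \<open>Changes of variables, and passage between \<open>lebesgue\<close> and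
  \<open>lborel\<close>\<close>

lemma lborel_distr_diff: "distr lborel borel (\<lambda>x::'a::euclidean_space. c - x) = lborel"
proof -
  have "distr lborel borel (\<lambda>x::'a. c + (-1) *\<^sub>R x) = lborel"
    using lborel_affine[of "-1" c] by (simp add: density_1)
  then show ?thesis by (simp add: algebra_simps)
qed

lemma
  fixes f :: "'a::euclidean_space \<Rightarrow> real"
  assumes [measurable]: "f \<in> borel_measurable borel"
  shows integrable_shift: "integrable lborel (\<lambda>x. f (c + x)) \<longleftrightarrow> integrable lborel f"
    and integral_shift: "(LINT x|lborel. f (c + x)) = (LINT x|lborel. f x)"
    and integrable_reflect: "integrable lborel (\<lambda>x. f (c - x)) \<longleftrightarrow> integrable lborel f"
    and integral_reflect: "(LINT x|lborel. f (c - x)) = (LINT x|lborel. f x)"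
proof -
  show "integrable lborel (\<lambda>x. f (c + x)) \<longleftrightarrow> integrable lborel f"
    using integrable_distr_eq[of "(+) c" lborel borel f] by (simp add: lborel_distr_plus)
  show "(LINT x|lborel. f (c + x)) = (LINT x|lborel. f x)"
    using integral_distr[of "(+) c" lborel borel f] by (simp add: lborel_distr_plus)
  show "integrable lborel (\<lambda>x. f (c - x)) \<longleftrightarrow> integrable lborel f"
    using integrable_distr_eq[of "\<lambda>x. c - x" lborel borel f] by (simp add: lborel_distr_diff)
  show "(LINT x|lborel. f (c - x)) = (LINT x|lborel. f x)"
    using integral_distr[of "\<lambda>x. c - x" lborel borel f] by (simp add: lborel_distr_diff)
qed

lemma lebesgue_borel_version:
  fixes g :: "'a::euclidean_space \<Rightarrow> 'b::euclidean_space"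
  assumes "g \<in> borel_measurable lebesgue"
  obtains g' where "g' \<in> borel_measurable borel" "AE x in lborel. g x = g' x"
proof -
  have "\<exists>h\<in>borel_measurable lborel. AE x in lborel. g x \<bullet> b = h x" for b
    using assms by (intro completion_ex_borel_measurable_real) auto
  then obtain h where h: "\<And>b. h b \<in> borel_measurable lborel" "\<And>b. AE x in lborel. g x \<bullet> b = h b x"
    by metis
  have "AE x in lborel. \<forall>b\<in>Basis. g x \<bullet> b = h b x"
    using h(2) by (intro AE_finite_allI) auto
  then have "AE x in lborel. g x = (\<Sum>b\<in>Basis. h b x *\<^sub>R b)"
    proof eventually_elim
    case (elim x)
    have "g x = (\<Sum>b\<in>Basis. (g x \<bullet> b) *\<^sub>R b)" by (simp only: euclidean_representation)
    also have "\<dots> = (\<Sum>b\<in>Basis. h b x *\<^sub>R b)" using elim by (intro sum.cong) auto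
    finally show ?case .
  qed
  moreover have "(\<lambda>x. \<Sum>b\<in>Basis. h b x *\<^sub>R b) \<in> borel_measurable borel"
    using h(1) by simp
  ultimately show ?thesis using that by blast
qed

text \<open>The definitions integrate over \<open>lebesgue\<close>, whose product with itself is not
  complete, whereas \<open>lborel\<close> is compatible with products. All analysis is therefore
  done with Borel representatives over \<open>lborel\<close> and carried back by these two
  facts.\<close>

lemma
  fixes f g :: "'a::euclidean_space \<Rightarrow> real"
  assumes "g \<in> borel_measurable borel" "AE x in lborel. f x = g x"
  shows integrable_lebesgue_lborel: "integrable lebesgue f \<longleftrightarrow> integrable lborel g"
    and integral_lebesgue_lborel: "integral\<^sup>L lebesgue f = integral\<^sup>L lborel g"
proof -
  have m: "g \<in> borel_measurable lborel" "g \<in> borel_measurable lebesgue"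
    using assms(1) by (auto intro: measurable_completion)
  have ae: "AE x in lebesgue. g x = f x"
    using AE_completion[OF assms(2)] by (auto elim: eventually_mono)
  then have mf: "f \<in> borel_measurable lebesgue"
    by (rule borel_measurable_AE[OF m(2)])
  show "integrable lebesgue f \<longleftrightarrow> integrable lborel g"
    using integrable_cong_AE[OF m(2) mf ae] integrable_completion[OF m(1)] by simp
  show "integral\<^sup>L lebesgue f = integral\<^sup>L lborel g"
    using integral_cong_AE[OF m(2) mf ae] integral_completion[OF m(1)] by simp
qed

text \<open>The cylinder over a null set is null. This carries an almost-everywhere equality in one
  variable to the integrability condition on the product space in
  \<open>weak_form_meaningful\<close>.\<close>

lemma AE_pair_fst:
  assumes "AE x in lborel. P (x::'a::euclidean_space)"
  shows "AE z in (lborel :: ('a \<times> 'b::euclidean_space) measure). P (fst z)"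
proof -
  obtain N where N: "N \<in> null_sets lborel" "\<And>x. x \<in> space lborel - N \<Longrightarrow> P x"
    using AE_E3[OF assms] by blast
  have "N \<times> UNIV \<in> null_sets (lborel \<Otimes>\<^sub>M lborel :: ('a \<times> 'b) measure)"
    using N by (intro lborel.times_in_null_sets1) auto
  then have "N \<times> UNIV \<in> null_sets (lborel :: ('a \<times> 'b) measure)" by (simp add: lborel_prod)
  then show ?thesis by (rule AE_I') (use N(2) in force)
qed

lemma AE_pair_snd:
  assumes "AE x in lborel. P (x::'b::euclidean_space)"
  shows "AE z in (lborel :: ('a::euclidean_space \<times> 'b) measure). P (snd z)"
proof -
  obtain N where N: "N \<in> null_sets lborel" "\<And>x. x \<in> space lborel - N \<Longrightarrow> P x"
    using AE_E3[OF assms] by blast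
  have "UNIV \<times> N \<in> null_sets (lborel \<Otimes>\<^sub>M lborel :: ('a \<times> 'b) measure)"
    using N by (intro lborel.times_in_null_sets2) auto
  then have "UNIV \<times> N \<in> null_sets (lborel :: ('a \<times> 'b) measure)" by (simp add: lborel_prod)
  then show ?thesis by (rule AE_I') (use N(2) in force)
qed

lemma ball_borel [measurable]: "ball (a::'a::euclidean_space) r \<in> sets borel"
  by simp

subsection \<open>Integrability of powers of the norm\<close>

text \<open>Almost everywhere f is at most the sum over j of \<open>a j\<close> times the indicator
  of the ball of radius \<open>R j\<close>, whose volume is a constant times
  \<open>R j ^ DIM('a)\<close>. The origin is exempt so that singular functions are covered.\<close>

lemma integrable_dyadic:
  fixes f :: "'a::euclidean_space \<Rightarrow> real"
  assumes [measurable]: "f \<in> borel_measurable borel" and "\<And>x. 0 \<le> f x"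
    and dom: "\<And>x. f x \<noteq> 0 \<Longrightarrow> x \<noteq> 0 \<Longrightarrow> \<exists>j. norm x < R j \<and> f x \<le> a j"
    and nn: "\<And>j. 0 \<le> a j" "\<And>j. 0 \<le> R j" and sm: "summable (\<lambda>j. a j * R j ^ DIM('a))"
  shows "integrable lborel f"
proof -
  let ?c = "unit_ball_vol (real DIM('a))"
  have c: "0 \<le> ?c" by simp
  have "AE x in lborel. x \<noteq> (0::'a)" by (rule AE_lborel_singleton)
  then have ae: "AE x in lborel. ennreal (f x) \<le> (\<Sum>j. ennreal (a j) * indicator (ball 0 (R j)) x)"
  proof eventually_elim
    fix x :: 'a assume x: "x \<noteq> 0"
    show "ennreal (f x) \<le> (\<Sum>j. ennreal (a j) * indicator (ball 0 (R j)) x)"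
    proof (cases "f x = 0")
      case False
      then obtain j where j: "norm x < R j" "f x \<le> a j" using dom x by blast
      have "ennreal (f x) \<le> ennreal (a j) * indicator (ball 0 (R j)) x"
        using j by (simp add: ennreal_leI)
      also have "\<dots> \<le> (\<Sum>j. ennreal (a j) * indicator (ball 0 (R j)) x)"
        using sum_le_suminf[OF summableI, of "{j}" "\<lambda>j. ennreal (a j) * indicator (ball 0 (R j)) x"]
        by (simp del: sum_mult_indicator)
      finally show ?thesis .
    qed simp
  qed
  have "(\<integral>\<^sup>+x. f x \<partial>lborel) \<le> (\<integral>\<^sup>+x. (\<Sum>j. ennreal (a j) * indicator (ball (0::'a) (R j)) x) \<partial>lborel)"
    by (rule nn_integral_mono_AE) (rule ae)
  also have "\<dots> = (\<Sum>j. ennreal (a j) * emeasure lborel (ball (0::'a) (R j)))"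
  proof (subst nn_integral_suminf)
    show "(\<lambda>x. ennreal (a i) * indicator (ball 0 (R i)) x) \<in> borel_measurable (lborel::'a measure)" for i
      by measurable
  qed (simp add: nn_integral_cmult_indicator)
  also have "\<dots> = (\<Sum>j. ennreal (?c * (a j * R j ^ DIM('a))))"
  proof -
    have "ennreal (a j) * emeasure lborel (ball (0::'a) (R j)) = ennreal (?c * (a j * R j ^ DIM('a)))" for j
      unfolding emeasure_ball[OF nn(2)]
      by (subst ennreal_mult[symmetric]) (use nn c in \<open>auto intro!: arg_cong[where f=ennreal]\<close>)
    then show ?thesis by simp
  qed
  also have "\<dots> = ennreal (\<Sum>j. ?c * (a j * R j ^ DIM('a)))"
    using nn c sm by (intro suminf_ennreal2) (auto intro!: summable_mult)
  finally have "(\<integral>\<^sup>+x. f x \<partial>lborel) < \<infinity>" by (metis ennreal_less_top infinity_ennreal_def le_less_trans)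
  then show ?thesis using assms(2) by (intro integrableI_nonneg) auto
qed

lemma integrable_norm_powr_near_0:
  fixes \<alpha> \<rho> :: real
  assumes "0 < \<alpha>" "0 < \<rho>"
  shows "integrable lborel (\<lambda>x::'a::euclidean_space. indicator (ball 0 \<rho>) x * norm x powr (\<alpha> - real DIM('a)))"
proof (rule integrable_dyadic)
  let ?N = "real DIM('a)"
  let ?R = "\<lambda>j::nat. \<rho> * 2 powr - real j"
  fix x :: 'a assume "indicator (ball 0 \<rho>) x * norm x powr (\<alpha> - ?N) \<noteq> 0" "x \<noteq> 0"
  then have x: "0 < norm x" "norm x < \<rho>" by (auto simp: indicator_def split: if_splits)
  define t where "t = log 2 (\<rho> / norm x)"
  have t0: "0 < t" using x assms by (simp add: t_def log_def ln_div)
  \<comment> \<open>Ceiling minus one, not floor: j < t must be strict for x to lie in the open ball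
    of radius \<open>\<rho> * 2 powr - real j\<close>.\<close>
  define j where "j = nat (\<lceil>t\<rceil> - 1)"
  have j: "real j < t" "t \<le> real j + 1" using t0 by (auto simp: j_def) linarith+
  have nx: "norm x = \<rho> * 2 powr - t"
    using x assms by (simp add: t_def powr_minus)
  have 1: "norm x < ?R j" using j(1) assms by (simp add: nx)
  \<comment> \<open>The exponent \<open>\<alpha>\<close> - N can have either sign. After splitting,
    the increasing factor is bounded by the outer radius of the dyadic shell and the decreasing one
    by the inner radius.\<close>
  have "norm x powr (\<alpha> - ?N) = norm x powr \<alpha> * norm x powr (- ?N)" by (simp flip: powr_add)
  also have "\<dots> \<le> ?R j powr \<alpha> * (\<rho> * 2 powr - (real j + 1)) powr (- ?N)"
    using 1 assms x j by (intro mult_mono powr_mono2 powr_mono2') (auto simp: nx)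
  finally show "\<exists>j. norm x < ?R j \<and> indicator (ball 0 \<rho>) x * norm x powr (\<alpha> - ?N)
      \<le> ?R j powr \<alpha> * (\<rho> * 2 powr - (real j + 1)) powr (- ?N)"
    using 1 x by auto
next
  let ?N = "real DIM('a)"
  have eq: "(\<rho> * 2 powr - real j) powr \<alpha> * (\<rho> * 2 powr - (real j + 1)) powr (- ?N)
      * (\<rho> * 2 powr - real j) ^ DIM('a) = (\<rho> powr \<alpha> * 2 powr ?N) * (2 powr - \<alpha>) ^ j" for j :: nat
    using assms by (simp add: powr_mult powr_powr powr_realpow[symmetric] algebra_simps flip: powr_add)
  have "summable (\<lambda>j::nat. (\<rho> powr \<alpha> * 2 powr ?N) * (2 powr - \<alpha>) ^ j)"
    using assms by (intro summable_mult summable_geometric) (simp add: powr_minus_divide)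
  then show "summable (\<lambda>j::nat. (\<rho> * 2 powr - real j) powr \<alpha> * (\<rho> * 2 powr - (real j + 1)) powr (- ?N)
      * (\<rho> * 2 powr - real j) ^ DIM('a))"
    by (simp only: eq)
  show "(\<lambda>x::'a. indicator (ball 0 \<rho>) x * norm x powr (\<alpha> - ?N)) \<in> borel_measurable borel"
    by measurable
qed (use assms in auto)

text \<open>On the shell 2^j <= 1 + |x| < 2^(j+1) the integrand is at most 2^(-j (N +
  \<open>\<gamma>\<close>)), while the ball containing the shell has volume of order 2^(j N); a
  geometric series with ratio 2^(-\<open>\<gamma>\<close>) remains.\<close>

lemma integrable_norm_powr_tail:
  fixes \<gamma> :: real
  assumes "0 < \<gamma>"
  shows "integrable lborel (\<lambda>x::'a::euclidean_space. (1 + norm x) powr (- (real DIM('a) + \<gamma>)))"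
proof (rule integrable_dyadic)
  let ?N = "real DIM('a)"
  fix x :: 'a
  define t where "t = log 2 (1 + norm x)"
  have t0: "0 \<le> t" by (simp add: t_def log_def)
  define j where "j = nat \<lfloor>t\<rfloor>"
  have j: "real j \<le> t" "t < real j + 1" using t0 by (auto simp: j_def)
  have nx: "1 + norm x = 2 powr t" by (simp add: t_def add_pos_nonneg)
  have "1 + norm x < 2 powr (real j + 1)" using j by (simp add: nx)
  then have 1: "norm x < 2 powr (real j + 1)" by simp
  have "(1 + norm x) powr (- (?N + \<gamma>)) \<le> (2 powr real j) powr (- (?N + \<gamma>))"
    using j assms unfolding nx by (intro powr_mono2') auto
  then show "\<exists>j::nat. norm x < 2 powr (real j + 1) \<and> (1 + norm x) powr (- (?N + \<gamma>)) \<le> (2 powr real j) powr (- (?N + \<gamma>))"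
    using 1 by blast
next
  let ?N = "real DIM('a)"
  have eq: "(2 powr real j) powr (- (?N + \<gamma>)) * (2 powr (real j + 1)) ^ DIM('a)
      = 2 powr ?N * (2 powr - \<gamma>) ^ j" for j :: nat
    by (simp add: powr_powr powr_realpow[symmetric] algebra_simps flip: powr_add)
  have "summable (\<lambda>j::nat. 2 powr ?N * (2 powr - \<gamma>) ^ j)"
    using assms by (intro summable_mult summable_geometric) (simp add: powr_minus_divide)
  then show "summable (\<lambda>j::nat. (2 powr real j) powr (- (?N + \<gamma>)) * (2 powr (real j + 1)) ^ DIM('a))"
    by (simp only: eq)
qed auto

subsection \<open>Bounding an \<open>L\<^sup>1\<close> norm by duality with smooth functions\<close>

text \<open>The L^1 norm of h is its integral against sgn h. The sign is an almost-everywhere limit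
  of continuous functions, and on the compact set B these are uniformly close to polynomials, which
  are smooth everywhere; the bound M passes to the limit. This does the work usually done by
  mollification.\<close>

lemma integral_abs_le_by_smooth:
  fixes h :: "'a::euclidean_space \<Rightarrow> real"
  assumes "integrable lborel h" "compact B" "\<And>x. x \<notin> B \<Longrightarrow> h x = 0"
    and M: "\<And>P. smooth_on P UNIV \<Longrightarrow> (\<And>x. x \<in> B \<Longrightarrow> \<bar>P x\<bar> \<le> 1) \<Longrightarrow> (LINT x|lborel. h x * P x) \<le> M"
  shows "(LINT x|lborel. \<bar>h x\<bar>) \<le> M"
proof -
  have mh: "h \<in> borel_measurable borel" using assms(1) by auto
  have "(\<lambda>x. sgn (h x)) \<in> borel_measurable lebesgue"
    using mh by (intro measurable_completion) simp
  then have "(\<lambda>x. sgn (h x)) measurable_on UNIV"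
    using measurable_on_iff_borel_measurable[of UNIV "\<lambda>x. sgn (h x)"]
    by (simp add: lebesgue_on_UNIV_eq)
  then obtain N g where N: "negligible N" and g: "\<And>n. continuous_on UNIV (g n)"
    and lim: "\<And>x. x \<notin> N \<Longrightarrow> (\<lambda>n. g n x) \<longlonglongrightarrow> sgn (h x)"
    by (auto simp: measurable_on_def)
  \<comment> \<open>Clamping to [-1, 1] keeps the limit, since sgn h takes its values there, and
    provides the domination.\<close>
  define c where "c n x = max (-1) (min 1 (g n x))" for n :: nat and x
  have cont: "continuous_on B (c n)" for n
    unfolding c_def by (intro continuous_intros continuous_on_subset[OF g]) auto
  have clim: "(\<lambda>n. c n x) \<longlonglongrightarrow> sgn (h x)" if "x \<notin> N" for x
  proof -
    have "(\<lambda>n. c n x) \<longlonglongrightarrow> max (-1) (min 1 (sgn (h x)))"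
      unfolding c_def by (intro tendsto_intros lim that)
    moreover have "max (-1) (min 1 (sgn (h x))) = sgn (h x)" by (simp add: sgn_if)
    ultimately show ?thesis by simp
  qed
  have "\<exists>P. real_polynomial_function P \<and> (\<forall>x\<in>B. \<bar>c n x - P x\<bar> < 1 / (real n + 1))" for n :: nat
  proof -
    have "0 < 1 / (real n + 1)" by simp
    from Stone_Weierstrass_real_polynomial_function[OF assms(2) cont[of n] this]
    obtain P where "real_polynomial_function P" "\<And>x. x \<in> B \<Longrightarrow> \<bar>c n x - P x\<bar> < 1 / (real n + 1)" by metis
    then show ?thesis by (auto intro!: exI[of _ P] simp: add.commute)
  qed
  then obtain P where P: "\<And>n. real_polynomial_function (P n)" "\<And>n x. x \<in> B \<Longrightarrow> \<bar>c n x - P n x\<bar> < 1 / (real n + 1)"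
    by metis
  \<comment> \<open>The approximation error may push P slightly beyond 1 on B; this factor restores
    the bound demanded of the functions tested in M, and it tends to 1.\<close>
  define Q where "Q n x = (inverse (1 + 1 / (real n + 1))) * P n x" for n x
  have smQ: "smooth_on (Q n) UNIV" for n
    unfolding Q_def by (intro smooth_on_mult smooth_on_const smooth_on_polynomial P) auto
  have Pb: "\<bar>P n x\<bar> \<le> 1 + 1 / (real n + 1)" if "x \<in> B" for n x
  proof -
    have "\<bar>c n x\<bar> \<le> 1" by (auto simp: c_def)
    then show ?thesis using P(2)[OF that, of n] by linarith
  qed
  have Qb: "\<bar>Q n x\<bar> \<le> 1" if "x \<in> B" for n x
  proof -
    have "0 < 1 + 1 / (real n + 1)" by (simp add: add_pos_nonneg)
    then show ?thesis using Pb[OF that, of n] by (simp add: Q_def abs_mult divide_simps mult.commute)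
  qed
  have inv0: "(\<lambda>n. 1 / (real n + 1)) \<longlonglongrightarrow> 0"
    using LIMSEQ_inverse_real_of_nat by (simp add: inverse_eq_divide add.commute)
  have Qlim: "(\<lambda>n. Q n x) \<longlonglongrightarrow> sgn (h x)" if "x \<notin> N" "x \<in> B" for x
  proof -
    have "(\<lambda>n. c n x - P n x) \<longlonglongrightarrow> 0"
      by (rule Lim_null_comparison[OF _ inv0]) (use P(2)[OF that(2)] in \<open>auto intro!: always_eventually less_imp_le\<close>)
    from tendsto_diff[OF clim[OF that(1)] this] have "(\<lambda>n. P n x) \<longlonglongrightarrow> sgn (h x)" by simp
    moreover have "(\<lambda>n. inverse (1 + 1 / (real n + 1))) \<longlonglongrightarrow> inverse (1 + 0)"
      by (intro tendsto_intros inv0) auto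
    ultimately show ?thesis unfolding Q_def using tendsto_mult by fastforce
  qed
  have "(\<lambda>n. LINT x|lborel. h x * Q n x) \<longlonglongrightarrow> (LINT x|lborel. \<bar>h x\<bar>)"
  proof (rule integral_dominated_convergence[where w="\<lambda>x. \<bar>h x\<bar>"])
    have "Q n \<in> borel_measurable borel" for n
      using smooth_on_continuous[OF smQ] by (rule borel_measurable_continuous_onI)
    then show "(\<lambda>x. h x * Q n x) \<in> borel_measurable lborel" for n using mh by simp
    have "AE x in lborel. x \<notin> N"
      using N by (metis AE_completion_iff AE_not_in negligible_iff_null_sets)
    then show "AE x in lborel. (\<lambda>n. h x * Q n x) \<longlonglongrightarrow> \<bar>h x\<bar>"
    proof eventually_elim
      case (elim x)
      show ?case
      proof (cases "x \<in> B")
        case True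
        from tendsto_mult_left[OF Qlim[OF elim True], of "h x"] show ?thesis
          by (simp add: abs_sgn)
      qed (simp add: assms(3))
    qed
    show "AE x in lborel. norm (h x * Q n x) \<le> \<bar>h x\<bar>" for n
    proof (intro always_eventually allI)
      fix x show "norm (h x * Q n x) \<le> \<bar>h x\<bar>"
        using Qb[of x n] assms(3)[of x] by (cases "x \<in> B") (auto simp: abs_mult mult_left_le)
    qed
  qed (use assms(1) mh in auto)
  then show ?thesis
    by (rule LIMSEQ_le_const2) (use M[OF smQ Qb] in auto)
qed

section \<open>Locally integrable functions paired with test functions\<close>

definition loc_int :: "('a::euclidean_space \<Rightarrow> 'b::euclidean_space) \<Rightarrow> bool" where
  "loc_int g \<longleftrightarrow> g \<in> borel_measurable borel \<and>
     (\<forall>C. compact C \<longrightarrow> integrable lborel (\<lambda>x. indicator C x * norm (g x)))"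

lemma loc_intD:
  assumes "loc_int g"
  shows "g \<in> borel_measurable borel" "compact C \<Longrightarrow> integrable lborel (\<lambda>x. indicator C x * norm (g x))"
  using assms by (auto simp: loc_int_def)

lemma loc_int_const: "loc_int (\<lambda>x::'a::euclidean_space. c::'b::euclidean_space)"
  unfolding loc_int_def
proof (intro conjI allI impI)
  fix C :: "'a set" assume "compact C"
  then have "integrable lborel (\<lambda>x. indicator C x :: real)"
    by (intro integrable_real_indicator) (auto simp: borel_compact emeasure_compact_finite[unfolded infinity_ennreal_def])
  then show "integrable lborel (\<lambda>x. indicator C x * norm c)" by simp
qed simp

lemma loc_int_inner: "loc_int g \<Longrightarrow> loc_int (\<lambda>x. g x \<bullet> b)"
  unfolding loc_int_def
proof (safe)
  fix C :: "'a set" assume C: "compact C" and g: "\<forall>C. compact C \<longrightarrow> integrable lborel (\<lambda>x. indicator C x * norm (g x))"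
    and [measurable]: "g \<in> borel_measurable borel"
  have [measurable]: "C \<in> sets borel" using C by (rule borel_compact)
  have "integrable lborel (\<lambda>x. indicator C x * norm (g x) * norm b)" using g C by simp
  then show "integrable lborel (\<lambda>x. indicator C x * norm (g x \<bullet> b))"
    by (rule Bochner_Integration.integrable_bound)
      (auto simp: indicator_def Cauchy_Schwarz_ineq2)
qed simp

lemma integrable_loc_mult:
  fixes v g :: "'a::euclidean_space \<Rightarrow> real"
  assumes v: "loc_int v" and "compact C" and [measurable]: "g \<in> borel_measurable borel"
    and "\<And>x. x \<in> C \<Longrightarrow> \<bar>g x\<bar> \<le> M" "\<And>x. x \<notin> C \<Longrightarrow> g x = 0"
  shows "integrable lborel (\<lambda>x. v x * g x)"
proof -
  have [measurable]: "v \<in> borel_measurable borel" using v by (simp add: loc_int_def)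
  have "integrable lborel (\<lambda>x. indicator C x * norm (v x) * M)" using v \<open>compact C\<close> by (simp add: loc_int_def)
  then show ?thesis
  proof (rule Bochner_Integration.integrable_bound)
    show "AE x in lborel. norm (v x * g x) \<le> norm (indicator C x * norm (v x) * M)"
    proof (intro always_eventually allI)
      fix x
      show "norm (v x * g x) \<le> norm (indicator C x * norm (v x) * M)"
        using assms(4)[of x] assms(5)[of x]
        by (cases "x \<in> C") (auto simp: abs_mult intro!: mult_left_mono)
    qed
  qed simp
qed

lemma loc_int_zero_off:
  fixes v :: "'a::euclidean_space \<Rightarrow> real"
  assumes "loc_int v" "compact C" "\<And>x. x \<notin> C \<Longrightarrow> v x = 0"
  shows "integrable lborel v"
proof -
  have [measurable]: "C \<in> sets borel" using assms by (auto intro: borel_compact)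
  have "integrable lborel (\<lambda>x. v x * indicator C x)"
    by (rule integrable_loc_mult[OF assms(1,2), where M=1]) (auto simp: indicator_def)
  moreover have "(\<lambda>x. v x * indicator C x) = v" using assms(3) by (force simp: indicator_def fun_eq_iff)
  ultimately show ?thesis by simp
qed

lemma smooth_borel: "smooth_on f UNIV \<Longrightarrow> f \<in> borel_measurable borel"
  by (rule borel_measurable_continuous_onI) (rule smooth_on_continuous)

lemma bounded_on_compact:
  fixes f :: "'a::euclidean_space \<Rightarrow> real"
  assumes "continuous_on C f" "compact C"
  obtains M where "0 \<le> M" "\<And>x. x \<in> C \<Longrightarrow> \<bar>f x\<bar> \<le> M"
proof -
  have "bounded (f ` C)" using assms compact_continuous_image compact_imp_bounded by blast
  then obtain M where "\<forall>x\<in>C. norm (f x) \<le> M" by (auto simp: bounded_iff)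
  then show ?thesis using that[of "max M 0"] by fastforce
qed

lemma frechet_derivative_basis_sum:
  assumes "smooth_on \<phi> UNIV"
  shows "frechet_derivative \<phi> (at x) z = (\<Sum>b\<in>Basis. (z \<bullet> b) * frechet_derivative \<phi> (at x) b)"
proof -
  have lin: "linear (frechet_derivative \<phi> (at x))"
    using smooth_onD[OF assms, of x] has_derivative_linear by auto
  have "frechet_derivative \<phi> (at x) z = frechet_derivative \<phi> (at x) (\<Sum>b\<in>Basis. (z \<bullet> b) *\<^sub>R b)"
    by (simp only: euclidean_representation)
  also have "\<dots> = (\<Sum>b\<in>Basis. (z \<bullet> b) * frechet_derivative \<phi> (at x) b)"
    using lin by (simp add: linear_sum linear_cmul)
  finally show ?thesis .
qed

lemma test_function_bounds:
  assumes "\<phi> \<in> test_functions (UNIV::'a::euclidean_space set)"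
  obtains M where "0 \<le> M" "\<And>x z. \<bar>frechet_derivative \<phi> (at x) z\<bar> \<le> M * norm z"
    "\<And>x y. \<bar>\<phi> x - \<phi> y\<bar> \<le> M * norm (x - y)" "\<And>x. \<bar>\<phi> x\<bar> \<le> M"
proof -
  define S where "S = closure {x. \<phi> x \<noteq> 0}"
  have sm: "smooth_on \<phi> UNIV" and "compact S" and out: "\<And>x. x \<notin> S \<Longrightarrow> \<phi> x = 0"
      "\<And>x b. x \<notin> S \<Longrightarrow> frechet_derivative \<phi> (at x) b = 0"
    using test_functionsD[OF assms] unfolding S_def by blast+
  have "\<exists>M\<ge>0. \<forall>x\<in>S. \<bar>frechet_derivative \<phi> (at x) b\<bar> \<le> M" if "b \<in> Basis" for b
    using bounded_on_compact[OF continuous_on_subset[OF smooth_on_continuous[OF smooth_on_frechet_derivative[OF sm that]]] \<open>compact S\<close>]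
    by (metis top_greatest)
  then obtain N where N: "\<And>b. b \<in> Basis \<Longrightarrow> 0 \<le> N b" 
      "\<And>b x. b \<in> Basis \<Longrightarrow> x \<in> S \<Longrightarrow> \<bar>frechet_derivative \<phi> (at x) b\<bar> \<le> N b"
    by metis
  obtain M0 where M0: "0 \<le> M0" "\<And>x. x \<in> S \<Longrightarrow> \<bar>\<phi> x\<bar> \<le> M0"
    using bounded_on_compact[OF continuous_on_subset[OF smooth_on_continuous[OF sm]] \<open>compact S\<close>] by auto
  have NN: "\<bar>frechet_derivative \<phi> (at x) b\<bar> \<le> N b" if "b \<in> Basis" for b x
    using N[OF that] out(2)[of x b] by (cases "x \<in> S") auto
  define M where "M = M0 + sum N Basis"
  have fb: "\<bar>frechet_derivative \<phi> (at x) z\<bar> \<le> sum N Basis * norm z" for x z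
  proof -
    have "\<bar>frechet_derivative \<phi> (at x) z\<bar> \<le> (\<Sum>b\<in>Basis. \<bar>(z \<bullet> b) * frechet_derivative \<phi> (at x) b\<bar>)"
      unfolding frechet_derivative_basis_sum[OF sm, of x z] by (rule sum_abs)
    also have "\<dots> \<le> (\<Sum>b\<in>Basis. norm z * N b)"
      unfolding abs_mult by (intro sum_mono mult_mono NN Basis_le_norm) auto
    finally show ?thesis by (simp add: sum_distrib_left mult.commute)
  qed
  have sN: "0 \<le> sum N Basis" using N(1) by (rule sum_nonneg)
  have lip: "\<bar>\<phi> x - \<phi> y\<bar> \<le> sum N Basis * norm (x - y)" for x y
  proof -
    have "norm (\<phi> x - \<phi> y) \<le> sum N Basis * norm (x - y)"
    proof (rule differentiable_bound[of UNIV])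
      show "onorm (frechet_derivative \<phi> (at x)) \<le> sum N Basis" for x
        by (rule onorm_bound) (use sN fb in auto)
    qed (use smooth_onD[OF sm] in auto)
    then show ?thesis by simp
  qed
  show ?thesis
  proof (rule that[of M])
    show "0 \<le> M" using M0(1) sN by (simp add: M_def)
    show "\<bar>frechet_derivative \<phi> (at x) z\<bar> \<le> M * norm z" for x z
      by (rule order_trans[OF fb]) (simp add: M_def M0 mult_right_mono)
    show "\<bar>\<phi> x - \<phi> y\<bar> \<le> M * norm (x - y)" for x y
      by (rule order_trans[OF lip]) (simp add: M_def M0 mult_right_mono)
    show "\<bar>\<phi> x\<bar> \<le> M" for x
      using M0(2)[of x] out(1)[of x] sN M0(1) by (cases "x \<in> S") (auto simp: M_def)
  qed
qed

lemma integrable_loc_test: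
  assumes "loc_int v" "\<phi> \<in> test_functions UNIV"
  shows "integrable lborel (\<lambda>x. v x * \<phi> x)"
    and "integrable lborel (\<lambda>x. v x * frechet_derivative \<phi> (at x) z)"
proof -
  obtain M where M: "0 \<le> M" "\<And>x z. \<bar>frechet_derivative \<phi> (at x) z\<bar> \<le> M * norm z"
    "\<And>x y. \<bar>\<phi> x - \<phi> y\<bar> \<le> M * norm (x - y)" "\<And>x. \<bar>\<phi> x\<bar> \<le> M"
    using test_function_bounds[OF assms(2)] by blast
  note T = test_functionsD[OF assms(2)]
  show "integrable lborel (\<lambda>x. v x * \<phi> x)"
    by (rule integrable_loc_mult[OF assms(1) T(2) smooth_borel[OF T(1)] M(4)]) (rule T(4))
  have "(\<lambda>x. frechet_derivative \<phi> (at x) z) \<in> borel_measurable borel"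
    unfolding frechet_derivative_basis_sum[OF T(1), of _ z]
    by (intro borel_measurable_sum borel_measurable_times borel_measurable_const smooth_borel smooth_on_frechet_derivative[OF T(1)])
  then show "integrable lborel (\<lambda>x. v x * frechet_derivative \<phi> (at x) z)"
    by (rule integrable_loc_mult[OF assms(1) T(2) _ M(2)]) (rule T(5))
qed

lemma has_derivative_translate:
  assumes "(f has_derivative f') (at (x - c))"
  shows "((\<lambda>x. f (x - c)) has_derivative f') (at (x::'a::euclidean_space))"
proof -
  have "((\<lambda>x. x - c) has_derivative (\<lambda>h. h - 0)) (at x)" by (intro derivative_intros)
  then have "((\<lambda>x. x - c) has_derivative (\<lambda>h. h)) (at x)" by simp
  from has_derivative_compose[OF this assms] show ?thesis .
qed

lemma smooth_on_translate:
  assumes "smooth_on f UNIV"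
  shows "smooth_on (\<lambda>x. f (x - c)) UNIV"
proof -
  have "Ck_on k (\<lambda>x. f (x - c)) UNIV" if "Ck_on k f UNIV" for k
    using that
  proof (induction k arbitrary: f)
    case 0
    then show ?case by (auto intro!: continuous_on_compose2[of UNIV f] continuous_intros)
  next
    case (Suc k)
    show ?case
      by (rule Ck_on_SucI[where f'="\<lambda>x. frechet_derivative f (at (x - c))"])
        (use Suc in \<open>auto intro!: has_derivative_translate simp flip: frechet_derivative_works\<close>)
  qed
  then show ?thesis using assms by (simp add: smooth_on_def)
qed

lemma frechet_derivative_translate:
  assumes "smooth_on f UNIV"
  shows "frechet_derivative (\<lambda>x. f (x - c)) (at x) = frechet_derivative f (at (x - c))"
  using frechet_derivative_at[OF has_derivative_translate[OF smooth_onD[OF assms UNIV_I]]] by simp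

lemma test_functions_translate:
  assumes "\<phi> \<in> test_functions UNIV"
  shows "(\<lambda>x. \<phi> (x - c)) \<in> test_functions UNIV"
proof (rule test_functionsI)
  let ?S = "closure {x. \<phi> x \<noteq> 0}"
  note T = test_functionsD[OF assms]
  show "smooth_on (\<lambda>x. \<phi> (x - c)) UNIV" by (rule smooth_on_translate[OF T(1)])
  show "compact ((\<lambda>x. x + c) ` ?S)" using T(2) by (intro compact_continuous_image continuous_intros)
  show "\<phi> (x - c) = 0" if "x \<notin> (\<lambda>x. x + c) ` ?S" for x
    by (rule T(4)) (use that in \<open>force simp: image_iff\<close>)
qed simp

text \<open>Differentiation under the integral sign: the derivative falls on \<open>\<phi>\<close>,
  so local integrability of v suffices. The difference quotients are dominated by a constant times
  |v| on one compact set that contains all translated supports.\<close>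

lemma has_derivative_integral_translate:
  assumes v: "loc_int v" and \<phi>: "\<phi> \<in> test_functions UNIV"
  shows "((\<lambda>t. LINT x|lborel. v x * \<phi> (x - t *\<^sub>R z)) has_real_derivative
           - (LINT x|lborel. v x * frechet_derivative \<phi> (at (x - t *\<^sub>R z)) z)) (at t)"
  unfolding has_field_derivative_iff tendsto_at_iff_sequentially
proof (intro allI impI)
  fix X :: "nat \<Rightarrow> real" assume X: "\<forall>i. X i \<in> UNIV - {t}" "X \<longlonglongrightarrow> t"
  obtain M where M: "0 \<le> M" "\<And>x z. \<bar>frechet_derivative \<phi> (at x) z\<bar> \<le> M * norm z"
    "\<And>x y. \<bar>\<phi> x - \<phi> y\<bar> \<le> M * norm (x - y)" "\<And>x. \<bar>\<phi> x\<bar> \<le> M"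
    using test_function_bounds[OF \<phi>] by blast
  note T = test_functionsD[OF \<phi>]
  obtain a where a: "\<And>x. x \<in> closure {x. \<phi> x \<noteq> 0} \<Longrightarrow> norm x \<le> a"
    using compact_imp_bounded[OF T(2)] by (auto simp: bounded_iff)
  obtain B where B: "\<And>n. \<bar>X n\<bar> \<le> B" using Bseq_def convergent_imp_Bseq X(2) convergentI by (metis real_norm_def)
  \<comment> \<open>Here a bounds the support of \<open>\<phi>\<close> and B the sequence X, so this
    ball contains the supports of the translates by \<open>X n *\<^sub>R z\<close> and by
    \<open>t *\<^sub>R z\<close>.\<close>
  define C where "C = cball (0::'a) (a + (B + \<bar>t\<bar>) * norm z)"
  have B0: "0 \<le> B" using B[of 0] by linarith
  have out: "\<phi> (x - s *\<^sub>R z) = 0" if "x \<notin> C" "\<bar>s\<bar> \<le> B + \<bar>t\<bar>" for x s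
  proof (rule T(4), rule notI)
    assume "x - s *\<^sub>R z \<in> closure {x. \<phi> x \<noteq> 0}"
    from a[OF this] have "norm x \<le> a + norm (s *\<^sub>R z)"
      using norm_triangle_sub[of x "s *\<^sub>R z"] by linarith
    also have "\<dots> \<le> a + (B + \<bar>t\<bar>) * norm z" using that(2) by (simp add: mult_right_mono)
    finally show False using that(1) by (simp add: C_def)
  qed
  have mv: "v \<in> borel_measurable borel" and m\<phi>: "\<phi> \<in> borel_measurable borel"
    using loc_intD[OF v] smooth_borel[OF T(1)] by auto
  have m\<phi>': "(\<lambda>x. frechet_derivative \<phi> (at (x - t *\<^sub>R z)) z) \<in> borel_measurable borel"
    unfolding frechet_derivative_basis_sum[OF T(1), of _ z]
    by (intro borel_measurable_sum borel_measurable_times borel_measurable_const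
          smooth_borel smooth_on_translate smooth_on_frechet_derivative[OF T(1)])
  have int: "integrable lborel (\<lambda>x. v x * \<phi> (x - s *\<^sub>R z))" for s
    by (rule integrable_loc_test[OF v test_functions_translate[OF \<phi>]])
  have lim: "(\<lambda>n. LINT x|lborel. v x * ((\<phi> (x - X n *\<^sub>R z) - \<phi> (x - t *\<^sub>R z)) / (X n - t)))
      \<longlonglongrightarrow> (LINT x|lborel. v x * - frechet_derivative \<phi> (at (x - t *\<^sub>R z)) z)"
  proof (rule integral_dominated_convergence[where w="\<lambda>x. indicator C x * norm (v x) * (M * norm z)"])
    show "integrable lborel (\<lambda>x. indicator C x * norm (v x) * (M * norm z))"
      using loc_intD(2)[OF v, of C] by (simp add: C_def)
    show "AE x in lborel. (\<lambda>n. v x * ((\<phi> (x - X n *\<^sub>R z) - \<phi> (x - t *\<^sub>R z)) / (X n - t)))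
        \<longlonglongrightarrow> v x * - frechet_derivative \<phi> (at (x - t *\<^sub>R z)) z"
    proof (intro always_eventually allI tendsto_mult tendsto_const)
      fix x
      have 1: "((\<lambda>s. x - s *\<^sub>R z) has_derivative (\<lambda>h. - (h *\<^sub>R z))) (at t)"
        by (auto intro!: derivative_eq_intros)
      have 2: "((\<lambda>s. \<phi> (x - s *\<^sub>R z)) has_derivative (\<lambda>h. frechet_derivative \<phi> (at (x - t *\<^sub>R z)) (- (h *\<^sub>R z)))) (at t)"
        by (rule has_derivative_compose[OF 1 smooth_onD[OF T(1)]]) simp
      have 3: "frechet_derivative \<phi> (at (x - t *\<^sub>R z)) (- (h *\<^sub>R z))
          = h * - frechet_derivative \<phi> (at (x - t *\<^sub>R z)) z" for h
        using linear_cmul[OF has_derivative_linear[OF smooth_onD[OF T(1)]], of "x - t *\<^sub>R z" "-h" z] by simp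
      have "((\<lambda>s. \<phi> (x - s *\<^sub>R z)) has_real_derivative - frechet_derivative \<phi> (at (x - t *\<^sub>R z)) z) (at t)"
        unfolding has_field_derivative_def
        by (rule has_derivative_eq_rhs[OF 2]) (simp add: fun_eq_iff 3 mult.commute)
      then have "((\<lambda>s. (\<phi> (x - s *\<^sub>R z) - \<phi> (x - t *\<^sub>R z)) / (s - t)) \<longlongrightarrow> - frechet_derivative \<phi> (at (x - t *\<^sub>R z)) z) (at t)"
        unfolding has_field_derivative_iff .
      then show "(\<lambda>n. (\<phi> (x - X n *\<^sub>R z) - \<phi> (x - t *\<^sub>R z)) / (X n - t)) \<longlonglongrightarrow> - frechet_derivative \<phi> (at (x - t *\<^sub>R z)) z"
        using X unfolding tendsto_at_iff_sequentially comp_def by blast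
    qed
    show "AE x in lborel. norm (v x * ((\<phi> (x - X n *\<^sub>R z) - \<phi> (x - t *\<^sub>R z)) / (X n - t)))
        \<le> indicator C x * norm (v x) * (M * norm z)" for n
    proof (intro always_eventually allI)
      fix x
      have nz: "\<bar>X n - t\<bar> > 0" using X(1) by auto
      show "norm (v x * ((\<phi> (x - X n *\<^sub>R z) - \<phi> (x - t *\<^sub>R z)) / (X n - t)))
        \<le> indicator C x * norm (v x) * (M * norm z)"
      proof (cases "x \<in> C")
        case True
        have "\<bar>\<phi> (x - X n *\<^sub>R z) - \<phi> (x - t *\<^sub>R z)\<bar> \<le> M * norm ((x - X n *\<^sub>R z) - (x - t *\<^sub>R z))"
          by (rule M(3))
        also have "(x - X n *\<^sub>R z) - (x - t *\<^sub>R z) = (t - X n) *\<^sub>R z" by (simp add: algebra_simps)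
        finally have "\<bar>(\<phi> (x - X n *\<^sub>R z) - \<phi> (x - t *\<^sub>R z)) / (X n - t)\<bar> \<le> M * norm z"
          using nz by (simp add: abs_divide divide_simps abs_minus_commute mult_ac)
        then show ?thesis using True unfolding real_norm_def abs_mult by (simp add: mult_left_mono del: abs_divide)
      next
        case False
        have "\<phi> (x - X n *\<^sub>R z) = 0" "\<phi> (x - t *\<^sub>R z) = 0"
          using B[of n] B0 by (auto intro!: out False)
        then show ?thesis using False by simp
      qed
    qed
  qed (use mv m\<phi> m\<phi>' in auto)
  have eq: "(LINT x|lborel. v x * ((\<phi> (x - X n *\<^sub>R z) - \<phi> (x - t *\<^sub>R z)) / (X n - t)))
      = ((LINT x|lborel. v x * \<phi> (x - X n *\<^sub>R z)) - (LINT x|lborel. v x * \<phi> (x - t *\<^sub>R z))) / (X n - t)" for n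
    by (subst Bochner_Integration.integral_diff[symmetric, OF int int])
      (simp add: algebra_simps diff_divide_distrib flip: Bochner_Integration.integral_divide_zero)
  show "((\<lambda>s. ((LINT x|lborel. v x * \<phi> (x - s *\<^sub>R z)) - (LINT x|lborel. v x * \<phi> (x - t *\<^sub>R z))) / (s - t)) \<circ> X)
      \<longlonglongrightarrow> - (LINT x|lborel. v x * frechet_derivative \<phi> (at (x - t *\<^sub>R z)) z)"
    unfolding comp_def eq[symmetric] using lim by simp
qed

text \<open>By translation invariance the integral of \<open>\<phi> (x - t *\<^sub>R z)\<close> does
  not depend on t; it is differentiated at t = 0 with the constant 1 in the role of v.\<close>

lemma integral_derivative_test_function:
  assumes "\<phi> \<in> test_functions UNIV"
  shows "(LINT x|lborel. frechet_derivative \<phi> (at x) z) = 0"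
proof -
  have m: "\<phi> \<in> borel_measurable borel" by (rule smooth_borel[OF test_functionsD(1)[OF assms]])
  have "(LINT x|lborel. 1 * \<phi> (x - t *\<^sub>R z)) = (LINT x|lborel. \<phi> x)" for t
    using integral_shift[OF m, of "- (t *\<^sub>R z)"] by simp
  then have "((\<lambda>t. LINT x|lborel. 1 * \<phi> (x - t *\<^sub>R z)) has_real_derivative 0) (at 0)" by simp
  from DERIV_unique[OF has_derivative_integral_translate[OF loc_int_const assms, of 1 z 0] this]
  show ?thesis by simp
qed

subsection \<open>Weak gradients with Borel representatives\<close>

definition borel_weak_gradient :: "('a::euclidean_space \<Rightarrow> real) \<Rightarrow> ('a \<Rightarrow> 'a) \<Rightarrow> bool" where
  "borel_weak_gradient v Dv \<longleftrightarrow> loc_int v \<and> loc_int Dv \<and>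
     (\<forall>\<phi>\<in>test_functions UNIV. \<forall>b\<in>Basis.
        (LINT x|lborel. v x * frechet_derivative \<phi> (at x) b) = - (LINT x|lborel. (Dv x \<bullet> b) * \<phi> x))"

lemma weak_gradient_direction:
  assumes "borel_weak_gradient v Dv" "\<phi> \<in> test_functions UNIV"
  shows "(LINT x|lborel. v x * frechet_derivative \<phi> (at x) z) = - (LINT x|lborel. (Dv x \<bullet> z) * \<phi> x)"
proof -
  have v: "loc_int v" and Dv: "loc_int Dv" using assms by (auto simp: borel_weak_gradient_def)
  note i1 = integrable_loc_test(2)[OF v assms(2)] and i2 = integrable_loc_test(1)[OF loc_int_inner[OF Dv] assms(2)]
  have "(LINT x|lborel. v x * frechet_derivative \<phi> (at x) z)
      = (LINT x|lborel. (\<Sum>b\<in>Basis. (z \<bullet> b) * (v x * frechet_derivative \<phi> (at x) b)))"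
    by (simp add: frechet_derivative_basis_sum[OF test_functionsD(1)[OF assms(2)], of _ z] sum_distrib_left mult_ac)
  also have "\<dots> = (\<Sum>b\<in>Basis. (z \<bullet> b) * (LINT x|lborel. v x * frechet_derivative \<phi> (at x) b))"
    by (subst Bochner_Integration.integral_sum) (auto intro!: integrable_mult_right i1)
  also have "\<dots> = (\<Sum>b\<in>Basis. (z \<bullet> b) * - (LINT x|lborel. (Dv x \<bullet> b) * \<phi> x))"
    using assms by (intro sum.cong) (auto simp: borel_weak_gradient_def)
  also have "\<dots> = - (LINT x|lborel. (\<Sum>b\<in>Basis. (z \<bullet> b) * ((Dv x \<bullet> b) * \<phi> x)))"
    by (subst Bochner_Integration.integral_sum) (auto intro!: integrable_mult_right i2 simp: sum_negf)
  also have "(\<lambda>x. \<Sum>b\<in>Basis. (z \<bullet> b) * ((Dv x \<bullet> b) * \<phi> x)) = (\<lambda>x. (Dv x \<bullet> z) * \<phi> x)"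
    by (auto simp: euclidean_inner[of _ z] sum_distrib_left sum_distrib_right mult_ac)
  finally show ?thesis .
qed

text \<open>Besides Borel measurability this arranges that v' vanishes at every point outside U, not
  just at almost every one, so that supports can later be handled pointwise.\<close>

lemma W1p_grad_borel:
  assumes "W1p_grad p v Dv" "AE x in lebesgue. x \<notin> U \<longrightarrow> v x = 0" "U \<in> sets borel"
  obtains v' Dv' where "borel_weak_gradient v' Dv'" "AE x in lborel. v x = v' x" "AE x in lborel. Dv x = Dv' x"
    "\<And>x. x \<notin> U \<Longrightarrow> v' x = 0"
proof -
  have "v \<in> borel_measurable lebesgue" "Dv \<in> borel_measurable lebesgue"
    using assms(1) by (auto simp: W1p_grad_def Lp_on_def set_borel_measurable_def)
  then obtain v0 Dv' where [measurable]: "v0 \<in> borel_measurable borel" "Dv' \<in> borel_measurable borel"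
    and ae0: "AE x in lborel. v x = v0 x" and aeD: "AE x in lborel. Dv x = Dv' x"
    by (metis lebesgue_borel_version)
  note [measurable] = assms(3)
  define v' where "v' x = indicator U x * v0 x" for x
  have [measurable]: "v' \<in> borel_measurable borel" unfolding v'_def[abs_def] by measurable
  have ae: "AE x in lborel. v x = v' x"
    using ae0 assms(2)[unfolded AE_completion_iff] by eventually_elim (auto simp: v'_def indicator_def)
  have w: "has_weak_gradient UNIV v Dv" using assms(1) by (simp add: W1p_grad_def)
  have "loc_int v'" unfolding loc_int_def
  proof (intro conjI allI impI)
    fix C :: "'a set" assume C: "compact C"
    have [measurable]: "C \<in> sets borel" using C by (rule borel_compact)
    have "integrable lebesgue (\<lambda>x. indicator C x * \<bar>v x\<bar>)"
      using w C by (auto simp: has_weak_gradient_def Lp_loc_def Lp_on_def set_integrable_def)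
    then show "integrable lborel (\<lambda>x. indicator C x * norm (v' x))"
      by (subst (asm) integrable_lebesgue_lborel[where g="\<lambda>x. indicator C x * norm (v' x)"])
        (use ae in auto)
  qed measurable
  moreover have "loc_int Dv'" unfolding loc_int_def
  proof (intro conjI allI impI)
    fix C :: "'a set" assume C: "compact C"
    have [measurable]: "C \<in> sets borel" using C by (rule borel_compact)
    have "integrable lebesgue (\<lambda>x. indicator C x * norm (Dv x))"
      using w C by (auto simp: has_weak_gradient_def Lp_loc_def Lp_on_def set_integrable_def)
    then show "integrable lborel (\<lambda>x. indicator C x * norm (Dv' x))"
      by (subst (asm) integrable_lebesgue_lborel[where g="\<lambda>x. indicator C x * norm (Dv' x)"])
        (use aeD in auto)
  qed measurable
  moreover have "(LINT x|lborel. v' x * frechet_derivative \<phi> (at x) b) = - (LINT x|lborel. (Dv' x \<bullet> b) * \<phi> x)"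
    if \<phi>: "\<phi> \<in> test_functions UNIV" and b: "b \<in> Basis" for \<phi> b
  proof -
    have [measurable]: "\<phi> \<in> borel_measurable borel" "(\<lambda>x. frechet_derivative \<phi> (at x) b) \<in> borel_measurable borel"
      using smooth_borel test_functionsD(1)[OF \<phi>] smooth_on_frechet_derivative[OF _ b] by blast+
    have "(LINT x|lebesgue. v x * frechet_derivative \<phi> (at x) b) = - (LINT x|lebesgue. (Dv x \<bullet> b) * \<phi> x)"
      using w \<phi> b by (auto simp: has_weak_gradient_def set_lebesgue_integral_def)
    moreover have "(LINT x|lebesgue. v x * frechet_derivative \<phi> (at x) b) = (LINT x|lborel. v' x * frechet_derivative \<phi> (at x) b)"
      by (rule integral_lebesgue_lborel) (use ae in auto)
    moreover have "(LINT x|lebesgue. (Dv x \<bullet> b) * \<phi> x) = (LINT x|lborel. (Dv' x \<bullet> b) * \<phi> x)"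
      by (rule integral_lebesgue_lborel) (use aeD in auto)
    ultimately show ?thesis by simp
  qed
  ultimately have "borel_weak_gradient v' Dv'" by (simp add: borel_weak_gradient_def)
  then show ?thesis by (rule that) (use ae aeD in \<open>auto simp: v'_def\<close>)
qed

text \<open>Testing v(x + z) - v(x) with a smooth function gives J 1 - J 0, where J t tests v with
  the translate by t z. The weak gradient identifies J' as the integral of Dv . z against that
  translate, at most |z| times a local L^1 norm of Dv. The mean value theorem and duality with
  smooth functions conclude.\<close>

lemma difference_quotient_L1:
  assumes wg: "borel_weak_gradient v Dv" and out: "\<And>x. x \<notin> ball x0 R \<Longrightarrow> v x = 0" and "0 \<le> R"
  obtains C where "0 \<le> C" "\<And>z. norm z \<le> 1 \<Longrightarrow> (LINT x|lborel. \<bar>v (z + x) - v x\<bar>) \<le> C * norm z"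
proof -
  have v: "loc_int v" and Dv: "loc_int Dv" using wg by (auto simp: borel_weak_gradient_def)
  have mv[measurable]: "v \<in> borel_measurable borel" using v by (simp add: loc_int_def)
  have mD[measurable]: "Dv \<in> borel_measurable borel" using Dv by (simp add: loc_int_def)
  have iv: "integrable lborel v"
    using loc_int_zero_off[OF v compact_cball, of x0 R] out by (auto simp: subset_iff)
  \<comment> \<open>For |z| <= 1 the difference is supported in radius R + 1; the cutoff used below
    is 1 there and 0 beyond R + 2, and its translates stay within R + 3.\<close>
  define C where "C = (LINT x|lborel. indicator (cball x0 (R + 3)) x * norm (Dv x))"
  have "(LINT x|lborel. \<bar>v (z + x) - v x\<bar>) \<le> C * norm z" if z: "norm z \<le> 1" for z
  proof (rule integral_abs_le_by_smooth[where B="cball x0 (R + 2)"])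
    have iz: "integrable lborel (\<lambda>x. v (z + x))" using iv integrable_shift[OF mv] by blast
    show "integrable lborel (\<lambda>x. v (z + x) - v x)" using iv iz by simp
    have zero: "v (z + x) - v x = 0" if "x \<notin> ball x0 (R + 1)" for x
    proof -
      have "R + 1 \<le> dist x0 x" using that by simp
      moreover have "dist x0 x \<le> dist x0 (z + x) + norm z"
        using dist_triangle[of x0 x "z + x"] by (simp add: dist_norm)
      ultimately show ?thesis using z out[of x] out[of "z + x"] by simp
    qed
    then show "v (z + x) - v x = 0" if "x \<notin> cball x0 (R + 2)" for x using that by simp
    fix P assume P: "smooth_on P UNIV" "\<And>x. x \<in> cball x0 (R + 2) \<Longrightarrow> \<bar>P x\<bar> \<le> 1"
    define \<phi> where "\<phi> x = cutoff x0 (R + 1) (R + 2) x * P x" for x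
    have \<phi>0: "\<phi> x = 0" if "x \<notin> cball x0 (R + 2)" for x
      using that \<open>0 \<le> R\<close> by (simp add: \<phi>_def cutoff_eq_0)
    have sm: "smooth_on \<phi> UNIV" unfolding \<phi>_def[abs_def]
      by (intro smooth_on_mult smooth_on_cutoff P(1)) auto
    have \<phi>: "\<phi> \<in> test_functions UNIV"
      by (rule test_functionsI[OF sm compact_cball _ \<phi>0]) auto
    have [measurable]: "\<phi> \<in> borel_measurable borel" by (rule smooth_borel[OF sm])
    have \<phi>1: "\<bar>\<phi> x\<bar> \<le> 1" for x
    proof (cases "x \<in> cball x0 (R + 2)")
      case True
      then show ?thesis using P(2)[OF True] cutoff_bounds[of x0 "R + 1" "R + 2" x]
        by (auto simp: \<phi>_def abs_mult intro: mult_le_one)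
    qed (simp add: \<phi>0)
    define J where "J t = (LINT x|lborel. v x * \<phi> (x - t *\<^sub>R z))" for t
    define J' where "J' t = (LINT x|lborel. (Dv x \<bullet> z) * \<phi> (x - t *\<^sub>R z))" for t
    have d: "(J has_real_derivative J' t) (at t)" for t
    proof -
      have "(LINT x|lborel. v x * frechet_derivative \<phi> (at (x - t *\<^sub>R z)) z) = - J' t"
        using weak_gradient_direction[OF wg test_functions_translate[OF \<phi>], of "t *\<^sub>R z" z]
        by (simp add: frechet_derivative_translate[OF sm] J'_def)
      then show ?thesis using has_derivative_integral_translate[OF v \<phi>, of z t]
        by (simp add: J_def[abs_def])
    qed
    have "\<exists>t. 0 < t \<and> t < 1 \<and> J 1 - J 0 = (1 - 0) * J' t"
      by (rule MVT2) (auto intro: d)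
    then obtain t where t: "0 < t" "t < 1" "J 1 - J 0 = J' t" by auto
    have "J' t \<le> (LINT x|lborel. indicator (cball x0 (R + 3)) x * norm (Dv x) * norm z)"
      unfolding J'_def
    proof (rule integral_mono)
      show "integrable lborel (\<lambda>x. (Dv x \<bullet> z) * \<phi> (x - t *\<^sub>R z))"
        by (rule integrable_loc_test[OF loc_int_inner[OF Dv] test_functions_translate[OF \<phi>]])
      show "integrable lborel (\<lambda>x. indicator (cball x0 (R + 3)) x * norm (Dv x) * norm z)"
        using loc_intD(2)[OF Dv, of "cball x0 (R + 3)"] by simp
      show "(Dv x \<bullet> z) * \<phi> (x - t *\<^sub>R z) \<le> indicator (cball x0 (R + 3)) x * norm (Dv x) * norm z" for x
      proof (cases "x \<in> cball x0 (R + 3)")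
        case True
        have "(Dv x \<bullet> z) * \<phi> (x - t *\<^sub>R z) \<le> \<bar>Dv x \<bullet> z\<bar> * \<bar>\<phi> (x - t *\<^sub>R z)\<bar>"
          by (metis abs_ge_self abs_mult)
        also have "\<dots> \<le> (norm (Dv x) * norm z) * 1"
          by (intro mult_mono Cauchy_Schwarz_ineq2 \<phi>1) auto
        finally show ?thesis using True by simp
      next
        case False
        have "norm (t *\<^sub>R z) \<le> 1" using t z mult_le_one[of t "norm z"] by simp
        then have "x - t *\<^sub>R z \<notin> cball x0 (R + 2)"
          using False dist_triangle[of x0 x "x - t *\<^sub>R z"] by (auto simp: dist_norm)
        then show ?thesis using \<phi>0 by simp
      qed
    qed
    also have "\<dots> = C * norm z" by (simp add: C_def)
    finally have le: "J 1 - J 0 \<le> C * norm z" using t by simp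
    have "J 1 = (LINT x|lborel. v (z + x) * \<phi> x)"
      using integral_shift[of "\<lambda>x. v x * \<phi> (x - z)" z] by (simp add: J_def)
    moreover have "J 0 = (LINT x|lborel. v x * \<phi> x)" by (simp add: J_def)
    moreover have "integrable lborel (\<lambda>x. v x * \<phi> (x - 1 *\<^sub>R z))"
      by (rule integrable_loc_test[OF v test_functions_translate[OF \<phi>]])
    then have "integrable lborel (\<lambda>x. v (z + x) * \<phi> x)"
      using integrable_shift[of "\<lambda>x. v x * \<phi> (x - z)" z] by simp
    ultimately have "J 1 - J 0 = (LINT x|lborel. v (z + x) * \<phi> x - v x * \<phi> x)"
      by (simp add: Bochner_Integration.integral_diff integrable_loc_test[OF v \<phi>])
    also have "\<dots> = (LINT x|lborel. (v (z + x) - v x) * P x)"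
    proof (rule Bochner_Integration.integral_cong)
      fix x
      show "v (z + x) * \<phi> x - v x * \<phi> x = (v (z + x) - v x) * P x"
      proof (cases "x \<in> ball x0 (R + 1)")
        case True
        then have "\<phi> x = P x" using \<open>0 \<le> R\<close> by (simp add: \<phi>_def cutoff_eq_1)
        then show ?thesis by (simp add: algebra_simps)
      next
        case False
        from zero[OF this] show ?thesis by simp
      qed
    qed simp
    finally show "(LINT x|lborel. (v (z + x) - v x) * P x) \<le> C * norm z" using le by simp
  qed simp
  moreover have "0 \<le> C" unfolding C_def by (intro integral_nonneg_AE) auto
  ultimately show ?thesis using that by blast
qed

text \<open>A test function vanishing near the closed ball has its derivative supported where v = 0,
  so Dv integrates to zero against it. With test functions \<open>\<eta>\<close> P, where
  \<open>\<eta>\<close> cuts off to an annulus and P is any smooth function, duality with the bound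
  0 gives Dv = 0 on the annulus. Countably many annuli and the null sphere fill the complement of
  the ball.\<close>

lemma weak_gradient_vanishes:
  assumes wg: "borel_weak_gradient v Dv" and out: "\<And>x. x \<notin> ball x0 r \<Longrightarrow> v x = 0" and "0 < r"
  shows "AE x in lborel. x \<notin> ball x0 r \<longrightarrow> Dv x = 0"
proof -
  have v: "loc_int v" and Dv: "loc_int Dv" using wg by (auto simp: borel_weak_gradient_def)
  have mD[measurable]: "Dv \<in> borel_measurable borel" using Dv by (simp add: loc_int_def)
  have annulus: "AE x in lborel. a \<le> dist x0 x \<and> dist x0 x \<le> c \<longrightarrow> Dv x \<bullet> b = 0" if a: "r < a" "a < c" and b: "b \<in> Basis" for a c b
  proof -
    \<comment> \<open>Strictly between r and a, so that \<open>\<eta>\<close> vanishes on a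
      neighbourhood of the closed ball and the derivative of \<open>\<eta>\<close> P is zero
      inside.\<close>
    define r' where "r' = (r + a) / 2"
    have r': "r < r'" "r' < a" using a by (auto simp: r'_def)
    define \<eta> where "\<eta> x = (1 + (-1) * cutoff x0 r' a x) * cutoff x0 c (c + 1) x" for x
    have sm: "smooth_on \<eta> UNIV" unfolding \<eta>_def[abs_def]
      by (intro smooth_on_mult smooth_on_add smooth_on_const smooth_on_cutoff) auto
    have \<eta>c: "\<eta> x = 0" if "x \<notin> cball x0 (c + 1)" for x
      using that a \<open>0 < r\<close> by (simp add: \<eta>_def cutoff_eq_0)
    have \<eta>t: "\<eta> \<in> test_functions UNIV"
      by (rule test_functionsI[OF sm compact_cball _ \<eta>c]) auto
    define h where "h x = (Dv x \<bullet> b) * \<eta> x" for x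
    have ih: "integrable lborel h" unfolding h_def[abs_def]
      by (rule integrable_loc_test[OF loc_int_inner[OF Dv] \<eta>t])
    have "(LINT x|lborel. \<bar>h x\<bar>) \<le> 0"
    proof (rule integral_abs_le_by_smooth[OF ih compact_cball])
      show "h x = 0" if "x \<notin> cball x0 (c + 1)" for x using \<eta>c[OF that] by (simp add: h_def)
      fix P assume P: "smooth_on P (UNIV::'a set)"
      define \<phi> where "\<phi> x = \<eta> x * P x" for x
      have \<phi>s: "smooth_on \<phi> UNIV" unfolding \<phi>_def[abs_def] by (intro smooth_on_mult sm P) auto
      have \<phi>: "\<phi> \<in> test_functions UNIV"
        by (rule test_functionsI[OF \<phi>s compact_cball[of x0 "c + 1"]]) (auto simp: \<phi>_def \<eta>c)
      have "v x * frechet_derivative \<phi> (at x) b = 0" for x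
      proof (cases "x \<in> ball x0 r")
        case True
        have z: "0 = \<phi> y" if "y \<in> ball x0 r'" for y
          using that r' \<open>0 < r\<close> by (simp add: \<phi>_def \<eta>_def cutoff_eq_1)
        have "((\<lambda>_. 0) has_derivative (\<lambda>_. 0)) (at x)" by simp
        then have "(\<phi> has_derivative (\<lambda>_. 0)) (at x)"
          by (rule has_derivative_transform_within_open[OF _ open_ball _ z]) (use True r' in auto)
        then have "frechet_derivative \<phi> (at x) = (\<lambda>_. 0)" using frechet_derivative_at by metis
        then show ?thesis by simp
      qed (simp add: out)
      then have "(LINT x|lborel. v x * frechet_derivative \<phi> (at x) b) = 0" by (simp only: integral_zero)
      then have "(LINT x|lborel. (Dv x \<bullet> b) * \<phi> x) = 0"
        using weak_gradient_direction[OF wg \<phi>, of b] by simp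
      then show "(LINT x|lborel. h x * P x) \<le> 0" by (simp add: h_def \<phi>_def mult.assoc)
    qed
    moreover have "0 \<le> (LINT x|lborel. \<bar>h x\<bar>)" by simp
    ultimately have "(LINT x|lborel. \<bar>h x\<bar>) = 0" by simp
    then have "AE x in lborel. \<bar>h x\<bar> = 0"
      using integral_nonneg_eq_0_iff_AE[where M=lborel and f="\<lambda>x. \<bar>h x\<bar>"] ih by auto
    then show ?thesis
    proof eventually_elim
      case (elim x)
      show ?case
      proof safe
        assume x: "a \<le> dist x0 x" "dist x0 x \<le> c"
        have "cutoff x0 r' a x = 0" using x r' \<open>0 < r\<close> by (intro cutoff_eq_0) auto
        moreover have "cutoff x0 c (c + 1) x = 1" using x a \<open>0 < r\<close> by (intro cutoff_eq_1) auto
        ultimately show "Dv x \<bullet> b = 0" using elim by (simp add: h_def \<eta>_def)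
      qed
    qed
  qed
  have "AE x in lborel. \<forall>n. \<forall>b\<in>Basis. r + 1 / (real n + 1) \<le> dist x0 x \<and> dist x0 x \<le> r + 2 + n \<longrightarrow> Dv x \<bullet> b = 0"
    unfolding AE_all_countable
  proof (intro allI AE_finite_allI annulus)
    fix n :: nat
    have "1 / (real n + 1) \<le> 1" by simp
    then show "r + 1 / (real n + 1) < r + 2 + real n" by linarith
  qed auto
  moreover have "AE x in lborel. x \<notin> sphere x0 r"
  proof -
    have "sphere x0 r \<in> null_sets lebesgue" using negligible_sphere negligible_iff_null_sets by blast
    from AE_not_in[OF this] show ?thesis by (simp add: AE_completion_iff)
  qed
  ultimately show ?thesis
  proof eventually_elim
    case (elim x)
    show ?case
    proof
      assume "x \<notin> ball x0 r"
      then have x: "r < dist x0 x" using elim(2) by auto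
      obtain n1 where n1: "inverse (real (Suc n1)) < dist x0 x - r" using reals_Archimedean[of "dist x0 x - r"] x by auto
      obtain n2 where n2: "dist x0 x - r - 2 \<le> real n2" using real_arch_simple by blast
      define n where "n = max n1 n2"
      have "1 / (real n + 1) \<le> inverse (real (Suc n1))" by (simp add: n_def divide_simps)
      then have "\<forall>b\<in>Basis. Dv x \<bullet> b = 0" using elim(1)[THEN spec, of n] n1 n2 by (auto simp: n_def)
      then show "Dv x = 0" by (simp add: euclidean_all_zero_iff)
    qed
  qed
qed

subsection \<open>The power map and its derivative\<close>

text \<open>The derivative of |\<open>\<xi>\<close>|^(p-2) \<open>\<xi>\<close> in direction h. The
  case p = 2 is separate because \<open>0 powr 0 = 0\<close> would give 0 instead of h at the
  origin; for p > 2 the value 0 there is correct.\<close>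

definition p_power_deriv :: "real \<Rightarrow> 'b::euclidean_space \<Rightarrow> 'b \<Rightarrow> 'b" where
  "p_power_deriv p \<xi> h = (if p = 2 then h
     else norm \<xi> powr (p - 2) *\<^sub>R h + ((p - 2) * norm \<xi> powr (p - 4) * (\<xi> \<bullet> h)) *\<^sub>R \<xi>)"

lemma norm_p_power: "2 \<le> p \<Longrightarrow> norm (p_power p \<xi>) = norm \<xi> powr (p - 1)"
proof (cases "\<xi> = 0")
  case False
  then have "norm \<xi> powr (p - 2) * norm \<xi> = norm \<xi> powr (p - 2) * norm \<xi> powr 1" by simp
  also have "\<dots> = norm \<xi> powr (p - 1)" unfolding powr_add[symmetric] by simp
  finally show ?thesis by (simp add: p_power_def)
qed (simp add: p_power_def)

lemma p_power_minus: "p_power p (- \<xi>) = - p_power p \<xi>"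
  by (simp add: p_power_def)

lemma p_power_0 [simp]: "p_power p 0 = 0"
  by (simp add: p_power_def)

lemma p_power_deriv_bound:
  assumes "2 < p"
  shows "norm (p_power_deriv p \<xi> h) \<le> (p - 1) * norm \<xi> powr (p - 2) * norm h"
proof (cases "\<xi> = 0")
  case False
  have "norm \<xi> powr (p - 4) * norm \<xi> * norm \<xi> = norm \<xi> powr (p - 4) * norm \<xi> powr 1 * norm \<xi> powr 1"
    using False by simp
  also have "\<dots> = norm \<xi> powr (p - 2)" unfolding powr_add[symmetric] by simp
  finally have e: "norm \<xi> powr (p - 4) * norm \<xi> * norm \<xi> = norm \<xi> powr (p - 2)" .
  have "norm (p_power_deriv p \<xi> h) \<le> norm \<xi> powr (p - 2) * norm h + (p - 2) * norm \<xi> powr (p - 4) * \<bar>\<xi> \<bullet> h\<bar> * norm \<xi>"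
    using assms unfolding p_power_deriv_def
    by (auto intro!: order_trans[OF norm_triangle_ineq] simp: abs_mult)
  also have "\<dots> \<le> norm \<xi> powr (p - 2) * norm h + (p - 2) * norm \<xi> powr (p - 4) * (norm \<xi> * norm h) * norm \<xi>"
    using assms by (intro add_mono mult_mono Cauchy_Schwarz_ineq2) auto
  also have "\<dots> = norm \<xi> powr (p - 2) * norm h + (p - 2) * (norm \<xi> powr (p - 4) * norm \<xi> * norm \<xi>) * norm h"
    by (simp add: mult_ac)
  also have "\<dots> = (p - 1) * norm \<xi> powr (p - 2) * norm h" unfolding e by (simp add: algebra_simps)
  finally show ?thesis .
qed (use assms in \<open>simp add: p_power_deriv_def\<close>)

lemma p_power_deriv_bound_ball:
  assumes "2 \<le> p" "norm \<xi> \<le> R" "0 < R"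
  shows "norm (p_power_deriv p \<xi> h) \<le> (p - 1) * R powr (p - 2) * norm h"
proof (cases "p = 2")
  case True
  then show ?thesis using assms by (simp add: p_power_deriv_def)
next
  case False
  have "norm (p_power_deriv p \<xi> h) \<le> (p - 1) * norm \<xi> powr (p - 2) * norm h"
    using assms False by (intro p_power_deriv_bound) auto
  also have "\<dots> \<le> (p - 1) * R powr (p - 2) * norm h"
    using assms by (intro mult_mono powr_mono2) auto
  finally show ?thesis .
qed

lemma has_derivative_p_power:
  assumes "2 \<le> p"
  shows "(p_power p has_derivative p_power_deriv p \<xi>) (at \<xi>)"
proof (cases "p = 2")
  case True
  have "p_power 2 = (\<lambda>\<xi>::'a. \<xi>)" by (auto simp: p_power_def fun_eq_iff powr_def)
  moreover have "p_power_deriv 2 \<xi> = (\<lambda>h. h)" by (auto simp: p_power_deriv_def)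
  ultimately show ?thesis using True by simp
next
  case False
  show ?thesis
  proof (cases "\<xi> = 0")
    case True
    have z: "p_power_deriv p (0::'a) = (\<lambda>h. 0)" using \<open>p \<noteq> 2\<close> by (auto simp: p_power_deriv_def)
    have "(p_power p has_derivative (\<lambda>h. 0)) (at (0::'a))"
    proof (rule has_derivativeI)
      have 1: "norm y powr (p - 2) = norm (p_power p y) / norm y" if "y \<noteq> 0" for y :: 'a
        using that by (simp add: p_power_def)
      have "((\<lambda>y::'a. norm y powr (p - 2)) \<longlongrightarrow> 0) (at 0)"
        using assms \<open>p \<noteq> 2\<close> by (intro tendsto_zero_powrI[where b="p - 2"] tendsto_norm_zero tendsto_const) (auto intro: tendsto_ident_at)
      then have "((\<lambda>y::'a. norm (p_power p y) / norm y) \<longlongrightarrow> 0) (at 0)"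
        by (rule Lim_transform_eventually) (auto simp: eventually_at_filter 1)
      then show "((\<lambda>y. ((p_power p y - p_power p 0) - 0) /\<^sub>R norm (y - 0)) \<longlongrightarrow> 0) (at (0::'a))"
        by (subst tendsto_norm_zero_iff[symmetric]) (simp add: divide_inverse mult.commute)
    qed simp
    then show ?thesis using True z by simp
  next
    case False
    have pos: "0 < norm \<xi>" using False by simp
    have n: "(norm has_derivative (\<lambda>h. h \<bullet> sgn \<xi>)) (at \<xi>)" using False by (rule has_derivative_norm)
    have "((\<lambda>t. t powr (p - 2)) has_real_derivative (p - 2) * norm \<xi> powr (p - 2 - 1)) (at (norm \<xi>))"
      by (rule has_real_derivative_powr[OF pos])
    from has_derivative_compose[OF n this[unfolded has_field_derivative_def]]
    have m: "((\<lambda>x. norm x powr (p - 2)) has_derivative (\<lambda>h. (p - 2) * norm \<xi> powr (p - 2 - 1) * (h \<bullet> sgn \<xi>))) (at \<xi>)" .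
    have "((\<lambda>x. norm x powr (p - 2) *\<^sub>R x) has_derivative
      (\<lambda>h. norm \<xi> powr (p - 2) *\<^sub>R h + ((p - 2) * norm \<xi> powr (p - 2 - 1) * (h \<bullet> sgn \<xi>)) *\<^sub>R \<xi>)) (at \<xi>)"
      by (rule has_derivative_scaleR[OF m has_derivative_ident])
    moreover have "norm \<xi> powr (p - 2 - 1) * (h \<bullet> sgn \<xi>) = norm \<xi> powr (p - 4) * (\<xi> \<bullet> h)" for h
    proof -
      have "norm \<xi> powr (p - 2 - 1) * (h \<bullet> sgn \<xi>) = (norm \<xi> powr (p - 3) * norm \<xi> powr (-1)) * (\<xi> \<bullet> h)"
        using pos by (simp add: sgn_div_norm inner_commute powr_minus)
      also have "norm \<xi> powr (p - 3) * norm \<xi> powr (-1) = norm \<xi> powr (p - 4)"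
        unfolding powr_add[symmetric] by simp
      finally show ?thesis .
    qed
    ultimately show ?thesis
      using \<open>p \<noteq> 2\<close> by (simp add: p_power_def[abs_def] p_power_deriv_def[abs_def] mult.assoc)
  qed
qed

text \<open>Away from the origin this is plain continuity. At the origin \<open>powr (p - 4)\<close>
  may blow up, so for p > 2 the limit 0 is taken from the growth bound |\<open>\<xi>\<close>|^(p-2)
  instead.\<close>

lemma tendsto_p_power_deriv:
  assumes "2 \<le> p" "(X \<longlongrightarrow> \<xi>) F" "(H \<longlongrightarrow> h) F"
  shows "((\<lambda>n. p_power_deriv p (X n) (H n)) \<longlongrightarrow> p_power_deriv p \<xi> h) F"
proof (cases "p = 2")
  case True
  then show ?thesis using assms by (simp add: p_power_deriv_def)
next
  case False
  show ?thesis
  proof (cases "\<xi> = 0")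
    case True
    have "((\<lambda>n. norm (X n) powr (p - 2)) \<longlongrightarrow> 0) F"
      using assms False True by (intro tendsto_zero_powrI[where b="p - 2"] tendsto_norm_zero tendsto_const) auto
    then have "((\<lambda>n. (p - 1) * norm (X n) powr (p - 2) * norm (H n)) \<longlongrightarrow> (p - 1) * 0 * norm h) F"
      by (intro tendsto_intros assms)
    then have "((\<lambda>n. (p - 1) * norm (X n) powr (p - 2) * norm (H n)) \<longlongrightarrow> 0) F" by simp
    then have "((\<lambda>n. p_power_deriv p (X n) (H n)) \<longlongrightarrow> 0) F"
      by (rule Lim_null_comparison[rotated])
        (use assms False in \<open>auto intro!: always_eventually p_power_deriv_bound\<close>)
    moreover have "p_power_deriv p \<xi> h = 0" using True False by (simp add: p_power_deriv_def)
    ultimately show ?thesis by simp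
  next
    case nz: False
    then show ?thesis using False unfolding p_power_deriv_def
      by (auto intro!: tendsto_intros assms)
  qed
qed

lemma continuous_p_power: "2 \<le> p \<Longrightarrow> continuous_on S (p_power p)"
  by (meson has_derivative_p_power has_derivative_continuous continuous_at_imp_continuous_on)

lemma p_power_measurable [measurable]: "p_power p \<in> borel_measurable borel"
  unfolding p_power_def[abs_def] by measurable

lemma p_power_lipschitz:
  fixes a b :: "'b::euclidean_space"
  assumes "2 \<le> p" "norm a \<le> R" "norm b \<le> R" "0 < R"
  shows "norm (p_power p a - p_power p b) \<le> (p - 1) * R powr (p - 2) * norm (a - b)"
proof (rule differentiable_bound[of "cball 0 R"])
  show "(p_power p has_derivative p_power_deriv p x) (at x within cball 0 R)" for x :: 'b
    by (rule has_derivative_at_withinI[OF has_derivative_p_power[OF assms(1)]])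
  show "onorm (p_power_deriv p x) \<le> (p - 1) * R powr (p - 2)" if "x \<in> cball (0::'b) R" for x
    by (rule onorm_bound) (use assms that in \<open>auto intro!: p_power_deriv_bound_ball\<close>)
qed (use assms in auto)

text \<open>The power map is odd, so the sum is a difference of values at a and -b. A Lipschitz
  constant of order (C t)^(p-2) and |a + b| <= C t^2 give order t^p: cancellation gains one power
  over the size t^(p-1) of each term.\<close>

lemma p_power_sum_bound:
  fixes a b :: real
  assumes "2 \<le> p" "\<bar>a\<bar> \<le> C * t" "\<bar>b\<bar> \<le> C * t" "\<bar>a + b\<bar> \<le> C * t\<^sup>2" "0 \<le> t" "0 \<le> C"
  shows "\<bar>p_power p a + p_power p b\<bar> \<le> (p - 1) * C powr (p - 1) * t powr p"
proof (cases "C * t = 0")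
  case True
  then have "a = 0" "b = 0" using assms by auto
  then show ?thesis using assms by simp
next
  case False
  then have pos: "0 < C" "0 < t" using assms by auto
  have "\<bar>p_power p a + p_power p b\<bar> = norm (p_power p a - p_power p (- b))" by (simp add: p_power_minus)
  also have "\<dots> \<le> (p - 1) * (C * t) powr (p - 2) * norm (a - - b)"
    by (rule p_power_lipschitz) (use assms pos in auto)
  also have "\<dots> \<le> (p - 1) * (C * t) powr (p - 2) * (C * t\<^sup>2)"
    using assms by (intro mult_left_mono) auto
  also have "\<dots> = (p - 1) * (C powr (p - 2) * C powr 1) * (t powr (p - 2) * t powr 2)"
    using pos by (simp add: powr_mult mult_ac)
  also have "\<dots> = (p - 1) * C powr (p - 1) * t powr p" unfolding powr_add[symmetric] by simp
  finally show ?thesis .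
qed

lemma powr_add_le:
  fixes a b q :: real
  assumes "0 \<le> a" "0 \<le> b" "0 \<le> q"
  shows "(a + b) powr q \<le> 2 powr q * (a powr q + b powr q)"
proof -
  have "(a + b) powr q \<le> (2 * max a b) powr q" using assms by (intro powr_mono2) auto
  also have "\<dots> = 2 powr q * max a b powr q" using assms by (simp add: powr_mult)
  also have "\<dots> \<le> 2 powr q * (a powr q + b powr q)" by (intro mult_left_mono) (auto simp: max_def)
  finally show ?thesis .
qed

lemma abs_diff_powr_le:
  fixes a b q :: real
  assumes "0 \<le> q" "\<bar>a\<bar> \<le> A" "\<bar>b\<bar> \<le> B"
  shows "\<bar>a - b\<bar> powr q \<le> 2 powr q * (A powr q + B powr q)"
proof -
  have "\<bar>a - b\<bar> powr q \<le> (A + B) powr q" using assms by (intro powr_mono2) auto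
  also have "\<dots> \<le> 2 powr q * (A powr q + B powr q)" using assms by (intro powr_add_le) auto
  finally show ?thesis .
qed

subsection \<open>Translation-invariant singular kernels and the nonlocal operator\<close>

text \<open>A translation-invariant kernel is a function k of the displacement, and evenness of k is
  the symmetry of the two-point kernel. The same estimates are thus available for |z|^(-N-sp), the
  kernel of D_s^p.\<close>

locale singular_kernel =
  fixes s p :: real and k :: "'a::euclidean_space \<Rightarrow> real" and \<Lambda> :: real
  assumes s: "0 < s" "s < 1" and p: "2 \<le> p"
    and k_even: "k (- z) = k z"
    and k_nonneg: "z \<noteq> 0 \<Longrightarrow> 0 \<le> k z"
    and k_le: "z \<noteq> 0 \<Longrightarrow> k z \<le> \<Lambda> * norm z powr (- (real DIM('a) + s * p))"
    and k_cont: "continuous_on (- {0}) k"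
    and \<Lambda>: "0 < \<Lambda>"
begin

definition weight :: "'a \<Rightarrow> real" where
  "weight y = (1 + norm y) powr (- (real DIM('a) + s * p))"

lemma weight_pos: "0 < weight y"
proof -
  have "0 < 1 + norm y" by (simp add: add_pos_nonneg)
  then show ?thesis by (simp add: weight_def)
qed

lemma weight_measurable [measurable]: "weight \<in> borel_measurable borel"
  unfolding weight_def[abs_def] by measurable

lemma weight_integrable: "integrable lborel weight"
  unfolding weight_def[abs_def] using s p by (intro integrable_norm_powr_tail) auto

lemma k_measurable [measurable]: "k \<in> borel_measurable borel"
proof -
  have "(\<lambda>x. indicator (- {0}) x *\<^sub>R k x) \<in> borel_measurable borel"
    by (rule borel_measurable_continuous_on_indicator[OF _ k_cont]) auto
  then have "(\<lambda>x. indicator (- {0}) x *\<^sub>R k x + indicator {0} x * k 0) \<in> borel_measurable borel" by measurable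
  also have "(\<lambda>x. indicator (- {0}) x *\<^sub>R k x + indicator {0} x * k 0) = k" by (auto simp: indicator_def)
  finally show ?thesis .
qed

text \<open>For |x| <= X and |y - x| >= \<open>\<rho>\<close> one has 1 + |y| <= c |y - x| with c =
  (1 + X) / \<open>\<rho>\<close> + 1. Hence a single multiple of the tail weight dominates k(y - x)
  for all such x at once.\<close>

lemma k_far:
  assumes "0 < \<rho>" "0 \<le> X"
  obtains C where "0 < C" "\<And>x y. norm x \<le> X \<Longrightarrow> \<rho> \<le> norm (y - x) \<Longrightarrow> k (y - x) \<le> C * weight y"
proof -
  define \<beta> where "\<beta> = real DIM('a) + s * p"
  have \<beta>: "0 < \<beta>" using s p by (simp add: \<beta>_def add_pos_nonneg)
  define c where "c = (1 + X) / \<rho> + 1"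
  have c: "0 < c" using assms by (simp add: c_def add_nonneg_pos)
  have "k (y - x) \<le> \<Lambda> * c powr \<beta> * weight y" if x: "norm x \<le> X" and y: "\<rho> \<le> norm (y - x)" for x y
  proof -
    have nz: "y - x \<noteq> 0" using y assms by auto
    have "1 + norm y \<le> (1 + X) + norm (y - x)" using x norm_triangle_sub[of y x] by simp
    also have "(1 + X) \<le> (1 + X) / \<rho> * norm (y - x)"
      using y assms by (simp add: divide_simps mult_left_mono)
    finally have le: "1 + norm y \<le> c * norm (y - x)" by (simp add: c_def algebra_simps)
    have "k (y - x) \<le> \<Lambda> * norm (y - x) powr (- \<beta>)" using k_le[OF nz] by (simp add: \<beta>_def)
    also have "norm (y - x) powr (- \<beta>) = c powr \<beta> * (c * norm (y - x)) powr (- \<beta>)"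
      using c by (simp add: powr_mult powr_minus)
    also have "\<Lambda> * \<dots> \<le> \<Lambda> * (c powr \<beta> * (1 + norm y) powr (- \<beta>))"
      using \<Lambda> \<beta> le by (intro mult_left_mono powr_mono2') (auto simp: add_pos_nonneg)
    finally show ?thesis by (simp add: weight_def \<beta>_def mult.assoc)
  qed
  then show ?thesis using that[of "\<Lambda> * c powr \<beta>"] \<Lambda> c by simp
qed

text \<open>The total exponent is p (1 - s) - N, which exceeds -N because s < 1.\<close>

lemma k_near_integrable:
  assumes "0 < \<rho>"
  shows "integrable lborel (\<lambda>z::'a. indicator (ball 0 \<rho>) z * (norm z powr p * norm z powr (- (real DIM('a) + s * p))))"
proof -
  have "integrable lborel (\<lambda>z::'a. indicator (ball 0 \<rho>) z * norm z powr (p * (1 - s) - real DIM('a)))"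
    using s p assms by (intro integrable_norm_powr_near_0) auto
  then show ?thesis unfolding powr_add[symmetric] by (simp add: algebra_simps)
qed

lemma near_dominated:
  assumes "0 < \<rho>" and [measurable]: "\<And>n. \<Phi> n \<in> borel_measurable borel" "\<phi> \<in> borel_measurable borel"
    and le: "\<And>n z. norm z < \<rho> \<Longrightarrow> \<bar>\<Phi> n z\<bar> \<le> C * norm z powr p"
    and lim: "\<And>z. z \<noteq> 0 \<Longrightarrow> norm z < \<rho> \<Longrightarrow> (\<lambda>n. \<Phi> n z) \<longlonglongrightarrow> \<phi> z"
  shows "(\<lambda>n::nat. LINT z|lborel. indicator (ball 0 \<rho>) z * (\<Phi> n z * k z))
           \<longlonglongrightarrow> (LINT z|lborel. indicator (ball 0 \<rho>) z * (\<phi> z * k z))"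
    and "integrable lborel (\<lambda>z. indicator (ball 0 \<rho>) z * (\<Phi> n z * k z))"
    and "integrable lborel (\<lambda>z. indicator (ball 0 \<rho>) z * (\<phi> z * k z))"
proof -
  define w where "w z = C * \<Lambda> * (indicator (ball 0 \<rho>) z * (norm z powr p * norm z powr (- (real DIM('a) + s * p))))" for z :: 'a
  have w: "integrable lborel w"
    unfolding w_def[abs_def] by (intro integrable_mult_right k_near_integrable assms)
  have AEnz: "AE z in lborel. z \<noteq> (0::'a)" by (rule AE_lborel_singleton)
  have bound: "AE z in lborel. norm (indicator (ball 0 \<rho>) z * (\<Phi> n z * k z)) \<le> w z" for n
    using AEnz
  proof eventually_elim
    case (elim z)
    have "0 \<le> C" if "norm z < \<rho>"
    proof -
      have "0 \<le> C * norm z powr p" using le[OF that, of n] by linarith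
      then show ?thesis using elim by (simp add: zero_le_mult_iff)
    qed
    then have "norm z < \<rho> \<Longrightarrow> \<bar>\<Phi> n z\<bar> * k z \<le> (C * norm z powr p) * (\<Lambda> * norm z powr (- (real DIM('a) + s * p)))"
      by (intro mult_mono le k_le k_nonneg elim) auto
    then show ?case using k_nonneg[OF elim]
      by (simp add: w_def indicator_def abs_mult mult_ac)
  qed
  have L: "AE z in lborel. (\<lambda>n. indicator (ball 0 \<rho>) z * (\<Phi> n z * k z)) \<longlonglongrightarrow> indicator (ball 0 \<rho>) z * (\<phi> z * k z)"
    using AEnz
  proof eventually_elim
    case (elim z)
    show ?case using lim[OF elim] by (cases "norm z < \<rho>") (auto intro!: tendsto_intros)
  qed
  show "(\<lambda>n. LINT z|lborel. indicator (ball 0 \<rho>) z * (\<Phi> n z * k z))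
           \<longlonglongrightarrow> (LINT z|lborel. indicator (ball 0 \<rho>) z * (\<phi> z * k z))"
    by (rule integral_dominated_convergence[OF _ _ w L bound]) measurable
  show "integrable lborel (\<lambda>z. indicator (ball 0 \<rho>) z * (\<Phi> n z * k z))"
    by (rule integrable_dominated_convergence2[OF _ _ w L bound]) measurable
  show "integrable lborel (\<lambda>z. indicator (ball 0 \<rho>) z * (\<phi> z * k z))"
    by (rule integrable_dominated_convergence[OF _ _ w L bound]) measurable
qed

text \<open>The removed ball moves with \<open>X n\<close>, so the indicators converge only off the
  sphere of radius \<open>\<rho>\<close> about x0, which is null. Domination is uniform because X is
  bounded and \<open>k_far\<close> covers all its points.\<close>

lemma far_dominated:
  assumes "0 < \<rho>" and [measurable]: "\<And>n. \<Psi> n \<in> borel_measurable borel" "\<psi> \<in> borel_measurable borel"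
    and X: "X \<longlonglongrightarrow> x0" and g: "integrable lborel (\<lambda>y. g y * weight y)"
    and le: "\<And>n y. \<bar>\<Psi> n y\<bar> \<le> g y"
    and lim: "AE y in lborel. (\<lambda>n. \<Psi> n y) \<longlonglongrightarrow> \<psi> y"
  shows "(\<lambda>n::nat. LINT y|lborel. indicator (- ball (X n) \<rho>) y * (\<Psi> n y * k (y - X n)))
           \<longlonglongrightarrow> (LINT y|lborel. indicator (- ball x0 \<rho>) y * (\<psi> y * k (y - x0)))"
    and "integrable lborel (\<lambda>y. indicator (- ball (X n) \<rho>) y * (\<Psi> n y * k (y - X n)))"
    and "integrable lborel (\<lambda>y. indicator (- ball x0 \<rho>) y * (\<psi> y * k (y - x0)))"
proof -
  obtain B where B: "0 < B" "\<And>n. norm (X n) \<le> B"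
    using convergent_imp_Bseq[OF convergentI[OF X]] unfolding Bseq_def by auto
  obtain C where C: "0 < C" "\<And>x y. norm x \<le> B \<Longrightarrow> \<rho> \<le> norm (y - x) \<Longrightarrow> k (y - x) \<le> C * weight y"
    using k_far[OF \<open>0 < \<rho>\<close>, of B] B by (metis less_imp_le)
  have w: "integrable lborel (\<lambda>y. C * (g y * weight y))" using g by simp
  have bound: "AE y in lborel. norm (indicator (- ball (X n) \<rho>) y * (\<Psi> n y * k (y - X n))) \<le> C * (g y * weight y)" for n
  proof (intro always_eventually allI)
    fix y
    have g0: "0 \<le> g y" using le[of n y] by linarith
    show "norm (indicator (- ball (X n) \<rho>) y * (\<Psi> n y * k (y - X n))) \<le> C * (g y * weight y)"
    proof (cases "y \<in> ball (X n) \<rho>")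
      case True
      then show ?thesis using g0 C weight_pos[of y] by (simp add: less_imp_le)
    next
      case False
      then have d: "\<rho> \<le> norm (y - X n)" by (simp add: dist_norm norm_minus_commute)
      then have nz: "y - X n \<noteq> 0" using \<open>0 < \<rho>\<close> by auto
      have "\<bar>\<Psi> n y\<bar> * k (y - X n) \<le> g y * (C * weight y)"
        by (rule mult_mono[OF le C(2)[OF B(2) d] g0 k_nonneg[OF nz]])
      then show ?thesis using False k_nonneg[OF nz] by (simp add: abs_mult mult_ac)
    qed
  qed
  have "AE x in lborel. x \<notin> sphere x0 \<rho>"
  proof -
    have "sphere x0 \<rho> \<in> null_sets lebesgue" using negligible_sphere negligible_iff_null_sets by blast
    from AE_not_in[OF this] show ?thesis by (simp add: AE_completion_iff)
  qed
  then have L: "AE y in lborel. (\<lambda>n. indicator (- ball (X n) \<rho>) y * (\<Psi> n y * k (y - X n)))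
      \<longlonglongrightarrow> indicator (- ball x0 \<rho>) y * (\<psi> y * k (y - x0))"
    using lim
  proof eventually_elim
    case (elim y)
    have dl: "(\<lambda>n. dist (X n) y) \<longlonglongrightarrow> dist x0 y" by (intro tendsto_intros X)
    show ?case
    proof (cases "dist x0 y < \<rho>")
      case True
      from order_tendstoD(2)[OF dl this]
      have "\<forall>\<^sub>F n in sequentially. 0 = indicator (- ball (X n) \<rho>) y * (\<Psi> n y * k (y - X n))"
        by eventually_elim simp
      then show ?thesis using True by (intro Lim_transform_eventually[OF tendsto_const]) (auto simp: indicator_def)
    next
      case False
      then have d: "\<rho> < dist x0 y" using elim(1) by (auto simp: less_le)
      have "isCont k (y - x0)"
        using k_cont d \<open>0 < \<rho>\<close> by (subst (asm) continuous_on_eq_continuous_at) (auto simp: open_Compl)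
      then have "(\<lambda>n. k (y - X n)) \<longlonglongrightarrow> k (y - x0)"
        by (rule isCont_tendsto_compose) (intro tendsto_intros X)
      then have l: "(\<lambda>n. \<Psi> n y * k (y - X n)) \<longlonglongrightarrow> \<psi> y * k (y - x0)"
        by (intro tendsto_intros elim(2))
      from order_tendstoD(1)[OF dl d]
      have "\<forall>\<^sub>F n in sequentially. \<Psi> n y * k (y - X n) = indicator (- ball (X n) \<rho>) y * (\<Psi> n y * k (y - X n))"
        by eventually_elim (simp add: indicator_def)
      from Lim_transform_eventually[OF l this] show ?thesis using d by (simp add: indicator_def)
    qed
  qed
  show "(\<lambda>n. LINT y|lborel. indicator (- ball (X n) \<rho>) y * (\<Psi> n y * k (y - X n)))
           \<longlonglongrightarrow> (LINT y|lborel. indicator (- ball x0 \<rho>) y * (\<psi> y * k (y - x0)))"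
    by (rule integral_dominated_convergence[OF _ _ w L bound]) measurable
  show "integrable lborel (\<lambda>y. indicator (- ball (X n) \<rho>) y * (\<Psi> n y * k (y - X n)))"
    by (rule integrable_dominated_convergence2[OF _ _ w L bound]) measurable
  show "integrable lborel (\<lambda>y. indicator (- ball x0 \<rho>) y * (\<psi> y * k (y - x0)))"
    by (rule integrable_dominated_convergence[OF _ _ w L bound]) measurable
qed

end

context singular_kernel begin

text \<open>The second difference symmetrises the principal value into an absolutely convergent integral.\<close>

definition sd :: "('a \<Rightarrow> real) \<Rightarrow> 'a \<Rightarrow> 'a \<Rightarrow> real" where
  "sd w x z = p_power p (w x - w (x + z)) + p_power p (w x - w (x - z))"

definition nonlocal_op :: "('a \<Rightarrow> real) \<Rightarrow> 'a \<Rightarrow> real" where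
  "nonlocal_op w x = (LINT z|lborel. sd w x z * k z)"

text \<open>The exponent q is p - 1 for the nonlocal operator, as in the tail space, and p for
  D_s^p.\<close>

definition tail_bound :: "real \<Rightarrow> ('a \<Rightarrow> real) \<Rightarrow> bool" where
  "tail_bound q g \<longleftrightarrow> g \<in> borel_measurable borel \<and> (\<forall>y. 0 \<le> g y) \<and> integrable lborel (\<lambda>y. g y powr q * weight y)"

lemma tail_bound_majorant:
  assumes "tail_bound q g"
  shows "integrable lborel (\<lambda>y. (2 powr q * (M powr q + g y powr q)) * weight y)"
proof -
  have "integrable lborel (\<lambda>y. 2 powr q * (M powr q * weight y + g y powr q * weight y))"
    using assms weight_integrable by (intro integrable_mult_right Bochner_Integration.integrable_add) (auto simp: tail_bound_def)
  then show ?thesis by (simp add: algebra_simps)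
qed

lemma p_power_diff_le:
  assumes "\<bar>a\<bar> \<le> M" "\<bar>b\<bar> \<le> g"
  shows "\<bar>p_power p (a - b :: real)\<bar> \<le> 2 powr (p - 1) * (M powr (p - 1) + g powr (p - 1))"
  using norm_p_power[OF p, of "a - b"] abs_diff_powr_le[of "p - 1" a M b g] assms p by simp

lemma sd_measurable [measurable]:
  assumes [measurable]: "w \<in> borel_measurable borel"
  shows "(\<lambda>z. sd w x z) \<in> borel_measurable borel"
  unfolding sd_def[abs_def] by measurable

text \<open>Both halves of the second difference are the same integral after y = x + z and y = x -
  z, the latter because k is even. Hence the factor 2, which matches the one in
  \<open>frac_p_laplacian\<close>.\<close>

lemma
  fixes w :: "'a \<Rightarrow> real"
  assumes [measurable]: "w \<in> borel_measurable borel" and g: "tail_bound (p - 1) g" and le: "\<And>y. \<bar>w y\<bar> \<le> g y" and "0 < \<rho>"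
  shows far_integrable_plus: "integrable lborel (\<lambda>z. indicator (- ball 0 \<rho>) z * (p_power p (w x - w (x + z)) * k z))"
    and far_integrable_minus: "integrable lborel (\<lambda>z. indicator (- ball 0 \<rho>) z * (p_power p (w x - w (x - z)) * k z))"
    and far_integrable_sd: "integrable lborel (\<lambda>z. indicator (- ball 0 \<rho>) z * (sd w x z * k z))"
    and far_integral_sd: "(LINT z|lborel. indicator (- ball 0 \<rho>) z * (sd w x z * k z))
      = 2 * (LINT y|lborel. indicator (- ball x \<rho>) y * (p_power p (w x - w y) * k (y - x)))"
proof -
  define f where "f y = indicator (- ball x \<rho>) y * (p_power p (w x - w y) * k (y - x))" for y
  have [measurable]: "f \<in> borel_measurable borel" unfolding f_def[abs_def] by measurable
  have f: "integrable lborel f" unfolding f_def[abs_def]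
    by (rule far_dominated(2)[OF \<open>0 < \<rho>\<close>, where X="\<lambda>_. x" and \<Psi>="\<lambda>_ y. p_power p (w x - w y)"
          and \<psi>="\<lambda>y. p_power p (w x - w y)", OF _ _ tendsto_const tail_bound_majorant[OF g, of "\<bar>w x\<bar>"]])
      (auto intro!: p_power_diff_le le)
  have f1: "f (x + z) = indicator (- ball 0 \<rho>) z * (p_power p (w x - w (x + z)) * k z)" for z
    by (simp add: f_def indicator_def dist_norm)
  have f2: "f (x - z) = indicator (- ball 0 \<rho>) z * (p_power p (w x - w (x - z)) * k z)" for z
    by (simp add: f_def indicator_def dist_norm k_even)
  show i1: "integrable lborel (\<lambda>z. indicator (- ball 0 \<rho>) z * (p_power p (w x - w (x + z)) * k z))"
    unfolding f1[symmetric] using integrable_shift[of f x] f by simp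
  show i2: "integrable lborel (\<lambda>z. indicator (- ball 0 \<rho>) z * (p_power p (w x - w (x - z)) * k z))"
    unfolding f2[symmetric] using integrable_reflect[of f x] f by simp
  have e: "indicator (- ball 0 \<rho>) z * (sd w x z * k z) = f (x + z) + f (x - z)" for z
    by (simp add: f1 f2 sd_def algebra_simps)
  show "integrable lborel (\<lambda>z. indicator (- ball 0 \<rho>) z * (sd w x z * k z))"
    unfolding e using i1 i2 by (intro Bochner_Integration.integrable_add) (simp_all add: f1 f2)
  have "(LINT z|lborel. f (x + z) + f (x - z)) = (LINT z|lborel. f (x + z)) + (LINT z|lborel. f (x - z))"
    using i1 i2 by (intro Bochner_Integration.integral_add) (simp_all add: f1 f2)
  also have "\<dots> = 2 * (LINT y|lborel. f y)" by (simp add: integral_shift integral_reflect)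
  finally show "(LINT z|lborel. indicator (- ball 0 \<rho>) z * (sd w x z * k z))
      = 2 * (LINT y|lborel. indicator (- ball x \<rho>) y * (p_power p (w x - w y) * k (y - x)))"
    unfolding e by (simp add: f_def)
qed

lemma indicator_ball_split: "indicator (ball 0 \<rho>) z * a + indicator (- ball 0 \<rho>) z * a = (a::real)"
  by (auto simp: indicator_def)

lemma
  assumes [measurable]: "w \<in> borel_measurable borel" and g: "tail_bound (p - 1) g" and le: "\<And>y. \<bar>w y\<bar> \<le> g y" and "0 < \<rho>"
    and near: "integrable lborel (\<lambda>z. indicator (ball 0 \<rho>) z * (sd w x z * k z))"
  shows nonlocal_op_integrable: "integrable lborel (\<lambda>z. sd w x z * k z)"
    and nonlocal_op_split: "nonlocal_op w x = (LINT z|lborel. indicator (ball 0 \<rho>) z * (sd w x z * k z))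
      + 2 * (LINT y|lborel. indicator (- ball x \<rho>) y * (p_power p (w x - w y) * k (y - x)))"
proof -
  note far = far_integrable_sd[OF assms(1) g le \<open>0 < \<rho>\<close>, of x]
  have "integrable lborel (\<lambda>z. indicator (ball 0 \<rho>) z * (sd w x z * k z) + indicator (- ball 0 \<rho>) z * (sd w x z * k z))"
    using near far by (rule Bochner_Integration.integrable_add)
  then show "integrable lborel (\<lambda>z. sd w x z * k z)" unfolding indicator_ball_split .
  have "nonlocal_op w x = (LINT z|lborel. indicator (ball 0 \<rho>) z * (sd w x z * k z) + indicator (- ball 0 \<rho>) z * (sd w x z * k z))"
    unfolding indicator_ball_split nonlocal_op_def ..
  also have "\<dots> = (LINT z|lborel. indicator (ball 0 \<rho>) z * (sd w x z * k z)) + (LINT z|lborel. indicator (- ball 0 \<rho>) z * (sd w x z * k z))"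
    using near far by (rule Bochner_Integration.integral_add)
  finally show "nonlocal_op w x = (LINT z|lborel. indicator (ball 0 \<rho>) z * (sd w x z * k z))
      + 2 * (LINT y|lborel. indicator (- ball x \<rho>) y * (p_power p (w x - w y) * k (y - x)))"
    unfolding far_integral_sd[OF assms(1) g le \<open>0 < \<rho>\<close>, of x] .
qed

lemma sd_bound:
  assumes "0 \<le> C" "\<bar>w x - w (x + z)\<bar> \<le> C * norm z" "\<bar>w x - w (x - z)\<bar> \<le> C * norm z"
    "\<bar>2 * w x - w (x + z) - w (x - z)\<bar> \<le> C * (norm z)\<^sup>2"
  shows "\<bar>sd w x z\<bar> \<le> (p - 1) * C powr (p - 1) * norm z powr p"
  unfolding sd_def by (rule p_power_sum_bound[OF p]) (use assms in \<open>auto simp: algebra_simps\<close>)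

lemma continuous_p_power_real: "isCont (p_power p) (t::real)"
  using continuous_p_power[OF p, of "UNIV::real set"] by (simp add: continuous_on_eq_continuous_at)

text \<open>Function and point vary together because both situations occur later: shrinking gluing
  radii at the fixed point x0, and lifted functions at points tending to x0. Near the diagonal the
  difference bounds at \<open>X n\<close> dominate, far from it the common majorant g.\<close>

lemma nonlocal_op_tendsto:
  assumes "0 < \<rho>" "X \<longlonglongrightarrow> x0" and W[measurable]: "\<And>n. W n \<in> borel_measurable borel" "w \<in> borel_measurable borel"
    and C: "0 \<le> C" "\<And>n z. norm z < \<rho> \<Longrightarrow> \<bar>W n (X n) - W n (X n + z)\<bar> \<le> C * norm z"
      "\<And>n z. norm z < \<rho> \<Longrightarrow> \<bar>2 * W n (X n) - W n (X n + z) - W n (X n - z)\<bar> \<le> C * (norm z)\<^sup>2"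
    and lim_near: "\<And>z. z \<noteq> 0 \<Longrightarrow> norm z < \<rho> \<Longrightarrow> (\<lambda>n. W n (X n + z)) \<longlonglongrightarrow> w (x0 + z)"
    and lim0: "(\<lambda>n. W n (X n)) \<longlonglongrightarrow> w x0"
    and lim: "AE y in lborel. (\<lambda>n. W n y) \<longlonglongrightarrow> w y"
    and g: "tail_bound (p - 1) g" and le: "\<And>n y. \<bar>W n y\<bar> \<le> g y" "\<And>y. \<bar>w y\<bar> \<le> g y"
  shows "(\<lambda>n. nonlocal_op (W n) (X n)) \<longlonglongrightarrow> nonlocal_op w x0"
    and "integrable lborel (\<lambda>z. sd w x0 z * k z)"
proof -
  have C': "\<bar>W n (X n) - W n (X n - z)\<bar> \<le> C * norm z" if "norm z < \<rho>" for n z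
    using C(2)[of "- z" n] that by simp
  have sdb: "\<bar>sd (W n) (X n) z\<bar> \<le> ((p - 1) * C powr (p - 1)) * norm z powr p" if "norm z < \<rho>" for n z
    by (rule sd_bound[OF C(1)]) (use that C C' in auto)
  have sdl: "(\<lambda>n. sd (W n) (X n) z) \<longlonglongrightarrow> sd w x0 z" if z: "z \<noteq> 0" "norm z < \<rho>" for z
    unfolding sd_def
    by (intro tendsto_add isCont_tendsto_compose[OF continuous_p_power_real] tendsto_diff lim0)
      (use lim_near[of z] lim_near[of "- z"] z in auto)
  note near = near_dominated[OF \<open>0 < \<rho>\<close>, where \<Phi>="\<lambda>n z. sd (W n) (X n) z" and \<phi>="sd w x0", OF _ _ sdb sdl]
  have near1: "(\<lambda>n. LINT z|lborel. indicator (ball 0 \<rho>) z * (sd (W n) (X n) z * k z))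
      \<longlonglongrightarrow> (LINT z|lborel. indicator (ball 0 \<rho>) z * (sd w x0 z * k z))"
    by (rule near(1)) measurable
  have near2: "integrable lborel (\<lambda>z. indicator (ball 0 \<rho>) z * (sd (W n) (X n) z * k z))" for n
    by (rule near(2)) measurable
  have near3: "integrable lborel (\<lambda>z. indicator (ball 0 \<rho>) z * (sd w x0 z * k z))"
    by (rule near(3)) measurable
  obtain M where M: "\<And>n. \<bar>W n (X n)\<bar> \<le> M"
    using convergent_imp_Bseq[OF convergentI[OF lim0]] unfolding Bseq_def by auto
  have far: "(\<lambda>n. LINT y|lborel. indicator (- ball (X n) \<rho>) y * (p_power p (W n (X n) - W n y) * k (y - X n)))
      \<longlonglongrightarrow> (LINT y|lborel. indicator (- ball x0 \<rho>) y * (p_power p (w x0 - w y) * k (y - x0)))"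
  proof (rule far_dominated(1)[OF \<open>0 < \<rho>\<close> _ _ \<open>X \<longlonglongrightarrow> x0\<close> tail_bound_majorant[OF g, of M]])
    show "AE y in lborel. (\<lambda>n. p_power p (W n (X n) - W n y)) \<longlonglongrightarrow> p_power p (w x0 - w y)"
      using lim by eventually_elim
        (intro isCont_tendsto_compose[OF continuous_p_power_real] tendsto_diff lim0)
  qed (auto intro!: p_power_diff_le M le)
  have "(\<lambda>n. nonlocal_op (W n) (X n)) = (\<lambda>n. (LINT z|lborel. indicator (ball 0 \<rho>) z * (sd (W n) (X n) z * k z))
      + 2 * (LINT y|lborel. indicator (- ball (X n) \<rho>) y * (p_power p (W n (X n) - W n y) * k (y - X n))))"
    by (intro ext nonlocal_op_split[OF W(1) g le(1) \<open>0 < \<rho>\<close> near2])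
  moreover have "nonlocal_op w x0 = (LINT z|lborel. indicator (ball 0 \<rho>) z * (sd w x0 z * k z))
      + 2 * (LINT y|lborel. indicator (- ball x0 \<rho>) y * (p_power p (w x0 - w y) * k (y - x0)))"
    by (rule nonlocal_op_split[OF W(2) g le(2) \<open>0 < \<rho>\<close> near3])
  ultimately show "(\<lambda>n. nonlocal_op (W n) (X n)) \<longlonglongrightarrow> nonlocal_op w x0"
    using near1 far by (auto intro!: tendsto_intros)
  show "integrable lborel (\<lambda>z. sd w x0 z * k z)"
    by (rule nonlocal_op_integrable[OF W(2) g le(2) \<open>0 < \<rho>\<close> near3])
qed

text \<open>Each truncated integral is half the integral of \<open>sd w x z * k z\<close> over |z|
  >= \<open>\<epsilon>\<close>. That function is integrable, so the principal value is an ordinary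
  limit by dominated convergence, and the prefactor 2 cancels the half.\<close>

lemma frac_p_laplacian_eq:
  assumes w[measurable]: "w \<in> borel_measurable borel" and ae: "AE y in lborel. u y = w y" and ux: "u x = w x"
    and g: "tail_bound (p - 1) g" and le: "\<And>y. \<bar>w y\<bar> \<le> g y"
    and sdi: "integrable lborel (\<lambda>z. sd w x z * k z)"
    and K: "\<And>y. K x y = k (y - x)"
  shows "frac_p_laplacian p K u x = nonlocal_op w x"
proof -
  have eq: "(LINT y:- ball x \<epsilon>|lebesgue. p_power p (u x - u y) * K x y)
      = (LINT z|lborel. indicator (- ball 0 \<epsilon>) z * (sd w x z * k z)) / 2" if "0 < \<epsilon>" for \<epsilon>
  proof -
    have "(LINT y:- ball x \<epsilon>|lebesgue. p_power p (u x - u y) * K x y)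
      = (LINT y|lborel. indicator (- ball x \<epsilon>) y * (p_power p (w x - w y) * k (y - x)))"
      unfolding set_lebesgue_integral_def
      by (rule integral_lebesgue_lborel) (measurable, use ae in \<open>eventually_elim, simp add: K ux\<close>)
    then show ?thesis using far_integral_sd[OF w g le that, of x] by simp
  qed
  have "((\<lambda>\<epsilon>. LINT z|lborel. indicator (- ball 0 \<epsilon>) z * (sd w x z * k z)) \<longlongrightarrow> nonlocal_op w x) (at_right 0)"
    unfolding tendsto_at_iff_sequentially nonlocal_op_def
  proof (intro allI impI)
    fix X :: "nat \<Rightarrow> real" assume X: "\<forall>i. X i \<in> {0<..} - {0}" "X \<longlonglongrightarrow> 0"
    have AEnz: "AE z in lborel. z \<noteq> (0::'a)" by (rule AE_lborel_singleton)
    have L: "AE z in lborel. (\<lambda>n. indicator (- ball 0 (X n)) z * (sd w x z * k z)) \<longlonglongrightarrow> sd w x z * k z"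
      using AEnz
    proof eventually_elim
      case (elim z)
      have "\<forall>\<^sub>F n in sequentially. X n < norm z"
        by (rule order_tendstoD(2)[OF X(2)]) (use elim in simp)
      then have "\<forall>\<^sub>F n in sequentially. sd w x z * k z = indicator (- ball 0 (X n)) z * (sd w x z * k z)"
        by eventually_elim simp
      then show ?case by (rule Lim_transform_eventually[OF tendsto_const])
    qed
    have B: "AE z in lborel. norm (indicator (- ball 0 (X n)) z * (sd w x z * k z)) \<le> norm (sd w x z * k z)" for n
      by (intro always_eventually allI) (auto simp: indicator_def)
    show "((\<lambda>\<epsilon>. LINT z|lborel. indicator (- ball 0 \<epsilon>) z * (sd w x z * k z)) \<circ> X)
        \<longlonglongrightarrow> (LINT z|lborel. sd w x z * k z)"
      unfolding comp_def
      by (rule integral_dominated_convergence[OF _ _ integrable_norm[OF sdi] L B]) measurable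
  qed
  then have "((\<lambda>\<epsilon>. (LINT z|lborel. indicator (- ball 0 \<epsilon>) z * (sd w x z * k z)) / 2) \<longlongrightarrow> nonlocal_op w x / 2) (at_right 0)"
    by (intro tendsto_intros) auto
  then have "((\<lambda>\<epsilon>. LINT y:- ball x \<epsilon>|lebesgue. p_power p (u x - u y) * K x y) \<longlongrightarrow> nonlocal_op w x / 2) (at_right 0)"
    by (rule Lim_transform_eventually) (auto simp: eventually_at_filter eq)
  then have "Lim (at_right 0) (\<lambda>\<epsilon>. LINT y:- ball x \<epsilon>|lebesgue. p_power p (u x - u y) * K x y) = nonlocal_op w x / 2"
    by (intro tendsto_Lim) auto
  then show ?thesis by (simp add: frac_p_laplacian_def)
qed

end

section \<open>Continuity of D_s^p\<close>

lemma singular_kernel_norm_powr: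
  assumes "0 < s" "s < 1" "2 \<le> p"
  shows "singular_kernel s p (\<lambda>z::'a::euclidean_space. norm z powr (- (real DIM('a) + s * p))) 1"
  by unfold_locales (use assms in \<open>auto intro!: continuous_intros\<close>)

lemma Dsp_integrand_eq:
  "Dsp_integrand s p w x (x + z) = \<bar>w x - w (x + z)\<bar> powr p * norm z powr (- (real DIM('a) + s * p))"
  for w :: "'a::euclidean_space \<Rightarrow> real"
  unfolding Dsp_integrand_def powr_minus divide_inverse by simp

text \<open>The p-th power of a first difference is already O(|z|^p), so a first-order bound at
  \<open>X n\<close> suffices near the diagonal. The tail calls for a majorant in the weighted L^p
  space.\<close>

lemma Dsp_tendsto:
  fixes w :: "'a::euclidean_space \<Rightarrow> real"
  assumes sp: "0 < s" "s < 1" "2 \<le> p" and "0 < \<rho>" "X \<longlonglongrightarrow> x0" and W[measurable]: "\<And>n. W n \<in> borel_measurable borel" "w \<in> borel_measurable borel"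
    and C: "0 \<le> C" "\<And>n z. norm z < \<rho> \<Longrightarrow> \<bar>W n (X n) - W n (X n + z)\<bar> \<le> C * norm z"
    and lim_near: "\<And>z. z \<noteq> 0 \<Longrightarrow> norm z < \<rho> \<Longrightarrow> (\<lambda>n. W n (X n + z)) \<longlonglongrightarrow> w (x0 + z)"
    and lim0: "(\<lambda>n. W n (X n)) \<longlonglongrightarrow> w x0"
    and lim: "AE y in lborel. (\<lambda>n. W n y) \<longlonglongrightarrow> w y"
    and g: "g \<in> borel_measurable borel" "integrable lborel (\<lambda>y. g y powr p * (1 + norm y) powr (- (real DIM('a) + s * p)))"
    and le: "\<And>n y. \<bar>W n y\<bar> \<le> g y"
  shows "(\<lambda>n. LINT y|lborel. Dsp_integrand s p (W n) (X n) y) \<longlonglongrightarrow> (LINT y|lborel. Dsp_integrand s p w x0 y)"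
    and "integrable lborel (\<lambda>y. Dsp_integrand s p (W n) (X n) y)"
proof -
  let ?k = "\<lambda>z::'a. norm z powr (- (real DIM('a) + s * p))"
  interpret singular_kernel s p ?k 1 by (rule singular_kernel_norm_powr[OF sp])
  have wt: "(1 + norm y) powr (- (real DIM('a) + s * p)) = weight y" for y :: 'a by (simp add: weight_def)
  have D: "Dsp_integrand s p w x (x + z) = \<bar>w x - w (x + z)\<bar> powr p * ?k z" for w :: "'a \<Rightarrow> real" and x z
    by (rule Dsp_integrand_eq)
  have D': "Dsp_integrand s p w x y = \<bar>w x - w y\<bar> powr p * ?k (y - x)" for w :: "'a \<Rightarrow> real" and x y
    using D[of w x "y - x"] by simp
  have tb: "tail_bound p g"
    using g le[of 0] unfolding tail_bound_def wt by (auto intro: order_trans[OF abs_ge_zero])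
  have nb: "\<bar>\<bar>W n (X n) - W n (X n + z)\<bar> powr p\<bar> \<le> C powr p * norm z powr p" if "norm z < \<rho>" for n z
    using powr_mono2[OF _ _ C(2)[OF that], of p n] sp C(1) by (simp add: powr_mult)
  have nl: "(\<lambda>n. \<bar>W n (X n) - W n (X n + z)\<bar> powr p) \<longlonglongrightarrow> \<bar>w x0 - w (x0 + z)\<bar> powr p" if "z \<noteq> 0" "norm z < \<rho>" for z
    using sp by (intro tendsto_powr2 tendsto_rabs tendsto_diff lim0 lim_near[OF that] tendsto_const) auto
  note near = near_dominated[OF \<open>0 < \<rho>\<close>, where \<Phi>="\<lambda>n z. \<bar>W n (X n) - W n (X n + z)\<bar> powr p"
      and \<phi>="\<lambda>z. \<bar>w x0 - w (x0 + z)\<bar> powr p", OF _ _ nb nl]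
  have near1: "(\<lambda>n. LINT z|lborel. indicator (ball 0 \<rho>) z * (\<bar>W n (X n) - W n (X n + z)\<bar> powr p * ?k z))
      \<longlonglongrightarrow> (LINT z|lborel. indicator (ball 0 \<rho>) z * (\<bar>w x0 - w (x0 + z)\<bar> powr p * ?k z))"
    by (rule near(1)) measurable
  have near2: "integrable lborel (\<lambda>z. indicator (ball 0 \<rho>) z * (\<bar>W n (X n) - W n (X n + z)\<bar> powr p * ?k z))" for n
    by (rule near(2)) measurable
  have near3: "integrable lborel (\<lambda>z. indicator (ball 0 \<rho>) z * (\<bar>w x0 - w (x0 + z)\<bar> powr p * ?k z))"
    by (rule near(3)) measurable
  obtain M where M: "\<And>n. \<bar>W n (X n)\<bar> \<le> M"
    using convergent_imp_Bseq[OF convergentI[OF lim0]] unfolding Bseq_def by auto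
  have fb: "\<bar>\<bar>W n (X n) - W n y\<bar> powr p\<bar> \<le> 2 powr p * (M powr p + g y powr p)" for n y
    using abs_diff_powr_le[of p, OF _ M[of n] le[of n y]] sp by simp
  have fl: "AE y in lborel. (\<lambda>n. \<bar>W n (X n) - W n y\<bar> powr p) \<longlonglongrightarrow> \<bar>w x0 - w y\<bar> powr p"
    using lim by eventually_elim
      (use sp in \<open>auto intro!: tendsto_powr2 tendsto_rabs tendsto_diff lim0 tendsto_const\<close>)
  note far = far_dominated[OF \<open>0 < \<rho>\<close>, where \<Psi>="\<lambda>n y. \<bar>W n (X n) - W n y\<bar> powr p"
      and \<psi>="\<lambda>y. \<bar>w x0 - w y\<bar> powr p", OF _ _ \<open>X \<longlonglongrightarrow> x0\<close> tail_bound_majorant[OF tb, of M] fb fl]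
  have far1: "(\<lambda>n. LINT y|lborel. indicator (- ball (X n) \<rho>) y * (\<bar>W n (X n) - W n y\<bar> powr p * ?k (y - X n)))
      \<longlonglongrightarrow> (LINT y|lborel. indicator (- ball x0 \<rho>) y * (\<bar>w x0 - w y\<bar> powr p * ?k (y - x0)))"
    by (rule far(1)) measurable
  have far2: "integrable lborel (\<lambda>y. indicator (- ball (X n) \<rho>) y * (\<bar>W n (X n) - W n y\<bar> powr p * ?k (y - X n)))" for n
    by (rule far(2)) measurable
  have far3: "integrable lborel (\<lambda>y. indicator (- ball x0 \<rho>) y * (\<bar>w x0 - w y\<bar> powr p * ?k (y - x0)))"
    by (rule far(3)) measurable
  have split: "integrable lborel (Dsp_integrand s p v x) \<and>
      (LINT y|lborel. Dsp_integrand s p v x y) = (LINT z|lborel. indicator (ball 0 \<rho>) z * (\<bar>v x - v (x + z)\<bar> powr p * ?k z))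
        + (LINT y|lborel. indicator (- ball x \<rho>) y * (\<bar>v x - v y\<bar> powr p * ?k (y - x)))"
    if [measurable]: "v \<in> borel_measurable borel"
      and n: "integrable lborel (\<lambda>z. indicator (ball 0 \<rho>) z * (\<bar>v x - v (x + z)\<bar> powr p * ?k z))"
      and f: "integrable lborel (\<lambda>y. indicator (- ball x \<rho>) y * (\<bar>v x - v y\<bar> powr p * ?k (y - x)))" for v x
  proof -
    define F where "F y = indicator (ball x \<rho>) y * (\<bar>v x - v y\<bar> powr p * ?k (y - x))" for y
    have [measurable]: "F \<in> borel_measurable borel" unfolding F_def[abs_def] by measurable
    have Fz: "F (x + z) = indicator (ball 0 \<rho>) z * (\<bar>v x - v (x + z)\<bar> powr p * ?k z)" for z
      by (simp add: F_def indicator_def dist_norm)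
    have e: "Dsp_integrand s p v x = (\<lambda>y. F y + indicator (- ball x \<rho>) y * (\<bar>v x - v y\<bar> powr p * ?k (y - x)))"
      by (auto simp: D' F_def indicator_def fun_eq_iff)
    have iF: "integrable lborel F" using integrable_shift[of F x] n by (simp add: Fz)
    have "(LINT y|lborel. F y) = (LINT z|lborel. indicator (ball 0 \<rho>) z * (\<bar>v x - v (x + z)\<bar> powr p * ?k z))"
      using integral_shift[of F x] by (simp add: Fz)
    then show ?thesis unfolding e using iF f by simp
  qed
  show "integrable lborel (\<lambda>y. Dsp_integrand s p (W n) (X n) y)"
    using split[OF W(1) near2 far2] by blast
  have "(\<lambda>n. LINT y|lborel. Dsp_integrand s p (W n) (X n) y) = (\<lambda>n. (LINT z|lborel. indicator (ball 0 \<rho>) z * (\<bar>W n (X n) - W n (X n + z)\<bar> powr p * ?k z))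
        + (LINT y|lborel. indicator (- ball (X n) \<rho>) y * (\<bar>W n (X n) - W n y\<bar> powr p * ?k (y - X n))))"
    using split[OF W(1) near2 far2] by blast
  moreover have "(LINT y|lborel. Dsp_integrand s p w x0 y) = (LINT z|lborel. indicator (ball 0 \<rho>) z * (\<bar>w x0 - w (x0 + z)\<bar> powr p * ?k z))
        + (LINT y|lborel. indicator (- ball x0 \<rho>) y * (\<bar>w x0 - w y\<bar> powr p * ?k (y - x0)))"
    using split[OF W(2) near3 far3] by blast
  ultimately show "(\<lambda>n. LINT y|lborel. Dsp_integrand s p (W n) (X n) y) \<longlonglongrightarrow> (LINT y|lborel. Dsp_integrand s p w x0 y)"
    using tendsto_add[OF near1 far1] by simp
qed

subsection \<open>Weak form of the nonlocal and of the local term\<close>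

context singular_kernel begin

text \<open>For fixed \<open>z\<close>, translating \<open>x\<close> by \<open>z\<close> turns
  \<open>\<integral> h(w(x) - w(x + z)) (v(x) - v(x + z)) dx\<close> into \<open>\<integral> v(x) sd w x z dx\<close>; multiplying by \<open>k z\<close>
  and integrating over \<open>z\<close> gives the claim without truncating the kernel.\<close>

lemma weak_nonlocal_form:
  assumes w[measurable]: "w \<in> borel_measurable borel" and g: "tail_bound (p - 1) g" and le: "\<And>y. \<bar>w y\<bar> \<le> g y"
    and r: "0 < r" "2 * r \<le> \<delta>" and C: "0 \<le> C"
    and lip: "\<And>x y. x \<in> ball x0 \<delta> \<Longrightarrow> y \<in> ball x0 \<delta> \<Longrightarrow> \<bar>w x - w y\<bar> \<le> C * norm (x - y)"
    and sec: "\<And>x z. x \<in> ball x0 \<delta> \<Longrightarrow> x + z \<in> ball x0 \<delta> \<Longrightarrow> x - z \<in> ball x0 \<delta>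
      \<Longrightarrow> \<bar>2 * w x - w (x + z) - w (x - z)\<bar> \<le> C * (norm z)\<^sup>2"
    and v: "integrable lborel v" "\<And>x. x \<notin> ball x0 r \<Longrightarrow> v x = 0"
    and D: "0 \<le> D" "\<And>z. norm z \<le> 1 \<Longrightarrow> (LINT x|lborel. \<bar>v (z + x) - v x\<bar>) \<le> D * norm z"
  shows "integrable lborel (\<lambda>(x, y). p_power p (w x - w y) * (v x - v y) * k (y - x))"
    and "integrable lborel (\<lambda>x. v x * nonlocal_op w x)"
    and "(LINT x|lborel. LINT y|lborel. p_power p (w x - w y) * (v x - v y) * k (y - x))
      = (LINT x|lborel. v x * nonlocal_op w x)"
proof -
  have mv[measurable]: "v \<in> borel_measurable borel" using v(1) by auto
  \<comment> \<open>The bound \<open>\<delta>\<close> / 2 keeps x + z and x - z in the ball of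
    radius \<open>\<delta>\<close> for x in the ball of radius r <= \<open>\<delta>\<close> / 2; the
    bound 1 is the range of the difference-quotient estimate D.\<close>
  define \<rho> where "\<rho> = min (\<delta> / 2) 1"
  have \<rho>: "0 < \<rho>" "\<rho> \<le> 1" "2 * \<rho> \<le> \<delta>" using r by (auto simp: \<rho>_def)
  have in1: "x \<in> ball x0 \<delta>" "x + z \<in> ball x0 \<delta>" "x - z \<in> ball x0 \<delta>" if "x \<in> ball x0 r" "norm z < \<rho>" for x z
  proof -
    have "dist x0 x < \<delta> / 2" using that r by simp
    moreover have "dist x0 (x + z) \<le> dist x0 x + norm z" "dist x0 (x - z) \<le> dist x0 x + norm z"
      using dist_triangle[of x0 "x + z" x] dist_triangle[of x0 "x - z" x] by (auto simp: dist_norm)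
    ultimately show "x \<in> ball x0 \<delta>" "x + z \<in> ball x0 \<delta>" "x - z \<in> ball x0 \<delta>" using that \<rho> r by auto
  qed
  have dp: "\<bar>w x - w (x + z)\<bar> \<le> C * norm z" "\<bar>w x - w (x - z)\<bar> \<le> C * norm z"
    if "x \<in> ball x0 r" "norm z < \<rho>" for x z
    using lip[OF in1(1,2)[OF that]] lip[OF in1(1,3)[OF that]] by auto
  have hb: "\<bar>p_power p t\<bar> \<le> (C * norm z) powr (p - 1)" if "\<bar>t\<bar> \<le> C * norm z" for t and z :: 'a
    using norm_p_power[OF p, of t] powr_mono2[of "p - 1" "\<bar>t\<bar>" "C * norm z"] that p by simp

  define far where "far z = (indicator (- ball 0 \<rho>) z :: real)" for z :: 'a
  define near where "near z = (indicator (ball 0 \<rho>) z :: real)" for z :: 'a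
  have [measurable]: "far \<in> borel_measurable borel" "near \<in> borel_measurable borel"
    unfolding far_def[abs_def] near_def[abs_def] by measurable
  have nf: "near z + far z = 1" "0 \<le> far z" "0 \<le> near z" for z by (auto simp: far_def near_def indicator_def)
  have AEnz: "AE z in lborel. z \<noteq> (0::'a)" by (rule AE_lborel_singleton)

  define M where "M = \<bar>w x0\<bar> + C * r"
  have M: "\<bar>w x\<bar> \<le> M" if "x \<in> ball x0 r" for x
  proof -
    have "\<bar>w x - w x0\<bar> \<le> C * norm (x - x0)" using that r by (intro lip) auto
    also have "\<dots> \<le> C * r" using that C by (intro mult_left_mono) (auto simp: dist_norm norm_minus_commute)
    finally show ?thesis by (simp add: M_def)
  qed
  obtain B where B: "\<And>x. x \<in> ball x0 r \<Longrightarrow> norm x \<le> B" "0 \<le> B"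
    using bounded_ball[of x0 r] r by (metis bounded_iff centre_in_ball norm_ge_zero order_trans)
  obtain c where c: "0 < c" "\<And>x y. norm x \<le> B \<Longrightarrow> \<rho> \<le> norm (y - x) \<Longrightarrow> k (y - x) \<le> c * weight y"
    using k_far[OF \<open>0 < \<rho>\<close> B(2)] by metis
  define G where "G y = (2 powr (p - 1) * (M powr (p - 1) + g y powr (p - 1))) * weight y" for y
  have G: "integrable lborel G" unfolding G_def[abs_def] by (rule tail_bound_majorant[OF g])
  have mG[measurable]: "G \<in> borel_measurable borel" using G by auto
  define T where "T = c * (LINT y|lborel. G y)"
  have intp: "integrable lborel (\<lambda>z. far z * (p_power p (w x - w (x + z)) * k z))" for x
    unfolding far_def by (rule far_integrable_plus[OF w g le \<rho>(1)])
  have intm: "integrable lborel (\<lambda>z. far z * (p_power p (w x - w (x - z)) * k z))" for x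
    unfolding far_def by (rule far_integrable_minus[OF w g le \<rho>(1)])
  have Tp: "(LINT z|lborel. \<bar>far z * (p_power p (w x - w (x + z)) * k z)\<bar>) \<le> T" if x: "x \<in> ball x0 r" for x
  proof -
    have "(LINT z|lborel. \<bar>far z * (p_power p (w x - w (x + z)) * k z)\<bar>) \<le> (LINT z|lborel. c * G (x + z))"
    proof (rule integral_mono)
      show "integrable lborel (\<lambda>z. \<bar>far z * (p_power p (w x - w (x + z)) * k z)\<bar>)" using intp by simp
      show "integrable lborel (\<lambda>z. c * G (x + z))" using G integrable_shift[OF mG, of x] by simp
      fix z
      show "\<bar>far z * (p_power p (w x - w (x + z)) * k z)\<bar> \<le> c * G (x + z)"
      proof (cases "z \<in> ball 0 \<rho>")
        case True
        then show ?thesis using c weight_pos[of "x + z"] by (simp add: far_def G_def less_imp_le)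
      next
        case False
        then have z: "\<rho> \<le> norm z" "z \<noteq> 0" using \<rho> by auto
        have "\<bar>p_power p (w x - w (x + z))\<bar> * k z \<le> (2 powr (p - 1) * (M powr (p - 1) + g (x + z) powr (p - 1))) * (c * weight (x + z))"
          using c(2)[OF B(1)[OF x], of "x + z"] z
          by (intro mult_mono p_power_diff_le M x le k_nonneg) auto
        then show ?thesis using False k_nonneg[OF z(2)] by (simp add: far_def G_def abs_mult mult_ac)
      qed
    qed
    also have "\<dots> = T" using integral_shift[OF mG, of x] by (simp add: T_def)
    finally show ?thesis .
  qed
  have Tm: "(LINT z|lborel. \<bar>far z * (p_power p (w x - w (x - z)) * k z)\<bar>) \<le> T" if x: "x \<in> ball x0 r" for x
  proof -
    have "(LINT z|lborel. \<bar>far z * (p_power p (w x - w (x + z)) * k z)\<bar>) = (LINT z|lborel. \<bar>far (0 - z) * (p_power p (w x - w (x + (0 - z))) * k (0 - z))\<bar>)"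
      by (rule integral_reflect[symmetric]) measurable
    also have "\<dots> = (LINT z|lborel. \<bar>far z * (p_power p (w x - w (x - z)) * k z)\<bar>)"
      by (simp add: k_even far_def indicator_def)
    finally show ?thesis using Tp[OF x] by simp
  qed

  \<comment> \<open>As v is integrable and vanishes off the ball, joint integrability follows from a
    bound on the z-integral of |A x| that is uniform for x in the ball.\<close>
  have prod: "integrable (lborel \<Otimes>\<^sub>M lborel) (\<lambda>(x, z). v x * A x z)"
    if [measurable]: "(\<lambda>(x, z). A x z) \<in> borel_measurable (lborel \<Otimes>\<^sub>M lborel)"
      and i: "\<And>x. x \<in> ball x0 r \<Longrightarrow> integrable lborel (A x)"
      and b: "\<And>x. x \<in> ball x0 r \<Longrightarrow> (LINT z|lborel. \<bar>A x z\<bar>) \<le> R" for A :: "'a \<Rightarrow> 'a \<Rightarrow> real" and R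
  proof (rule lborel_pair.Fubini_integrable)
    show "(\<lambda>(x, z). v x * A x z) \<in> borel_measurable (lborel \<Otimes>\<^sub>M lborel)" by measurable
    have ix: "integrable lborel (\<lambda>z. v x * A x z)" for x
      using i[of x] v(2)[of x] by (cases "x \<in> ball x0 r") auto
    then show "AE x in lborel. integrable lborel (\<lambda>y. case (x, y) of (x, z) \<Rightarrow> v x * A x z)" by simp
    have "integrable lborel (\<lambda>x. R * \<bar>v x\<bar>)" using v(1) by simp
    then show "integrable lborel (\<lambda>x. LINT y|lborel. norm (case (x, y) of (x, z) \<Rightarrow> v x * A x z))"
    proof (rule Bochner_Integration.integrable_bound)
      show "(\<lambda>x. LINT y|lborel. norm (case (x, y) of (x, z) \<Rightarrow> v x * A x z)) \<in> borel_measurable lborel"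
        by measurable
      show "AE x in lborel. norm (LINT y|lborel. norm (case (x, y) of (x, z) \<Rightarrow> v x * A x z)) \<le> norm (R * \<bar>v x\<bar>)"
      proof (intro always_eventually allI)
        fix x
        show "norm (LINT y|lborel. norm (case (x, y) of (x, z) \<Rightarrow> v x * A x z)) \<le> norm (R * \<bar>v x\<bar>)"
        proof (cases "x \<in> ball x0 r")
          case True
          have "0 \<le> (LINT z|lborel. \<bar>A x z\<bar>)" by simp
          then show ?thesis using b[OF True] by (simp add: abs_mult mult.commute[of R] mult_left_mono)
        qed (simp add: v(2))
      qed
    qed
  qed

  \<comment> \<open>The two halves of the second difference are separated only for far z. Near 0 the
    bound on each is O(|z|^(p-1)), too weak for the kernel when s p >= p - 1; there they stay
    together in N, where cancellation gives |z|^p.\<close>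
  define E where "E x z = v x * (far z * (p_power p (w x - w (x + z)) * k z))" for x z
  define E2 where "E2 x z = v x * (far z * (p_power p (w x - w (x - z)) * k z))" for x z
  define N where "N x z = v x * (near z * (sd w x z * k z))" for x z
  have E: "integrable (lborel \<Otimes>\<^sub>M lborel) (\<lambda>(x, z). E x z)" unfolding E_def
    by (rule prod[OF _ intp Tp]) measurable
  have E2: "integrable (lborel \<Otimes>\<^sub>M lborel) (\<lambda>(x, z). E2 x z)" unfolding E2_def
    by (rule prod[OF _ intm Tm]) measurable
  define P where "P z = near z * (norm z powr p * norm z powr (- (real DIM('a) + s * p)))" for z :: 'a
  have P: "integrable lborel P" unfolding P_def[abs_def] near_def by (rule k_near_integrable[OF \<rho>(1)])
  define cp where "cp = (p - 1) * C powr (p - 1)"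
  have cp0: "0 \<le> cp" using p by (simp add: cp_def)
  have Nb: "AE z in lborel. \<bar>near z * (sd w x z * k z)\<bar> \<le> cp * \<Lambda> * P z" if x: "x \<in> ball x0 r" for x
    using AEnz
  proof eventually_elim
    case (elim z)
    show ?case
    proof (cases "norm z < \<rho>")
      case True
      have "\<bar>sd w x z\<bar> * k z \<le> (cp * norm z powr p) * (\<Lambda> * norm z powr (- (real DIM('a) + s * p)))"
        unfolding cp_def
        by (intro mult_mono sd_bound C dp x True sec in1[OF x True] k_le k_nonneg elim) (use p in auto)
      then show ?thesis using True k_nonneg[OF elim] by (simp add: near_def P_def abs_mult mult_ac)
    qed (simp add: near_def P_def)
  qed
  have Nm: "(\<lambda>z. near z * (sd w x z * k z)) \<in> borel_measurable lborel" for x by measurable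
  have Ni: "integrable lborel (\<lambda>z. near z * (sd w x z * k z))" if x: "x \<in> ball x0 r" for x
    by (rule Bochner_Integration.integrable_bound[OF integrable_mult_right[OF P, of "cp * \<Lambda>"] Nm])
      (use Nb[OF x] in \<open>eventually_elim, auto\<close>)
  have NT: "(LINT z|lborel. \<bar>near z * (sd w x z * k z)\<bar>) \<le> (LINT z|lborel. cp * \<Lambda> * P z)" if x: "x \<in> ball x0 r" for x
    by (rule integral_mono_AE[OF integrable_abs[OF Ni[OF x]] integrable_mult_right[OF P] Nb[OF x]])
  have N: "integrable (lborel \<Otimes>\<^sub>M lborel) (\<lambda>(x, z). N x z)" unfolding N_def
    by (rule prod[OF _ Ni NT]) (unfold sd_def, measurable)
  define VS where "VS x z = v x * (sd w x z * k z)" for x z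
  have VSe: "VS x z = N x z + (E x z + E2 x z)" for x z
  proof -
    have "VS x z = (near z + far z) * VS x z" by (simp add: nf)
    then show ?thesis by (simp add: VS_def N_def E_def E2_def sd_def algebra_simps)
  qed
  have VS: "integrable (lborel \<Otimes>\<^sub>M lborel) (\<lambda>(x, z). VS x z)"
    using Bochner_Integration.integrable_add[OF N Bochner_Integration.integrable_add[OF E E2]]
    by (simp add: VSe split_def)

  \<comment> \<open>The far part that carries v(x + z). Translating x by z and oddness of h turn it
    into -E2, whose integrability carries over slice by slice.\<close>
  define E3 where "E3 x z = v (z + x) * (far z * (p_power p (w x - w (x + z)) * k z))" for x z
  have E3e: "E3 x z = - E2 (z + x) z" for x z
  proof -
    have "w x - w (x + z) = - (w (z + x) - w (z + x - z))" by (simp add: add.commute)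
    then have "p_power p (w x - w (x + z)) = - p_power p (w (z + x) - w (z + x - z))"
      by (simp only: p_power_minus)
    then show ?thesis by (simp add: E3_def E2_def)
  qed
  have mE2[measurable]: "(\<lambda>x. E2 x z) \<in> borel_measurable borel" for z unfolding E2_def by measurable
  have E3: "integrable (lborel \<Otimes>\<^sub>M lborel) (\<lambda>(z, x). E3 x z)"
  proof (rule lborel_pair.Fubini_integrable)
    show "(\<lambda>(z, x). E3 x z) \<in> borel_measurable (lborel \<Otimes>\<^sub>M lborel)" unfolding E3_def by measurable
    have E2s: "integrable (lborel \<Otimes>\<^sub>M lborel) (\<lambda>(z, x). E2 x z)"
      using lborel_pair.integrable_product_swap[OF E2] by (simp add: split_def)
    have "AE z in lborel. integrable lborel (\<lambda>x. E2 x z)"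
      using lborel_pair.AE_integrable_fst[of "\<lambda>z x. E2 x z"] E2s by simp
    then show "AE z in lborel. integrable lborel (\<lambda>x. case (z, x) of (z, x) \<Rightarrow> E3 x z)"
      by eventually_elim (simp add: E3e integrable_shift[OF mE2])
    have "integrable lborel (\<lambda>z. LINT x|lborel. \<bar>E2 x z\<bar>)"
      using lborel_pair.integrable_fst[of "\<lambda>z x. \<bar>E2 x z\<bar>"] integrable_abs[OF E2s] by (simp add: split_def)
    moreover have "(LINT x|lborel. \<bar>E2 (z + x) z\<bar>) = (LINT x|lborel. \<bar>E2 x z\<bar>)" for z
      by (rule integral_shift[of "\<lambda>x. \<bar>E2 x z\<bar>"]) measurable
    ultimately show "integrable lborel (\<lambda>z. LINT x|lborel. norm (case (z, x) of (z, x) \<Rightarrow> E3 x z))"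
      by (simp add: E3e)
  qed

  define Q where "Q z x = p_power p (w x - w (x + z)) * (v x - v (z + x)) * k z" for z x
  have [measurable]: "(\<lambda>(z, x). Q z x) \<in> borel_measurable (lborel \<Otimes>\<^sub>M lborel)" unfolding Q_def by measurable
  \<comment> \<open>Near the diagonal w contributes (C |z|)^(p-1) and, after integration in x, the
    difference quotient of v contributes D |z|: together |z|^p, integrable against the
    kernel.\<close>
  define NQ where "NQ z x = near z * Q z x" for z x
  have iz: "integrable lborel (\<lambda>x. \<bar>v (z + x) - v x\<bar>)" for z
    using v(1) integrable_shift[OF mv, of z] by (intro integrable_abs Bochner_Integration.integrable_diff) auto
  have NQb: "\<bar>NQ z x\<bar> \<le> (near z * (C * norm z) powr (p - 1) * k z) * \<bar>v (z + x) - v x\<bar>" if "z \<noteq> 0" for z x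
  proof (cases "norm z < \<rho> \<and> v (z + x) \<noteq> v x")
    case True
    have "x \<in> ball x0 r \<or> x + z \<in> ball x0 r" using True v(2) by (metis add.commute)
    then have "\<bar>w x - w (x + z)\<bar> \<le> C * norm z"
    proof
      assume "x \<in> ball x0 r"
      then show ?thesis using dp True by blast
    next
      assume "x + z \<in> ball x0 r"
      from dp(2)[OF this, of z] True show ?thesis by (simp add: abs_minus_commute)
    qed
    from hb[OF this] show ?thesis
      using True k_nonneg[OF that] by (simp add: NQ_def Q_def near_def abs_mult abs_minus_commute mult_ac mult_left_mono)
  next
    case False
    then show ?thesis using k_nonneg[OF that] by (auto simp: NQ_def Q_def near_def)
  qed
  have NQi: "integrable lborel (\<lambda>x. NQ z x)" if "z \<noteq> 0" for z
  proof (rule Bochner_Integration.integrable_bound[OF integrable_mult_right[OF iz[of z], of "near z * (C * norm z) powr (p - 1) * k z"]])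
    show "(\<lambda>x. NQ z x) \<in> borel_measurable lborel" unfolding NQ_def Q_def by measurable
    show "AE x in lborel. norm (NQ z x) \<le> norm (near z * (C * norm z) powr (p - 1) * k z * \<bar>v (z + x) - v x\<bar>)"
      using NQb[OF that] by (auto intro!: always_eventually order_trans[OF _ abs_ge_self])
  qed
  have NQ: "integrable (lborel \<Otimes>\<^sub>M lborel) (\<lambda>(z, x). NQ z x)"
  proof (rule lborel_pair.Fubini_integrable)
    show mNQ[measurable]: "(\<lambda>(z, x). NQ z x) \<in> borel_measurable (lborel \<Otimes>\<^sub>M lborel)" unfolding NQ_def by measurable
    show "AE z in lborel. integrable lborel (\<lambda>x. case (z, x) of (z, x) \<Rightarrow> NQ z x)"
      using AEnz by eventually_elim (simp add: NQi)
    show "integrable lborel (\<lambda>z. LINT x|lborel. norm (case (z, x) of (z, x) \<Rightarrow> NQ z x))"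
    proof (rule Bochner_Integration.integrable_bound[OF integrable_mult_right[OF P, of "C powr (p - 1) * \<Lambda> * D"]])
      show "(\<lambda>z. LINT x|lborel. norm (case (z, x) of (z, x) \<Rightarrow> NQ z x)) \<in> borel_measurable lborel" by measurable
      show "AE z in lborel. norm (LINT x|lborel. norm (case (z, x) of (z, x) \<Rightarrow> NQ z x)) \<le> norm (C powr (p - 1) * \<Lambda> * D * P z)"
        using AEnz
      proof eventually_elim
        case (elim z)
        have n0: "0 \<le> near z * (C * norm z) powr (p - 1) * k z" using k_nonneg[OF elim] by (simp add: nf)
        have "(LINT x|lborel. \<bar>NQ z x\<bar>) \<le> (LINT x|lborel. (near z * (C * norm z) powr (p - 1) * k z) * \<bar>v (z + x) - v x\<bar>)"
          by (rule integral_mono) (use iz[of z] NQi[OF elim] NQb[OF elim] in auto)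
        also have "\<dots> = (near z * (C * norm z) powr (p - 1) * k z) * (LINT x|lborel. \<bar>v (z + x) - v x\<bar>)" by simp
        also have "\<dots> \<le> C powr (p - 1) * \<Lambda> * D * P z"
        proof (cases "norm z < \<rho>")
          case True
          have "(near z * (C * norm z) powr (p - 1) * k z) * (LINT x|lborel. \<bar>v (z + x) - v x\<bar>)
              \<le> (near z * (C * norm z) powr (p - 1) * (\<Lambda> * norm z powr (- (real DIM('a) + s * p)))) * (D * norm z)"
            using True \<rho> k_nonneg[OF elim] \<Lambda> by (intro mult_mono D k_le elim) (auto simp: nf)
          also have "\<dots> = C powr (p - 1) * \<Lambda> * D * (near z * ((norm z powr (p - 1) * norm z powr 1) * norm z powr (- (real DIM('a) + s * p))))"
            using C by (simp add: powr_mult mult_ac)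
          also have "\<dots> = C powr (p - 1) * \<Lambda> * D * P z"
            unfolding powr_add[of "norm z" "p - 1" 1, symmetric] by (simp add: P_def)
          finally show ?thesis .
        qed (simp add: near_def P_def)
        finally show ?case by (simp add: order_trans[OF _ abs_ge_self])
      qed
    qed
  qed
  have Qe: "Q z x = NQ z x + (E x z - E3 x z)" for z x
  proof -
    have "Q z x = (near z + far z) * Q z x" by (simp add: nf)
    then show ?thesis by (simp add: Q_def NQ_def E_def E3_def algebra_simps)
  qed
  have Es: "integrable (lborel \<Otimes>\<^sub>M lborel) (\<lambda>(z, x). E x z)"
    using lborel_pair.integrable_product_swap[OF E] by (simp add: split_def)
  have Q: "integrable (lborel \<Otimes>\<^sub>M lborel) (\<lambda>(z, x). Q z x)"
    using Bochner_Integration.integrable_add[OF NQ Bochner_Integration.integrable_diff[OF Es E3]]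
    by (simp add: Qe split_def)

  \<comment> \<open>For almost every fixed z the halves a and b are integrable in x separately, so
    the translation by z can be done on the slice. Joint integrability is called upon only for Q and
    VS, when the order of integration is exchanged.\<close>
  have QVS: "AE z in lborel. (LINT x|lborel. Q z x) = (LINT x|lborel. VS x z)"
  proof -
    have aeE: "AE z in lborel. integrable lborel (\<lambda>x. E x z)"
      using lborel_pair.AE_integrable_fst[of "\<lambda>z x. E x z"] Es by simp
    have aeE2: "AE z in lborel. integrable lborel (\<lambda>x. E2 x z)"
      using lborel_pair.AE_integrable_snd[of E2] E2 by simp
    show ?thesis using aeE aeE2
    proof eventually_elim
      case (elim z)
      define a where "a x = v x * (p_power p (w x - w (x + z)) * k z)" for x
      define b where "b x = v x * (p_power p (w x - w (x - z)) * k z)" for x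
      have [measurable]: "a \<in> borel_measurable borel" "b \<in> borel_measurable borel"
        unfolding a_def[abs_def] b_def[abs_def] by measurable
      have ab: "integrable lborel a \<and> integrable lborel b"
      proof (cases "norm z < \<rho>")
        case True
        have d: "integrable lborel (\<lambda>x. ((C * norm z) powr (p - 1) * \<bar>k z\<bar>) * \<bar>v x\<bar>)"
          using v(1) by simp
        have "norm (a x) \<le> ((C * norm z) powr (p - 1) * \<bar>k z\<bar>) * \<bar>v x\<bar>" for x
        proof (cases "x \<in> ball x0 r")
          case x: True
          have "\<bar>p_power p (w x - w (x + z))\<bar> * (\<bar>k z\<bar> * \<bar>v x\<bar>) \<le> (C * norm z) powr (p - 1) * (\<bar>k z\<bar> * \<bar>v x\<bar>)"
            by (intro mult_right_mono hb dp x True) auto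
          then show ?thesis by (simp add: a_def abs_mult mult_ac)
        qed (simp add: a_def v(2))
        then have "integrable lborel a"
          by (intro Bochner_Integration.integrable_bound[OF d]) (auto intro!: always_eventually order_trans[OF _ abs_ge_self])
        moreover have "norm (b x) \<le> ((C * norm z) powr (p - 1) * \<bar>k z\<bar>) * \<bar>v x\<bar>" for x
        proof (cases "x \<in> ball x0 r")
          case x: True
          have "\<bar>p_power p (w x - w (x - z))\<bar> * (\<bar>k z\<bar> * \<bar>v x\<bar>) \<le> (C * norm z) powr (p - 1) * (\<bar>k z\<bar> * \<bar>v x\<bar>)"
            by (intro mult_right_mono hb dp x True) auto
          then show ?thesis by (simp add: b_def abs_mult mult_ac)
        qed (simp add: b_def v(2))
        then have "integrable lborel b"
          by (intro Bochner_Integration.integrable_bound[OF d]) (auto intro!: always_eventually order_trans[OF _ abs_ge_self])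
        ultimately show ?thesis by simp
      next
        case False
        then have "far z = 1" by (simp add: far_def)
        then have "(\<lambda>x. E x z) = a" "(\<lambda>x. E2 x z) = b" by (auto simp: E_def E2_def a_def b_def)
        then show ?thesis using elim by simp
      qed
      have "Q z x = a x + b (z + x)" for x
      proof -
        have "w x - w (x + z) = - (w (z + x) - w (z + x - z))" by (simp add: add.commute)
        then have "p_power p (w x - w (x + z)) = - p_power p (w (z + x) - w (z + x - z))"
          by (simp only: p_power_minus)
        then have "b (z + x) = - v (z + x) * (p_power p (w x - w (x + z)) * k z)" by (simp add: b_def)
        then show ?thesis by (simp add: Q_def a_def algebra_simps)
      qed
      then have "(LINT x|lborel. Q z x) = (LINT x|lborel. a x) + (LINT x|lborel. b (z + x))"
        using ab integrable_shift[of b z] by simp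
      also have "\<dots> = (LINT x|lborel. a x + b x)" using ab integral_shift[of b z] by simp
      also have "\<dots> = (LINT x|lborel. VS x z)" by (simp add: a_def b_def VS_def sd_def algebra_simps)
      finally show ?case .
    qed
  qed

  \<comment> \<open>Back from the displacement z to the second point y = x + z, by a translation for
    each fixed x.\<close>
  define n where "n x y = p_power p (w x - w y) * (v x - v y) * k (y - x)" for x y
  have nQ: "n x (x + z) = Q z x" for x z by (simp add: n_def Q_def add.commute)
  have mn[measurable]: "(\<lambda>(x, y). n x y) \<in> borel_measurable (lborel \<Otimes>\<^sub>M lborel)" unfolding n_def by measurable
  have mn'[measurable]: "n x \<in> borel_measurable borel" for x unfolding n_def by measurable
  have Qs: "integrable (lborel \<Otimes>\<^sub>M lborel) (\<lambda>(x, z). Q z x)"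
    using lborel_pair.integrable_product_swap[OF Q] by (simp add: split_def)
  have ni: "integrable (lborel \<Otimes>\<^sub>M lborel) (\<lambda>(x, y). n x y)"
  proof (rule lborel_pair.Fubini_integrable[OF mn])
    have "AE x in lborel. integrable lborel (\<lambda>z. Q z x)"
      using lborel_pair.AE_integrable_fst[of "\<lambda>x z. Q z x"] Qs by simp
    then show "AE x in lborel. integrable lborel (\<lambda>y. case (x, y) of (x, y) \<Rightarrow> n x y)"
      by eventually_elim (use integrable_shift[OF mn'] in \<open>simp flip: nQ\<close>)
    have "integrable lborel (\<lambda>x. LINT z|lborel. \<bar>Q z x\<bar>)"
      using lborel_pair.integrable_fst[of "\<lambda>x z. \<bar>Q z x\<bar>"] integrable_abs[OF Qs] by (simp add: split_def)
    moreover have "(LINT z|lborel. \<bar>n x (x + z)\<bar>) = (LINT y|lborel. \<bar>n x y\<bar>)" for x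
      by (rule integral_shift[of "\<lambda>y. \<bar>n x y\<bar>"]) measurable
    ultimately show "integrable lborel (\<lambda>x. LINT y|lborel. norm (case (x, y) of (x, y) \<Rightarrow> n x y))"
      by (simp flip: nQ)
  qed
  then show "integrable lborel (\<lambda>(x, y). p_power p (w x - w y) * (v x - v y) * k (y - x))"
    by (simp add: n_def lborel_prod)
  have VSx: "(LINT z|lborel. VS x z) = v x * nonlocal_op w x" for x
    by (simp add: VS_def nonlocal_op_def)
  show "integrable lborel (\<lambda>x. v x * nonlocal_op w x)"
    using lborel_pair.integrable_fst[of VS] VS by (simp add: VSx)
  have "(LINT x|lborel. LINT y|lborel. n x y) = (LINT x|lborel. LINT z|lborel. Q z x)"
    unfolding nQ[symmetric] by (simp add: integral_shift[OF mn'])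
  also have "\<dots> = (LINT z|lborel. LINT x|lborel. Q z x)"
    using lborel_pair.Fubini_integral[of "\<lambda>z x. Q z x"] Q by simp
  also have "\<dots> = (LINT z|lborel. LINT x|lborel. VS x z)"
  proof (rule integral_cong_AE[OF _ _ QVS])
    show "(\<lambda>z. LINT x|lborel. Q z x) \<in> borel_measurable lborel" by measurable
    show "(\<lambda>z. LINT x|lborel. VS x z) \<in> borel_measurable lborel" unfolding VS_def sd_def by measurable
  qed
  also have "\<dots> = (LINT x|lborel. LINT z|lborel. VS x z)"
    using lborel_pair.Fubini_integral[of VS] VS by simp
  finally show "(LINT x|lborel. LINT y|lborel. p_power p (w x - w y) * (v x - v y) * k (y - x))
      = (LINT x|lborel. v x * nonlocal_op w x)"
    by (simp add: VSx n_def)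
qed

end

section \<open>Quadratic polynomials and their p-Laplacian\<close>

definition quad :: "real \<Rightarrow> 'a::euclidean_space \<Rightarrow> ('a \<Rightarrow> 'a) \<Rightarrow> 'a \<Rightarrow> 'a \<Rightarrow> real" where
  "quad a \<xi> B x0 x = a + \<xi> \<bullet> (x - x0) + (B (x - x0) \<bullet> (x - x0)) / 2"

definition quad_grad :: "'a::euclidean_space \<Rightarrow> ('a \<Rightarrow> 'a) \<Rightarrow> 'a \<Rightarrow> 'a \<Rightarrow> 'a" where
  "quad_grad \<xi> B x0 x = \<xi> + B (x - x0)"

locale symmetric_map =
  fixes B :: "'a::euclidean_space \<Rightarrow> 'a"
  assumes lin: "linear B" and sym: "B x \<bullet> y = x \<bullet> B y"
begin

lemma blin: "bounded_linear B"
  using lin by (simp add: linear_conv_bounded_linear)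

lemma B_diff: "B (x - y) = B x - B y" and B_add: "B (x + y) = B x + B y" and B_neg: "B (- x) = - B x"
  using lin by (simp_all add: linear_diff linear_add linear_neg)

lemma quad_grad_has_derivative: "(quad_grad \<xi> B x0 has_derivative B) (at x)"
  unfolding quad_grad_def[abs_def]
  by (auto intro!: derivative_eq_intros bounded_linear.has_derivative[OF blin])

lemma quad_grad_continuous: "continuous_on S (quad_grad \<xi> B x0)"
  using quad_grad_has_derivative by (meson continuous_at_imp_continuous_on has_derivative_continuous)

lemma quad_grad_smooth: "smooth_on (\<lambda>x. quad_grad \<xi> B x0 x \<bullet> b) UNIV"
proof -
  have "smooth_on (\<lambda>x. B x \<bullet> b + (\<xi> - B x0) \<bullet> b) UNIV"
    by (intro smooth_on_add smooth_on_const smooth_on_linear bounded_linear_compose[OF bounded_linear_inner_left blin]) auto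
  then show ?thesis by (simp add: quad_grad_def B_diff inner_add_left inner_diff_left algebra_simps)
qed

lemma quad_add: "quad a \<xi> B x0 (x + z) = quad a \<xi> B x0 x + quad_grad \<xi> B x0 x \<bullet> z + (B z \<bullet> z) / 2"
proof -
  have e: "x + z - x0 = (x - x0) + z" by simp
  have "a + \<xi> \<bullet> (y + z) + (B (y + z) \<bullet> (y + z)) / 2 = a + \<xi> \<bullet> y + (B y \<bullet> y) / 2 + (\<xi> + B y) \<bullet> z + (B z \<bullet> z) / 2" for y
  proof -
    have "B z \<bullet> y = B y \<bullet> z" by (metis sym inner_commute)
    then show ?thesis by (simp add: B_add inner_add_left inner_add_right field_simps)
  qed
  then show ?thesis unfolding quad_def quad_grad_def e .
qed

lemma quad_has_derivative: "(quad a \<xi> B x0 has_derivative (\<lambda>h. quad_grad \<xi> B x0 x \<bullet> h)) (at x)"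
proof -
  have "(quad a \<xi> B x0 has_derivative (\<lambda>h. \<xi> \<bullet> h + (B (x - x0) \<bullet> h + B h \<bullet> (x - x0)) / 2)) (at x)"
    unfolding quad_def[abs_def]
    by (auto intro!: derivative_eq_intros bounded_linear.has_derivative[OF blin])
  moreover have "B h \<bullet> (x - x0) = B (x - x0) \<bullet> h" for h by (metis sym inner_commute)
  ultimately show ?thesis by (simp add: quad_grad_def inner_add_left)
qed

lemma quad_smooth: "smooth_on (quad a \<xi> B x0) UNIV"
proof -
  have "smooth_on (\<lambda>x. quad_grad \<xi> B x0 x \<bullet> b) UNIV" for b by (rule quad_grad_smooth)
  then have "Ck_on (Suc k) (quad a \<xi> B x0) UNIV" for k
    by (intro Ck_on_SucI[OF _ quad_has_derivative]) (auto simp: smooth_on_def)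
  then show ?thesis unfolding smooth_on_def using Ck_on_SucD by blast
qed

lemma quad_continuous: "continuous_on S (quad a \<xi> B x0)"
  using smooth_on_continuous[OF quad_smooth] continuous_on_subset by blast

text \<open>The p-Laplacian of the quadratic polynomial, without the minus sign of the equation: the
  divergence of the flux \<open>p_power p\<close> of \<open>quad_grad \<xi> B x0\<close>, expanded
  by the chain rule with constant Hessian B.\<close>

definition local_op :: "real \<Rightarrow> 'a \<Rightarrow> 'a \<Rightarrow> 'a \<Rightarrow> real" where
  "local_op p \<xi> x0 x = (\<Sum>b\<in>Basis. p_power_deriv p (quad_grad \<xi> B x0 x) (B b) \<bullet> b)"

lemma local_op_continuous:
  assumes "2 \<le> p"
  shows "continuous_on S (local_op p \<xi> x0)"
proof -
  have "isCont (local_op p \<xi> x0) x" for x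
    unfolding local_op_def[abs_def] isCont_def
    by (intro tendsto_sum tendsto_inner tendsto_p_power_deriv[OF assms] tendsto_const)
      (use quad_grad_continuous[of UNIV \<xi> x0] in \<open>auto simp: continuous_on_def\<close>)
  then show ?thesis by (simp add: continuous_at_imp_continuous_on)
qed

definition regularised :: "real \<Rightarrow> real \<Rightarrow> 'a \<Rightarrow> 'a \<Rightarrow> 'a \<Rightarrow> real" where
  "regularised p \<epsilon> \<xi> x0 x = ((norm (quad_grad \<xi> B x0 x))\<^sup>2 + \<epsilon>) powr ((p - 2) / 2)"

lemma norm_quad_grad_sq_smooth: "smooth_on (\<lambda>x. (norm (quad_grad \<xi> B x0 x))\<^sup>2) UNIV"
proof -
  have "smooth_on (\<lambda>x. \<Sum>b\<in>Basis. (quad_grad \<xi> B x0 x \<bullet> b) * (quad_grad \<xi> B x0 x \<bullet> b)) UNIV"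
    by (intro smooth_on_sum smooth_on_mult quad_grad_smooth) auto
  then show ?thesis
    unfolding power2_norm_eq_inner by (subst euclidean_inner)
qed

lemma regularised_smooth: "0 < \<epsilon> \<Longrightarrow> smooth_on (regularised p \<epsilon> \<xi> x0) UNIV"
  unfolding regularised_def[abs_def]
  by (intro smooth_on_powr smooth_on_add norm_quad_grad_sq_smooth smooth_on_const) (auto simp: add_nonneg_pos)

lemma regularised_has_derivative:
  assumes "0 < \<epsilon>"
  shows "(regularised p \<epsilon> \<xi> x0 has_derivative
    (\<lambda>h. (p - 2) * ((norm (quad_grad \<xi> B x0 x))\<^sup>2 + \<epsilon>) powr ((p - 4) / 2) * (quad_grad \<xi> B x0 x \<bullet> B h))) (at x)"
proof -
  let ?g = "quad_grad \<xi> B x0"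
  have pos: "0 < (norm (?g x))\<^sup>2 + \<epsilon>" using assms by (simp add: add_nonneg_pos)
  have "((\<lambda>x. ?g x \<bullet> ?g x) has_derivative (\<lambda>h. ?g x \<bullet> B h + B h \<bullet> ?g x)) (at x)"
    by (rule has_derivative_inner[OF quad_grad_has_derivative quad_grad_has_derivative])
  then have "((\<lambda>x. (norm (?g x))\<^sup>2 + \<epsilon>) has_derivative (\<lambda>h. 2 * (?g x \<bullet> B h))) (at x)"
    unfolding power2_norm_eq_inner
    by (rule has_derivative_eq_rhs[OF has_derivative_add[OF _ has_derivative_const]]) (simp add: inner_commute)
  from has_derivative_compose[OF this has_real_derivative_powr[OF pos, of "(p - 2) / 2", unfolded has_field_derivative_def]]
  show ?thesis unfolding regularised_def[abs_def]
    by (rule has_derivative_eq_rhs) (auto simp: fun_eq_iff field_simps)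
qed

text \<open>Regularising \<open>|\<xi>|\<^sup>p\<^sup>-\<^sup>2\<close> makes the flux \<open>C\<^sup>\<infinity>\<close>, hence admissible in the definition of the
  weak gradient; the regularisation is removed by dominated convergence.\<close>

lemma weak_local_form:
  assumes p: "2 \<le> p" and wg: "borel_weak_gradient v Dv" and out: "\<And>x. x \<notin> ball x0 r \<Longrightarrow> v x = 0" and r: "0 < r"
  shows "integrable lborel (\<lambda>x. indicator (ball x0 r) x * (p_power p (quad_grad \<xi> B x0 x) \<bullet> Dv x))"
    and "(LINT x|lborel. indicator (ball x0 r) x * (p_power p (quad_grad \<xi> B x0 x) \<bullet> Dv x))
      = - (LINT x|lborel. v x * local_op p \<xi> x0 x)"
    and "integrable lborel (\<lambda>x. v x * local_op p \<xi> x0 x)"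
proof -
  let ?g = "quad_grad \<xi> B x0"
  have v: "loc_int v" and Dv: "loc_int Dv" using wg by (auto simp: borel_weak_gradient_def)
  have mv[measurable]: "v \<in> borel_measurable borel" using v by (simp add: loc_int_def)
  have mD[measurable]: "Dv \<in> borel_measurable borel" using Dv by (simp add: loc_int_def)
  have mg[measurable]: "?g \<in> borel_measurable borel" by (rule borel_measurable_continuous_onI[OF quad_grad_continuous])
  have mL[measurable]: "local_op p \<xi> x0 \<in> borel_measurable borel" by (rule borel_measurable_continuous_onI[OF local_op_continuous[OF p]])
  have iv: "integrable lborel v"
    using loc_int_zero_off[OF v compact_cball, of x0 r] out by (auto simp: subset_iff)
  have D0: "AE x in lborel. x \<notin> ball x0 r \<longrightarrow> Dv x = 0" by (rule weak_gradient_vanishes[OF wg out r])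
  obtain G where G: "0 \<le> G" "\<And>x. x \<in> cball x0 r \<Longrightarrow> norm (?g x) \<le> G"
    using bounded_on_compact[OF continuous_on_norm[OF quad_grad_continuous] compact_cball[of x0 r]] by (metis abs_norm_cancel)
  obtain KB where KB: "0 < KB" "\<And>z. norm (B z) \<le> norm z * KB" using bounded_linear.pos_bounded[OF blin] by blast
  define e where "e n = 1 / (real n + 1)" for n :: nat
  have e: "0 < e n" "e n \<le> 1" for n by (auto simp: e_def)
  have elim: "e \<longlonglongrightarrow> 0" unfolding e_def[abs_def]
    using LIMSEQ_inverse_real_of_nat by (simp add: inverse_eq_divide add.commute)
  define R where "R n = regularised p (e n) \<xi> x0" for n
  \<comment> \<open>The b-th diagonal entry of the derivative of the regularised flux; summed over b
    it is the divergence.\<close>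
  define d where "d n x b = R n x * (B b \<bullet> b)
      + ((p - 2) * ((norm (?g x))\<^sup>2 + e n) powr ((p - 4) / 2) * (?g x \<bullet> B b)) * (?g x \<bullet> b)" for n x b
  define H where "H = (G\<^sup>2 + 1) powr ((p - 2) / 2)"
  have posn: "0 < (norm (?g x))\<^sup>2 + e n" for x n using e(1)[of n] by (simp add: add_nonneg_pos)
  have Rb: "0 \<le> R n x" "R n x \<le> H" if "x \<in> cball x0 r" for n x
  proof -
    show "0 \<le> R n x" by (simp add: R_def regularised_def)
    have "(norm (?g x))\<^sup>2 \<le> G\<^sup>2" using G(2)[OF that] by (simp add: power_mono)
    then show "R n x \<le> H" unfolding R_def regularised_def H_def
      using e[of n] posn[of x n] p by (intro powr_mono2) auto
  qed
  have mR[measurable]: "R n \<in> borel_measurable borel" for n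
    unfolding R_def by (rule smooth_borel[OF regularised_smooth[OF e(1)]])
  have ident: "(LINT x|lborel. v x * (\<Sum>b\<in>Basis. d n x b)) = - (LINT x|lborel. indicator (ball x0 r) x * (R n x * (?g x \<bullet> Dv x)))" for n
  proof -
    \<comment> \<open>The cutoff gives the flux compact support. It equals 1 on the ball, and
      outside v vanishes and Dv vanishes almost everywhere, so it leaves no trace in either
      integral.\<close>
    define \<phi> where "\<phi> b x = cutoff x0 r (2 * r) x * (R n x * (?g x \<bullet> b))" for b x
    have \<phi>s: "smooth_on (\<phi> b) UNIV" for b unfolding \<phi>_def R_def
      by (intro smooth_on_mult smooth_on_cutoff regularised_smooth e quad_grad_smooth) auto
    have \<phi>t: "\<phi> b \<in> test_functions UNIV" for b
      by (rule test_functionsI[OF \<phi>s compact_cball[of x0 "2 * r"]]) (use r in \<open>auto simp: \<phi>_def cutoff_eq_0\<close>)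
    have fd: "v x * frechet_derivative (\<phi> b) (at x) b = v x * d n x b" for x b
    proof (cases "x \<in> ball x0 r")
      case True
      have 1: "((\<lambda>x. R n x * (?g x \<bullet> b)) has_derivative
        (\<lambda>h. R n x * (B h \<bullet> b) + ((p - 2) * ((norm (?g x))\<^sup>2 + e n) powr ((p - 4) / 2) * (?g x \<bullet> B h)) * (?g x \<bullet> b))) (at x)"
        unfolding R_def
        by (rule has_derivative_mult[OF regularised_has_derivative[OF e(1)]
              has_derivative_inner_left[OF quad_grad_has_derivative]])
      have 2: "R n y * (?g y \<bullet> b) = \<phi> b y" if "y \<in> ball x0 r" for y
      proof -
        have "cutoff x0 r (2 * r) y = 1" using that r by (intro cutoff_eq_1) auto
        then show ?thesis by (simp add: \<phi>_def)
      qed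
      have "frechet_derivative (\<phi> b) (at x) b = d n x b"
        using fun_cong[OF frechet_derivative_at[OF has_derivative_transform_within_open[OF 1 open_ball True 2]], of b]
        by (simp only: d_def)
      then show ?thesis by simp
    qed (simp add: out)
    have i1: "integrable lborel (\<lambda>x. v x * d n x b)" for b
      using integrable_loc_test(2)[OF v \<phi>t, of b b] by (simp add: fd)
    have i2: "integrable lborel (\<lambda>x. (Dv x \<bullet> b) * \<phi> b x)" for b
      by (rule integrable_loc_test(1)[OF loc_int_inner[OF Dv] \<phi>t])
    have "(LINT x|lborel. v x * (\<Sum>b\<in>Basis. d n x b)) = (\<Sum>b\<in>Basis. LINT x|lborel. v x * d n x b)"
      unfolding sum_distrib_left by (rule Bochner_Integration.integral_sum) (rule i1)
    also have "\<dots> = (\<Sum>b\<in>Basis. - (LINT x|lborel. (Dv x \<bullet> b) * \<phi> b x))"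
      using weak_gradient_direction[OF wg \<phi>t] by (simp flip: fd)
    also have "\<dots> = - (LINT x|lborel. (\<Sum>b\<in>Basis. (Dv x \<bullet> b) * \<phi> b x))"
      by (subst Bochner_Integration.integral_sum) (auto simp: i2 sum_negf)
    also have "(LINT x|lborel. (\<Sum>b\<in>Basis. (Dv x \<bullet> b) * \<phi> b x)) = (LINT x|lborel. indicator (ball x0 r) x * (R n x * (?g x \<bullet> Dv x)))"
    proof (rule integral_cong_AE)
      show "(\<lambda>x. \<Sum>b\<in>Basis. (Dv x \<bullet> b) * \<phi> b x) \<in> borel_measurable lborel"
        using i2 by (intro borel_measurable_sum) (metis borel_measurable_integrable)
      show "AE x in lborel. (\<Sum>b\<in>Basis. (Dv x \<bullet> b) * \<phi> b x) = indicator (ball x0 r) x * (R n x * (?g x \<bullet> Dv x))"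
        using D0
      proof eventually_elim
        case (elim x)
        show ?case
        proof (cases "x \<in> ball x0 r")
          case True
          have "(\<Sum>b\<in>Basis. (Dv x \<bullet> b) * \<phi> b x) = R n x * (\<Sum>b\<in>Basis. (?g x \<bullet> b) * (Dv x \<bullet> b))"
            unfolding sum_distrib_left using True r by (intro sum.cong) (auto simp: \<phi>_def cutoff_eq_1)
          then show ?thesis using True by (simp add: euclidean_inner[of "?g x" "Dv x"])
        qed (use elim in simp)
      qed
    qed measurable
    finally show ?thesis .
  qed
  have dlim: "(\<lambda>n. d n x b) \<longlonglongrightarrow> p_power_deriv p (?g x) (B b) \<bullet> b"
    and Rlim: "(\<lambda>n. R n x * (?g x \<bullet> y)) \<longlonglongrightarrow> p_power p (?g x) \<bullet> y" for x y b
  proof -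
    have nl: "(\<lambda>n. (norm (?g x))\<^sup>2 + e n) \<longlonglongrightarrow> (norm (?g x))\<^sup>2"
      using tendsto_add[OF tendsto_const elim] by simp
    have pw: "((norm (?g x))\<^sup>2) powr (c / 2) = norm (?g x) powr c" if "?g x \<noteq> 0" for c
      using that by (simp add: powr_powr flip: powr_numeral)
    have pl: "(\<lambda>n. ((norm (?g x))\<^sup>2 + e n) powr (c / 2)) \<longlonglongrightarrow> norm (?g x) powr c" if "?g x \<noteq> 0" for c
      using that unfolding pw[OF that, symmetric] by (intro tendsto_powr[OF nl tendsto_const]) simp
    show "(\<lambda>n. R n x * (?g x \<bullet> y)) \<longlonglongrightarrow> p_power p (?g x) \<bullet> y"
    proof (cases "?g x = 0")
      case False
      from tendsto_mult[OF pl[OF False, of "p - 2"] tendsto_const, of "?g x \<bullet> y"] show ?thesis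
        by (simp add: R_def regularised_def p_power_def)
    qed simp
    show "(\<lambda>n. d n x b) \<longlonglongrightarrow> p_power_deriv p (?g x) (B b) \<bullet> b"
    proof (cases "p = 2")
      case True
      have "d n x b = B b \<bullet> b" for n
        using posn[of x n] True by (simp add: d_def R_def regularised_def)
      then show ?thesis using True by (simp add: p_power_deriv_def)
    next
      case False
      then have p2: "2 < p" using p by simp
      show ?thesis
      proof (cases "?g x = 0")
        case True
        have "(\<lambda>n. e n powr ((p - 2) / 2)) \<longlonglongrightarrow> 0"
          using p2 e by (intro tendsto_zero_powrI[OF elim tendsto_const]) (auto intro!: always_eventually less_imp_le)
        from tendsto_mult_left_zero[OF this, of "B b \<bullet> b"] have "(\<lambda>n. d n x b) \<longlonglongrightarrow> 0"
          using True by (simp add: d_def R_def regularised_def)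
        then show ?thesis using True False by (simp add: p_power_deriv_def)
      next
        case nz: False
        have "(\<lambda>n. d n x b) \<longlonglongrightarrow> norm (?g x) powr (p - 2) * (B b \<bullet> b)
            + ((p - 2) * norm (?g x) powr (p - 4) * (?g x \<bullet> B b)) * (?g x \<bullet> b)"
          unfolding d_def R_def regularised_def by (intro tendsto_intros pl nz)
        then show ?thesis using False by (simp add: p_power_deriv_def inner_add_left)
      qed
    qed
  qed
  have db: "\<bar>d n x b\<bar> \<le> H * KB + (p - 2) * H * KB" if x: "x \<in> ball x0 r" and b: "b \<in> Basis" for n x b
  proof -
    have xc: "x \<in> cball x0 r" using x by simp
    have Bb: "norm (B b) \<le> KB" using KB(2)[of b] b by simp
    have "\<bar>B b \<bullet> b\<bar> \<le> norm (B b) * norm b" by (rule Cauchy_Schwarz_ineq2)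
    then have 1: "\<bar>R n x * (B b \<bullet> b)\<bar> \<le> H * KB"
      unfolding abs_mult using Rb[OF xc, of n] Bb b by (intro mult_mono) auto
    let ?m = "(norm (?g x))\<^sup>2 + e n"
    \<comment> \<open>Since |g|^2 <= m, the product is at most m^((p-2)/2), the regularised
      coefficient, which is bounded uniformly in n whatever the sign of p - 4.\<close>
    have "?m powr ((p - 4) / 2) * (norm (?g x))\<^sup>2 \<le> ?m powr ((p - 4) / 2) * ?m powr 1"
      using posn[of x n] e[of n] by (intro mult_left_mono) auto
    also have "\<dots> = R n x" unfolding powr_add[symmetric] by (simp add: R_def regularised_def field_simps)
    also have "\<dots> \<le> H" by (rule Rb[OF xc])
    finally have m: "?m powr ((p - 4) / 2) * (norm (?g x))\<^sup>2 \<le> H" .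
    have "\<bar>?g x \<bullet> B b\<bar> * \<bar>?g x \<bullet> b\<bar> \<le> (norm (?g x) * norm (B b)) * (norm (?g x) * norm b)"
      by (intro mult_mono Cauchy_Schwarz_ineq2) auto
    also have "\<dots> \<le> (norm (?g x))\<^sup>2 * KB"
      using mult_left_mono[OF Bb, of "(norm (?g x))\<^sup>2"] b by (simp add: power2_eq_square mult_ac)
    finally have "?m powr ((p - 4) / 2) * (\<bar>?g x \<bullet> B b\<bar> * \<bar>?g x \<bullet> b\<bar>) \<le> ?m powr ((p - 4) / 2) * ((norm (?g x))\<^sup>2 * KB)"
      by (intro mult_left_mono) auto
    also have "\<dots> \<le> H * KB" using mult_right_mono[OF m, of KB] KB(1) by (simp add: mult.assoc)
    finally have "(p - 2) * (?m powr ((p - 4) / 2) * (\<bar>?g x \<bullet> B b\<bar> * \<bar>?g x \<bullet> b\<bar>)) \<le> (p - 2) * (H * KB)"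
      using p by (intro mult_left_mono) auto
    then have 2: "\<bar>((p - 2) * ?m powr ((p - 4) / 2) * (?g x \<bullet> B b)) * (?g x \<bullet> b)\<bar> \<le> (p - 2) * H * KB"
      using p by (simp add: abs_mult mult_ac)
    show ?thesis unfolding d_def using 1 2 by linarith
  qed
  define S where "S = real (DIM('a)) * (H * KB + (p - 2) * H * KB)"
  have dsb: "\<bar>\<Sum>b\<in>Basis. d n x b\<bar> \<le> S" if "x \<in> ball x0 r" for n x
  proof -
    have "\<bar>\<Sum>b\<in>Basis. d n x b\<bar> \<le> (\<Sum>b\<in>(Basis::'a set). H * KB + (p - 2) * H * KB)"
      using db[OF that] by (intro order_trans[OF sum_abs] sum_mono) auto
    then show ?thesis by (simp add: S_def)
  qed
  have wS: "integrable lborel (\<lambda>x. S * \<bar>v x\<bar>)" using iv by simp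
  have bS: "AE x in lborel. norm (v x * (\<Sum>b\<in>Basis. d n x b)) \<le> S * \<bar>v x\<bar>" for n
  proof (intro always_eventually allI)
    fix x
    show "norm (v x * (\<Sum>b\<in>Basis. d n x b)) \<le> S * \<bar>v x\<bar>"
      using dsb[of x n] by (cases "x \<in> ball x0 r") (auto simp: abs_mult mult.commute[of S] mult_left_mono out)
  qed
  have lS: "AE x in lborel. (\<lambda>n. v x * (\<Sum>b\<in>Basis. d n x b)) \<longlonglongrightarrow> v x * local_op p \<xi> x0 x"
    unfolding local_op_def by (intro always_eventually allI tendsto_intros dlim)
  have m1: "(\<lambda>x. v x * local_op p \<xi> x0 x) \<in> borel_measurable lborel" by measurable
  have m2: "(\<lambda>x. v x * (\<Sum>b\<in>Basis. d n x b)) \<in> borel_measurable lborel" for n unfolding d_def by measurable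
  have lim1: "(\<lambda>n. LINT x|lborel. v x * (\<Sum>b\<in>Basis. d n x b)) \<longlonglongrightarrow> (LINT x|lborel. v x * local_op p \<xi> x0 x)"
    by (rule integral_dominated_convergence[OF m1 m2 wS lS bS])
  show "integrable lborel (\<lambda>x. v x * local_op p \<xi> x0 x)"
    by (rule integrable_dominated_convergence[OF m1 m2 wS lS bS])
  have wD: "integrable lborel (\<lambda>x. (H * G) * (indicator (cball x0 r) x * norm (Dv x)))"
    using loc_intD(2)[OF Dv compact_cball, of x0 r] by simp
  have bD: "AE x in lborel. norm (indicator (ball x0 r) x * (R n x * (?g x \<bullet> Dv x))) \<le> (H * G) * (indicator (cball x0 r) x * norm (Dv x))" for n
  proof (intro always_eventually allI)
    fix x
    show "norm (indicator (ball x0 r) x * (R n x * (?g x \<bullet> Dv x))) \<le> (H * G) * (indicator (cball x0 r) x * norm (Dv x))"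
    proof (cases "x \<in> ball x0 r")
      case True
      then have xc: "x \<in> cball x0 r" by simp
      have "\<bar>?g x \<bullet> Dv x\<bar> \<le> norm (?g x) * norm (Dv x)" by (rule Cauchy_Schwarz_ineq2)
      also have "\<dots> \<le> G * norm (Dv x)" by (intro mult_right_mono G xc) auto
      finally have "R n x * \<bar>?g x \<bullet> Dv x\<bar> \<le> H * (G * norm (Dv x))"
        using Rb[OF xc, of n] by (intro mult_mono) auto
      then show ?thesis using True Rb(1)[OF xc, of n] by (simp add: abs_mult mult.assoc)
    next
      case False
      have "0 \<le> H" by (simp add: H_def)
      then show ?thesis using False G(1) by simp
    qed
  qed
  have lD: "AE x in lborel. (\<lambda>n. indicator (ball x0 r) x * (R n x * (?g x \<bullet> Dv x)))
      \<longlonglongrightarrow> indicator (ball x0 r) x * (p_power p (?g x) \<bullet> Dv x)"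
    by (intro always_eventually allI tendsto_mult tendsto_const Rlim)
  have m3: "(\<lambda>x. indicator (ball x0 r) x * (p_power p (?g x) \<bullet> Dv x)) \<in> borel_measurable lborel" by measurable
  have m4: "(\<lambda>x. indicator (ball x0 r) x * (R n x * (?g x \<bullet> Dv x))) \<in> borel_measurable lborel" for n by measurable
  have lim2: "(\<lambda>n. LINT x|lborel. indicator (ball x0 r) x * (R n x * (?g x \<bullet> Dv x)))
      \<longlonglongrightarrow> (LINT x|lborel. indicator (ball x0 r) x * (p_power p (?g x) \<bullet> Dv x))"
    by (rule integral_dominated_convergence[OF m3 m4 wD lD bD])
  show "integrable lborel (\<lambda>x. indicator (ball x0 r) x * (p_power p (?g x) \<bullet> Dv x))"
    by (rule integrable_dominated_convergence[OF m3 m4 wD lD bD])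
  have "(\<lambda>n. - (LINT x|lborel. v x * (\<Sum>b\<in>Basis. d n x b))) \<longlonglongrightarrow> - (LINT x|lborel. v x * local_op p \<xi> x0 x)"
    by (intro tendsto_minus lim1)
  then have "(\<lambda>n. LINT x|lborel. indicator (ball x0 r) x * (R n x * (?g x \<bullet> Dv x)))
      \<longlonglongrightarrow> - (LINT x|lborel. v x * local_op p \<xi> x0 x)" by (simp add: ident)
  from LIMSEQ_unique[OF lim2 this]
  show "(LINT x|lborel. indicator (ball x0 r) x * (p_power p (?g x) \<bullet> Dv x)) = - (LINT x|lborel. v x * local_op p \<xi> x0 x)" .
qed

end

lemma Lp_loc_continuous:
  fixes f :: "'a::euclidean_space \<Rightarrow> 'b::euclidean_space"
  assumes "continuous_on UNIV f'" "\<And>x. x \<in> U \<Longrightarrow> f x = f' x" "0 \<le> q"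
  shows "Lp_loc q U f"
  unfolding Lp_loc_def Lp_on_def
proof (intro allI impI conjI)
  fix C assume C: "compact C \<and> C \<subseteq> U"
  have [measurable]: "C \<in> sets borel" using C by (auto intro: borel_compact)
  have [measurable]: "f' \<in> borel_measurable borel" by (rule borel_measurable_continuous_onI[OF assms(1)])
  have e: "indicator C x *\<^sub>R f x = indicator C x *\<^sub>R f' x" for x using C assms(2) by (auto simp: indicator_def)
  have "(\<lambda>x. indicator C x *\<^sub>R f' x) \<in> borel_measurable lebesgue"
    by (intro measurable_completion) measurable
  then show "set_borel_measurable lebesgue C f" unfolding set_borel_measurable_def e .
  have e2: "indicator C x *\<^sub>R norm (f x) powr q = norm (f' x) powr q * indicator C x" for x
    using C assms(2) by (auto simp: indicator_def)
  obtain M where M: "0 \<le> M" "\<And>x. x \<in> C \<Longrightarrow> \<bar>norm (f' x)\<bar> \<le> M"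
    using bounded_on_compact[OF continuous_on_norm[OF continuous_on_subset[OF assms(1)]]] C by (metis subset_UNIV)
  have "integrable lborel (\<lambda>x. 1 * (norm (f' x) powr q * indicator C x))"
    by (rule integrable_loc_mult[OF loc_int_const, of C _ "M powr q"])
      (use C M assms(3) in \<open>auto intro!: powr_mono2 simp: indicator_def\<close>)
  then have "integrable lborel (\<lambda>x. norm (f' x) powr q * indicator C x)" by simp
  then have "integrable lebesgue (\<lambda>x. norm (f' x) powr q * indicator C x)"
    by (subst integrable_completion) auto
  then show "set_integrable lebesgue C (\<lambda>x. norm (f x) powr q)"
    unfolding set_integrable_def e2 .
qed

text \<open>Integration by parts: the polynomial times a test function is again a test function, so
  its derivative integrates to zero, and the product rule splits this integral into the two
  sides.\<close>

lemma (in symmetric_map) W1p_loc_grad_quad: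
  assumes W: "\<And>x. x \<in> U \<Longrightarrow> W x = quad a \<xi> B x0 x" and "0 \<le> p"
  shows "W1p_loc_grad p U W (quad_grad \<xi> B x0)"
proof -
  let ?q = "quad a \<xi> B x0" and ?g = "quad_grad \<xi> B x0"
  have "(LINT x:U|lebesgue. W x * frechet_derivative \<phi> (at x) b) = - (LINT x:U|lebesgue. (?g x \<bullet> b) * \<phi> x)"
    if \<phi>: "\<phi> \<in> test_functions U" and b: "b \<in> Basis" for \<phi> b
  proof -
    note T = test_functionsD[OF \<phi>]
    have \<phi>U: "\<phi> \<in> test_functions UNIV" using \<phi> by (auto simp: test_functions_def)
    have z: "\<phi> x = 0" "frechet_derivative \<phi> (at x) b = 0" if "x \<notin> U" for x
    proof -
      have "x \<notin> closure {x. \<phi> x \<noteq> 0}" using that T(3) by blast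
      then show "\<phi> x = 0" "frechet_derivative \<phi> (at x) b = 0" using T(4,5) by blast+
    qed
    have lq: "loc_int ?q" and lg: "loc_int (\<lambda>x. ?g x \<bullet> b)"
    proof -
      have "loc_int f" if f: "continuous_on UNIV f" for f :: "'a \<Rightarrow> real"
        unfolding loc_int_def
      proof (intro conjI allI impI)
        show "f \<in> borel_measurable borel" by (rule borel_measurable_continuous_onI[OF f])
        fix C :: "'a set" assume C: "compact C"
        have "set_integrable lebesgue C (\<lambda>x. norm (f x) powr 1)"
          using Lp_loc_continuous[OF f, of UNIV f 1] C by (auto simp: Lp_loc_def Lp_on_def)
        then show "integrable lborel (\<lambda>x. indicator C x * norm (f x))"
          using \<open>f \<in> borel_measurable borel\<close> borel_compact[OF C] unfolding set_integrable_def
          by (subst (asm) integrable_completion) auto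
      qed
      then show "loc_int ?q" "loc_int (\<lambda>x. ?g x \<bullet> b)"
        using quad_continuous smooth_on_continuous[OF quad_grad_smooth] by blast+
    qed
    have mq: "(\<lambda>x. ?q x * frechet_derivative \<phi> (at x) b) \<in> borel_measurable borel"
      and mg: "(\<lambda>x. (?g x \<bullet> b) * \<phi> x) \<in> borel_measurable borel"
      using integrable_loc_test(2)[OF lq \<phi>U, of b] integrable_loc_test(1)[OF lg \<phi>U] by (auto dest: borel_measurable_integrable)
    define \<psi> where "\<psi> x = ?q x * \<phi> x" for x
    have \<psi>: "\<psi> \<in> test_functions UNIV"
    proof (rule test_functionsI[OF _ T(2)])
      show "smooth_on \<psi> UNIV" unfolding \<psi>_def[abs_def] by (intro smooth_on_mult quad_smooth T(1) open_UNIV)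
      show "\<psi> x = 0" if "x \<notin> closure {x. \<phi> x \<noteq> 0}" for x
        unfolding \<psi>_def T(4)[OF that] by simp
    qed simp
    have hd: "(\<psi> has_derivative (\<lambda>h. ?q x * frechet_derivative \<phi> (at x) h + (?g x \<bullet> h) * \<phi> x)) (at x)" for x
      unfolding \<psi>_def[abs_def] by (rule has_derivative_mult[OF quad_has_derivative smooth_onD[OF T(1)]]) simp
    then have fd: "frechet_derivative \<psi> (at x) b = ?q x * frechet_derivative \<phi> (at x) b + (?g x \<bullet> b) * \<phi> x" for x
      using fun_cong[OF frechet_derivative_at[OF hd[of x]], of b] by simp
    have "0 = (LINT x|lborel. ?q x * frechet_derivative \<phi> (at x) b + (?g x \<bullet> b) * \<phi> x)"
      using integral_derivative_test_function[OF \<psi>, of b] by (simp add: fd)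
    also have "\<dots> = (LINT x|lborel. ?q x * frechet_derivative \<phi> (at x) b) + (LINT x|lborel. (?g x \<bullet> b) * \<phi> x)"
      by (rule Bochner_Integration.integral_add[OF integrable_loc_test(2)[OF lq \<phi>U] integrable_loc_test(1)[OF lg \<phi>U]])
    also have "(LINT x|lborel. ?q x * frechet_derivative \<phi> (at x) b) = (LINT x:U|lebesgue. W x * frechet_derivative \<phi> (at x) b)"
      unfolding set_lebesgue_integral_def
      by (rule integral_lebesgue_lborel[OF mq, symmetric], rule always_eventually) (use z W in \<open>auto simp: indicator_def\<close>)
    also have "(LINT x|lborel. (?g x \<bullet> b) * \<phi> x) = (LINT x:U|lebesgue. (?g x \<bullet> b) * \<phi> x)"
      unfolding set_lebesgue_integral_def
      by (rule integral_lebesgue_lborel[OF mg, symmetric], rule always_eventually) (use z in \<open>auto simp: indicator_def\<close>)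
    finally show ?thesis by simp
  qed
  moreover have "Lp_loc q U W" if "0 \<le> q" for q using quad_continuous W that by (rule Lp_loc_continuous)
  moreover have "Lp_loc q U ?g" if "0 \<le> q" for q using quad_grad_continuous _ that by (rule Lp_loc_continuous) simp
  ultimately show ?thesis using \<open>0 \<le> p\<close> by (simp add: W1p_loc_grad_def has_weak_gradient_def)
qed

subsection \<open>Restriction of weak supersolutions to balls\<close>

lemma set_integral_restrict:
  fixes F :: "'a::euclidean_space \<Rightarrow> real"
  assumes F: "set_integrable lebesgue \<Omega> F" and U: "U \<in> sets lebesgue" "U \<subseteq> \<Omega>" and z: "AE x in lebesgue. x \<notin> U \<longrightarrow> F x = 0"
  shows "set_integrable lebesgue U F" "(LINT x:U|lebesgue. F x) = (LINT x:\<Omega>|lebesgue. F x)"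
proof -
  have e: "indicator U x *\<^sub>R (indicator \<Omega> x *\<^sub>R F x) = indicator U x *\<^sub>R F x" for x
    using U(2) by (auto simp: indicator_def)
  have "integrable lebesgue (\<lambda>x. indicator U x *\<^sub>R (indicator \<Omega> x *\<^sub>R F x))"
    using F U(1) unfolding set_integrable_def by (simp only: integrable_mult_indicator)
  then show i: "set_integrable lebesgue U F" unfolding e set_integrable_def .
  show "(LINT x:U|lebesgue. F x) = (LINT x:\<Omega>|lebesgue. F x)"
    unfolding set_lebesgue_integral_def
  proof (rule integral_cong_AE)
    show "AE x in lebesgue. indicator U x *\<^sub>R F x = indicator \<Omega> x *\<^sub>R F x"
      using z by eventually_elim (use U(2) in \<open>auto simp: indicator_def\<close>)
  qed (use i F in \<open>auto simp: set_integrable_def\<close>)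
qed

text \<open>Enlarging the domain of a test function leaves the local integrals unchanged only if its
  weak gradient, and not just v itself, vanishes almost everywhere outside the ball.\<close>

lemma W1p_grad_zero_off_ball:
  assumes "W1p_grad p v Dv" "v \<in> X0 p (ball x0 r)" "0 < r"
  shows "AE x in lebesgue. x \<notin> ball x0 r \<longrightarrow> v x = 0" "AE x in lebesgue. x \<notin> ball x0 r \<longrightarrow> Dv x = 0"
proof -
  show v0: "AE x in lebesgue. x \<notin> ball x0 r \<longrightarrow> v x = 0" using assms(2) by (simp add: X0_def)
  obtain v' Dv' where b: "borel_weak_gradient v' Dv'" "AE x in lborel. Dv x = Dv' x" "\<And>x. x \<notin> ball x0 r \<Longrightarrow> v' x = 0"
    by (rule W1p_grad_borel[OF assms(1) v0]) auto
  have "AE x in lborel. x \<notin> ball x0 r \<longrightarrow> Dv' x = 0"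
    by (rule weak_gradient_vanishes[OF b(1) b(3) assms(3)])
  with b(2) have "AE x in lborel. x \<notin> ball x0 r \<longrightarrow> Dv x = 0"
    by eventually_elim auto
  then show "AE x in lebesgue. x \<notin> ball x0 r \<longrightarrow> Dv x = 0" by (rule AE_completion)
qed

lemma Lp_loc_mono: "Lp_loc q \<Omega> g \<Longrightarrow> U \<subseteq> \<Omega> \<Longrightarrow> Lp_loc q U g"
  unfolding Lp_loc_def by blast

lemma has_weak_gradient_mono:
  assumes "has_weak_gradient \<Omega> u Du" "U \<subseteq> \<Omega>"
  shows "has_weak_gradient U u Du"
proof -
  have e: "(LINT x:U|lebesgue. u x * frechet_derivative \<phi> (at x) b) = (LINT x:\<Omega>|lebesgue. u x * frechet_derivative \<phi> (at x) b)"
    "(LINT x:U|lebesgue. (Du x \<bullet> b) * \<phi> x) = (LINT x:\<Omega>|lebesgue. (Du x \<bullet> b) * \<phi> x)"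
    if \<phi>: "\<phi> \<in> test_functions U" for \<phi> b
  proof -
    note T = test_functionsD[OF \<phi>]
    have z: "\<phi> x = 0" "frechet_derivative \<phi> (at x) b = 0" if "x \<notin> U" for x
    proof -
      have "x \<notin> closure {x. \<phi> x \<noteq> 0}" using that T(3) by blast
      then show "\<phi> x = 0" "frechet_derivative \<phi> (at x) b = 0" using T(4,5) by blast+
    qed
    show "(LINT x:U|lebesgue. u x * frechet_derivative \<phi> (at x) b) = (LINT x:\<Omega>|lebesgue. u x * frechet_derivative \<phi> (at x) b)"
      "(LINT x:U|lebesgue. (Du x \<bullet> b) * \<phi> x) = (LINT x:\<Omega>|lebesgue. (Du x \<bullet> b) * \<phi> x)"
      unfolding set_lebesgue_integral_def
      by (rule Bochner_Integration.integral_cong, simp, use z assms(2) in \<open>auto simp: indicator_def\<close>)+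
  qed
  have t: "\<phi> \<in> test_functions \<Omega>" if "\<phi> \<in> test_functions U" for \<phi>
    using that assms(2) by (auto simp: test_functions_def)
  show ?thesis unfolding has_weak_gradient_def
  proof (intro conjI ballI)
    show "Lp_loc 1 U u" "Lp_loc 1 U Du" using assms Lp_loc_mono by (auto simp: has_weak_gradient_def)
    fix \<phi> b assume "\<phi> \<in> test_functions U" "b \<in> (Basis::'a set)"
    then show "(LINT x:U|lebesgue. u x * frechet_derivative \<phi> (at x) b) = - (LINT x:U|lebesgue. (Du x \<bullet> b) * \<phi> x)"
      unfolding e[OF \<open>\<phi> \<in> test_functions U\<close>] using assms(1) t unfolding has_weak_gradient_def by blast
  qed
qed

text \<open>A test function of the ball is one of \<open>\<Omega>\<close>, and the local integrals
  over both sets agree because v and Dv vanish off the ball. The nonlocal term is taken over the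
  whole space in both cases.\<close>

lemma weak_supersolution_ball:
  assumes "weak_supersolution s p K f \<Omega> u" "ball x0 r \<subseteq> \<Omega>" "0 < r"
  shows "weak_supersolution s p K f (ball x0 r) u"
proof -
  let ?U = "ball x0 r"
  obtain Du where Du: "W1p_loc_grad p \<Omega> u Du"
    and weak: "\<And>v Dv. v \<in> X0 p \<Omega> \<Longrightarrow> W1p_grad p v Dv \<Longrightarrow> AE x in lebesgue. 0 \<le> v x \<Longrightarrow>
           weak_form_meaningful s p K f \<Omega> u Du v Dv \<and> weak_lhs p K \<Omega> u Du v Dv \<ge> weak_rhs s p f \<Omega> u Du v"
    using assms(1) unfolding weak_supersolution_def by blast
  have U: "?U \<in> sets lebesgue" by simp
  have "weak_form_meaningful s p K f ?U u Du v Dv \<and> weak_lhs p K ?U u Du v Dv \<ge> weak_rhs s p f ?U u Du v"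
    if v: "v \<in> X0 p ?U" "W1p_grad p v Dv" "AE x in lebesgue. 0 \<le> v x" for v Dv
  proof -
    note z = W1p_grad_zero_off_ball[OF v(2,1) assms(3)]
    have "AE x in lebesgue. x \<notin> \<Omega> \<longrightarrow> v x = 0" using z(1) by eventually_elim (use assms(2) in auto)
    then have "v \<in> X0 p \<Omega>" using v(1) by (simp add: X0_def)
    from weak[OF this v(2,3)] have m: "weak_form_meaningful s p K f \<Omega> u Du v Dv"
      and le: "weak_lhs p K \<Omega> u Du v Dv \<ge> weak_rhs s p f \<Omega> u Du v" by auto
    have l: "AE x in lebesgue. x \<notin> ?U \<longrightarrow> local_integrand p Du Dv x = 0"
      using z(2) by eventually_elim (simp add: local_integrand_def)
    have rh: "AE x in lebesgue. x \<notin> ?U \<longrightarrow> rhs_integrand s p f u Du v x = 0"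
      using z(1) by eventually_elim (simp add: rhs_integrand_def)
    note L = set_integral_restrict[OF _ U assms(2) l] and R = set_integral_restrict[OF _ U assms(2) rh]
    show ?thesis using m le L R by (simp add: weak_form_meaningful_def weak_lhs_def weak_rhs_def)
  qed
  moreover have "AE x in lebesgue. x \<in> ?U \<longrightarrow> rhs_meaningful s p f ?U u x"
  proof -
    have "AE x in lebesgue. x \<in> \<Omega> \<longrightarrow> rhs_meaningful s p f \<Omega> u x" using assms(1) by (simp add: weak_supersolution_def)
    then show ?thesis
    proof eventually_elim
      case (elim x)
      then show ?case using assms(2) unfolding rhs_meaningful_def by blast
    qed
  qed
  moreover have "W1p_loc_grad p ?U u Du"
    using Du unfolding W1p_loc_grad_def
    by (simp add: Lp_loc_mono[OF _ assms(2)] has_weak_gradient_mono[OF _ assms(2)])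
  ultimately show ?thesis using assms(1) unfolding weak_supersolution_def by blast
qed

subsection \<open>A pointwise subsolution is a weak subsolution\<close>

text \<open>With KB a bound for B, the gradient on the ball is at most |\<open>\<xi>\<close>| + KB
  \<open>\<delta>\<close>, and the quadratic term adds KB \<open>\<delta>\<close> |x - y| since |x -
  y| <= 2 \<open>\<delta>\<close>. The second difference is exactly -(B z . z), everywhere.\<close>

lemma (in symmetric_map) quad_differences:
  assumes "0 < \<delta>"
  obtains C where "0 \<le> C"
    "\<And>x y. x \<in> ball x0 \<delta> \<Longrightarrow> y \<in> ball x0 \<delta> \<Longrightarrow> \<bar>quad a \<xi> B x0 x - quad a \<xi> B x0 y\<bar> \<le> C * norm (x - y)"
    "\<And>x z. \<bar>2 * quad a \<xi> B x0 x - quad a \<xi> B x0 (x + z) - quad a \<xi> B x0 (x - z)\<bar> \<le> C * (norm z)\<^sup>2"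
proof -
  let ?q = "quad a \<xi> B x0" and ?g = "quad_grad \<xi> B x0"
  obtain KB where KB: "0 < KB" "\<And>z. norm (B z) \<le> norm z * KB" using bounded_linear.pos_bounded[OF blin] by blast
  have BB: "\<bar>B z \<bullet> z\<bar> \<le> KB * (norm z)\<^sup>2" for z
  proof -
    have "\<bar>B z \<bullet> z\<bar> \<le> norm (B z) * norm z" by (rule Cauchy_Schwarz_ineq2)
    also have "\<dots> \<le> (norm z * KB) * norm z" by (intro mult_right_mono KB) auto
    finally show ?thesis by (simp add: power2_eq_square mult_ac)
  qed
  define C where "C = norm \<xi> + 2 * KB * \<delta> + KB"
  have lip: "\<bar>?q x - ?q y\<bar> \<le> C * norm (x - y)" if x: "x \<in> ball x0 \<delta>" and y: "y \<in> ball x0 \<delta>" for x y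
  proof -
    have nx: "norm (x - x0) \<le> \<delta>" "norm (y - x0) \<le> \<delta>" using x y by (auto simp: dist_norm norm_minus_commute)
    have nz: "norm (y - x) \<le> 2 * \<delta>" using norm_triangle_ineq4[of "y - x0" "x - x0"] nx by simp
    have "norm (?g x) \<le> norm \<xi> + KB * \<delta>"
    proof -
      have "norm (B (x - x0)) \<le> KB * \<delta>"
        using order_trans[OF KB(2)[of "x - x0"] mult_right_mono[OF nx(1) less_imp_le[OF KB(1)]]]
        by (simp add: mult.commute)
      then show ?thesis unfolding quad_grad_def using norm_triangle_ineq[of \<xi> "B (x - x0)"] by linarith
    qed
    then have 1: "\<bar>?g x \<bullet> (y - x)\<bar> \<le> (norm \<xi> + KB * \<delta>) * norm (y - x)"
      by (intro order_trans[OF Cauchy_Schwarz_ineq2] mult_right_mono) auto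
    have "KB * (norm (y - x))\<^sup>2 \<le> KB * ((2 * \<delta>) * norm (y - x))"
      unfolding power2_eq_square using KB(1) nz by (intro mult_left_mono mult_right_mono) auto
    then have 2: "\<bar>B (y - x) \<bullet> (y - x)\<bar> \<le> 2 * (KB * \<delta> * norm (y - x))" using BB[of "y - x"] by (simp add: mult_ac)
    have "?q y = ?q x + ?g x \<bullet> (y - x) + (B (y - x) \<bullet> (y - x)) / 2" using quad_add[of a \<xi> x0 x "y - x"] by simp
    then have "\<bar>?q x - ?q y\<bar> \<le> (norm \<xi> + KB * \<delta>) * norm (y - x) + KB * \<delta> * norm (y - x)" using 1 2 by linarith
    also have "\<dots> \<le> C * norm (x - y)"
      using KB(1) by (simp add: C_def norm_minus_commute[of y x] algebra_simps)
    finally show ?thesis .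
  qed
  have sec: "\<bar>2 * ?q x - ?q (x + z) - ?q (x - z)\<bar> \<le> C * (norm z)\<^sup>2" for x z
  proof -
    have "2 * ?q x - ?q (x + z) - ?q (x - z) = - (B z \<bullet> z)"
      using quad_add[of a \<xi> x0 x z] quad_add[of a \<xi> x0 x "- z"] by (simp add: B_neg)
    moreover have "KB * (norm z)\<^sup>2 \<le> C * (norm z)\<^sup>2"
      using KB(1) assms by (intro mult_right_mono) (auto simp: C_def)
    ultimately show ?thesis using BB[of z] by simp
  qed
  have "0 \<le> C" using KB(1) assms by (simp add: C_def)
  then show ?thesis using that lip sec by blast
qed

text \<open>Local integrability is read off from the weighted one, because the weight is bounded
  below on compact sets.\<close>

lemma (in singular_kernel) tail_bound_tail_space:
  assumes g: "tail_bound (p - 1) g" and w[measurable]: "w \<in> borel_measurable borel" and le: "\<And>y. \<bar>w y\<bar> \<le> g y"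
  shows "w \<in> tail_space s p"
proof -
  have p1: "0 \<le> p - 1" using p by simp
  have ge: "integrable lborel (\<lambda>y. g y powr (p - 1) * weight y)" using g by (simp add: tail_bound_def)
  have wle: "\<bar>w y\<bar> powr (p - 1) \<le> g y powr (p - 1)" for y using le p1 by (intro powr_mono2) auto
  have wi: "integrable lborel (\<lambda>y. \<bar>w y\<bar> powr (p - 1) * weight y)"
    by (rule Bochner_Integration.integrable_bound[OF ge])
      (auto intro!: always_eventually mult_right_mono wle simp: abs_mult abs_of_pos[OF weight_pos] less_imp_le[OF weight_pos])
  have e: "\<bar>w y\<bar> powr (p - 1) / (1 + norm y) powr (real DIM('a) + s * p) = \<bar>w y\<bar> powr (p - 1) * weight y" for y
    unfolding weight_def powr_minus divide_inverse by simp
  have "integrable lebesgue (\<lambda>y. \<bar>w y\<bar> powr (p - 1) / (1 + norm y) powr (real DIM('a) + s * p))"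
    unfolding e using wi by (subst integrable_completion) auto
  moreover have "Lp_loc (p - 1) UNIV w"
    unfolding Lp_loc_def Lp_on_def
  proof (intro allI impI conjI)
    fix C :: "'a set" assume C: "compact C \<and> C \<subseteq> UNIV"
    have [measurable]: "C \<in> sets borel" using C by (auto intro: borel_compact)
    show "set_borel_measurable lebesgue C w" unfolding set_borel_measurable_def
      by (intro measurable_completion) measurable
    obtain R where R: "\<And>y. y \<in> C \<Longrightarrow> norm y \<le> R" using compact_imp_bounded C by (metis bounded_iff)
    define c where "c = (1 + R) powr (- (real DIM('a) + s * p))"
    have wc: "c \<le> weight y" "0 < c" if "y \<in> C" for y
    proof -
      have ny: "0 < 1 + norm y" by (simp add: add_pos_nonneg)
      show "c \<le> weight y" unfolding c_def weight_def
      proof (rule powr_mono2')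
        have "0 \<le> real DIM('a) + s * p" using s p by simp
        then show "- (real DIM('a) + s * p) \<le> 0" by simp
      qed (use R[OF that] ny in auto)
      have "0 < 1 + R" using R[OF that] ny by linarith
      then show "0 < c" by (simp add: c_def)
    qed
    have "integrable lborel (\<lambda>y. indicator C y * \<bar>w y\<bar> powr (p - 1))"
    proof (rule Bochner_Integration.integrable_bound[OF integrable_mult_right[OF wi, of "inverse c"]])
      show "AE y in lborel. norm (indicator C y * \<bar>w y\<bar> powr (p - 1)) \<le> norm (inverse c * (\<bar>w y\<bar> powr (p - 1) * weight y))"
      proof (intro always_eventually allI)
        fix y
        show "norm (indicator C y * \<bar>w y\<bar> powr (p - 1)) \<le> norm (inverse c * (\<bar>w y\<bar> powr (p - 1) * weight y))"
        proof (cases "y \<in> C")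
          case True
          have "\<bar>w y\<bar> powr (p - 1) * c \<le> \<bar>w y\<bar> powr (p - 1) * weight y"
            using wc[OF True] by (intro mult_left_mono) auto
          then show ?thesis using True wc[OF True] by (simp add: abs_mult abs_of_pos[OF weight_pos] field_simps)
        qed simp
      qed
    qed measurable
    then show "set_integrable lebesgue C (\<lambda>x. norm (w x) powr (p - 1))"
      unfolding set_integrable_def by (subst integrable_completion) auto
  qed
  ultimately show ?thesis by (simp add: tail_space_def)
qed

locale singular_kernel_quad = singular_kernel s p k \<Lambda> + symmetric_map B
  for s p :: real and k :: "'a::euclidean_space \<Rightarrow> real" and \<Lambda> and B :: "'a \<Rightarrow> 'a"
begin

text \<open>The pointwise inequality is multiplied by v >= 0 and integrated; the two weak-form
  lemmas rewrite the result. The polynomial form of w is asked for on a ball of at least twice the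
  radius, so that near the support of v all differences with small z are smooth; beyond it w is any
  tail-bounded Borel function.\<close>

lemma weak_subsolution_ball:
  fixes K :: "'a \<Rightarrow> 'a \<Rightarrow> real"
  assumes K: "\<And>x y. K x y = k (y - x)"
    and w[measurable]: "w \<in> borel_measurable borel" and g: "tail_bound (p - 1) g" and le: "\<And>y. \<bar>w y\<bar> \<le> g y"
    and r: "0 < r" "2 * r \<le> \<delta>" and wq: "\<And>x. x \<in> ball x0 \<delta> \<Longrightarrow> w x = quad a \<xi> B x0 x"
    and sub: "\<And>x. x \<in> ball x0 r \<Longrightarrow> - local_op p \<xi> x0 x + nonlocal_op w x \<le> f x (w x) (quad_grad \<xi> B x0 x) (Dsp s p w x)"
    and mF: "(\<lambda>x. indicator (ball x0 r) x * f x (w x) (quad_grad \<xi> B x0 x) (Dsp s p w x)) \<in> borel_measurable borel"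
    and bF: "\<And>x. x \<in> ball x0 r \<Longrightarrow> \<bar>f x (w x) (quad_grad \<xi> B x0 x) (Dsp s p w x)\<bar> \<le> MF"
    and mean: "\<And>x. x \<in> ball x0 r \<Longrightarrow> rhs_meaningful s p f (ball x0 r) w x"
  shows "weak_subsolution s p K f (ball x0 r) w"
proof -
  let ?U = "ball x0 r" and ?g = "quad_grad \<xi> B x0" and ?q = "quad a \<xi> B x0"
  define F where "F x = indicator ?U x * f x (w x) (?g x) (Dsp s p w x)" for x
  have [measurable]: "F \<in> borel_measurable borel" using mF by (simp add: F_def[abs_def])
  have \<delta>: "0 < \<delta>" using r by simp
  obtain C where C: "0 \<le> C" 
    "\<And>x y. x \<in> ball x0 \<delta> \<Longrightarrow> y \<in> ball x0 \<delta> \<Longrightarrow> \<bar>?q x - ?q y\<bar> \<le> C * norm (x - y)"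
    "\<And>x z. \<bar>2 * ?q x - ?q (x + z) - ?q (x - z)\<bar> \<le> C * (norm z)\<^sup>2"
    using quad_differences[OF \<delta>, of x0 a \<xi>] by blast
  have lip: "\<bar>w x - w y\<bar> \<le> C * norm (x - y)" if "x \<in> ball x0 \<delta>" "y \<in> ball x0 \<delta>" for x y
    using C(2)[OF that] that by (simp add: wq)
  have sec: "\<bar>2 * w x - w (x + z) - w (x - z)\<bar> \<le> C * (norm z)\<^sup>2"
    if "x \<in> ball x0 \<delta>" "x + z \<in> ball x0 \<delta>" "x - z \<in> ball x0 \<delta>" for x z
    using C(3)[of x z] unfolding wq[OF that(1)] wq[OF that(2)] wq[OF that(3)] .
  have [measurable]: "?g \<in> borel_measurable borel" by (rule borel_measurable_continuous_onI[OF quad_grad_continuous])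
  have [measurable]: "local_op p \<xi> x0 \<in> borel_measurable borel" by (rule borel_measurable_continuous_onI[OF local_op_continuous[OF p]])
  have wU: "x \<in> ?U \<Longrightarrow> w x = ?q x" for x using wq r by auto
  have main: "weak_form_meaningful s p K f ?U w ?g v Dv \<and> weak_lhs p K ?U w ?g v Dv \<le> weak_rhs s p f ?U w ?g v"
    if v: "v \<in> X0 p ?U" "W1p_grad p v Dv" "AE x in lebesgue. 0 \<le> v x" for v Dv
  proof -
    obtain v' Dv' where b: "borel_weak_gradient v' Dv'" and v': "AE x in lborel. v x = v' x" and Dv': "AE x in lborel. Dv x = Dv' x"
      and out: "\<And>x. x \<notin> ?U \<Longrightarrow> v' x = 0"
      by (rule W1p_grad_borel[OF v(2), of ?U]) (use v(1) in \<open>auto simp: X0_def\<close>)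
    have lv: "loc_int v'" and lD: "loc_int Dv'" using b by (auto simp: borel_weak_gradient_def)
    have [measurable]: "v' \<in> borel_measurable borel" "Dv' \<in> borel_measurable borel" using lv lD by (auto simp: loc_int_def)
    have iv: "integrable lborel v'"
      using loc_int_zero_off[OF lv compact_cball, of x0 r] out by (auto simp: subset_iff)
    have v0: "AE x in lborel. 0 \<le> v' x"
      using v(3)[unfolded AE_completion_iff] v' by eventually_elim simp
    obtain D where D: "0 \<le> D" "\<And>z. norm z \<le> 1 \<Longrightarrow> (LINT x|lborel. \<bar>v' (z + x) - v' x\<bar>) \<le> D * norm z"
      by (rule difference_quotient_L1[OF b out less_imp_le[OF r(1)]]) auto
    define n' where "n' x y = p_power p (w x - w y) * (v' x - v' y) * k (y - x)" for x y
    have NL1: "integrable lborel (\<lambda>(x, y). n' x y)" unfolding n'_def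
      by (rule weak_nonlocal_form(1)[OF w g le r C(1) lip sec iv out D])
    have NL2: "integrable lborel (\<lambda>x. v' x * nonlocal_op w x)"
      by (rule weak_nonlocal_form(2)[OF w g le r C(1) lip sec iv out D])
    have NL3: "(LINT x|lborel. LINT y|lborel. n' x y) = (LINT x|lborel. v' x * nonlocal_op w x)" unfolding n'_def
      by (rule weak_nonlocal_form(3)[OF w g le r C(1) lip sec iv out D])
    have LC1: "integrable lborel (\<lambda>x. indicator ?U x * (p_power p (?g x) \<bullet> Dv' x))"
      by (rule weak_local_form(1)[OF p b out r(1)])
    have LC2: "(LINT x|lborel. indicator ?U x * (p_power p (?g x) \<bullet> Dv' x)) = - (LINT x|lborel. v' x * local_op p \<xi> x0 x)"
      by (rule weak_local_form(2)[OF p b out r(1)])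
    have LC3: "integrable lborel (\<lambda>x. v' x * local_op p \<xi> x0 x)"
      by (rule weak_local_form(3)[OF p b out r(1)])
    have l1: "AE x in lborel. indicator ?U x *\<^sub>R local_integrand p ?g Dv x = indicator ?U x * (p_power p (?g x) \<bullet> Dv' x)"
      using Dv' by eventually_elim (simp add: local_integrand_def)
    have lm: "(\<lambda>x. indicator ?U x * (p_power p (?g x) \<bullet> Dv' x)) \<in> borel_measurable borel" by measurable
    have A1: "set_integrable lebesgue ?U (local_integrand p ?g Dv)"
      unfolding set_integrable_def using integrable_lebesgue_lborel[OF lm l1] LC1 by simp
    have A2: "(LINT x:?U|lebesgue. local_integrand p ?g Dv x) = - (LINT x|lborel. v' x * local_op p \<xi> x0 x)"
      unfolding set_lebesgue_integral_def using integral_lebesgue_lborel[OF lm l1] LC2 by simp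
    have nm: "(\<lambda>(x, y). n' x y) \<in> borel_measurable (borel :: ('a \<times> 'a) measure)"
      using borel_measurable_integrable[OF NL1] by simp
    have "AE z in (lborel :: ('a \<times> 'a) measure). v (fst z) = v' (fst z)" "AE z in (lborel :: ('a \<times> 'a) measure). v (snd z) = v' (snd z)"
      using AE_pair_fst[OF v'] AE_pair_snd[OF v'] by auto
    then have nae: "AE z in lborel. (case z of (x, y) \<Rightarrow> nonlocal_integrand p K w v x y) = (case z of (x, y) \<Rightarrow> n' x y)"
      by eventually_elim (auto simp: nonlocal_integrand_def n'_def K split: prod.split)
    have B1: "integrable lebesgue (\<lambda>(x, y). nonlocal_integrand p K w v x y)"
      using integrable_lebesgue_lborel[OF nm nae] NL1 by simp
    have nm': "(\<lambda>(x, y). n' x y) \<in> borel_measurable (lborel \<Otimes>\<^sub>M lborel)"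
      using nm by (simp add: lborel_prod)
    then have im: "(\<lambda>x. LINT y|lborel. n' x y) \<in> borel_measurable borel"
      using lborel.borel_measurable_lebesgue_integral[of n' lborel] by simp
    have "AE x in lborel. (LINT y|lebesgue. nonlocal_integrand p K w v x y) = (LINT y|lborel. n' x y)"
      using v'
    proof eventually_elim
      case (elim x)
      show ?case
      proof (rule integral_lebesgue_lborel)
        show "n' x \<in> borel_measurable borel" unfolding n'_def by measurable
        show "AE y in lborel. nonlocal_integrand p K w v x y = n' x y"
          using v' by eventually_elim (simp add: elim nonlocal_integrand_def n'_def K)
      qed
    qed
    from integral_lebesgue_lborel[OF im this]
    have B2: "(LINT x|lebesgue. LINT y|lebesgue. nonlocal_integrand p K w v x y) = (LINT x|lborel. v' x * nonlocal_op w x)"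
      using NL3 by simp
    have Fb: "\<bar>F x\<bar> \<le> MF" if "x \<in> ?U" for x using bF[OF that] that by (simp add: F_def)
    have iF: "integrable lborel (\<lambda>x. v' x * F x)"
    proof (rule integrable_loc_mult[OF lv compact_cball[of x0 r], of _ "max MF 0"])
      show "\<bar>F x\<bar> \<le> max MF 0" for x using Fb[of x] by (cases "x \<in> ?U") (auto simp: F_def)
      show "F x = 0" if "x \<notin> cball x0 r" for x using that by (simp add: F_def)
    qed measurable
    have rae: "AE x in lborel. indicator ?U x *\<^sub>R rhs_integrand s p f w ?g v x = v' x * F x"
      using v' by eventually_elim (simp add: rhs_integrand_def F_def)
    have rm: "(\<lambda>x. v' x * F x) \<in> borel_measurable borel" by measurable
    have C1: "set_integrable lebesgue ?U (rhs_integrand s p f w ?g v)"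
      unfolding set_integrable_def using integrable_lebesgue_lborel[OF rm rae] iF by simp
    have C2: "weak_rhs s p f ?U w ?g v = (LINT x|lborel. v' x * F x)"
      unfolding weak_rhs_def set_lebesgue_integral_def by (rule integral_lebesgue_lborel[OF rm rae])
    have "weak_lhs p K ?U w ?g v Dv = (LINT x|lborel. v' x * nonlocal_op w x) - (LINT x|lborel. v' x * local_op p \<xi> x0 x)"
      unfolding weak_lhs_def A2 B2 by simp
    also have "\<dots> = (LINT x|lborel. v' x * nonlocal_op w x - v' x * local_op p \<xi> x0 x)"
      using NL2 LC3 by (rule Bochner_Integration.integral_diff[symmetric])
    also have "\<dots> \<le> (LINT x|lborel. v' x * F x)"
    proof (rule integral_mono_AE[OF Bochner_Integration.integrable_diff[OF NL2 LC3] iF])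
      show "AE x in lborel. v' x * nonlocal_op w x - v' x * local_op p \<xi> x0 x \<le> v' x * F x"
        using v0
      proof eventually_elim
        case (elim x)
        show ?case
        proof (cases "x \<in> ?U")
          case True
          from mult_left_mono[OF sub[OF True] elim] show ?thesis
            using True by (simp add: F_def algebra_simps)
        qed (simp add: out)
      qed
    qed
    finally show ?thesis using A1 B1 C1 by (simp add: weak_form_meaningful_def C2)
  qed
  have "W1p_loc_grad p ?U w ?g" using wU p by (intro W1p_loc_grad_quad) auto
  then show ?thesis
    unfolding weak_subsolution_def using main tail_bound_tail_space[OF g w le] mean
    by (auto intro!: exI[of _ ?g])
qed

end

section \<open>Null sets, measurability of D_s^p, and tail bounds\<close>

lemma AE_meets_ball:
  assumes "AE x in lborel. P (x::'a::euclidean_space)" "0 < e"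
  shows "\<exists>x\<in>ball x0 e. P x"
proof (rule ccontr)
  assume "\<not> ?thesis"
  with assms(1) have "AE x in lborel. x \<notin> ball x0 e" by (auto elim: eventually_mono)
  then have "emeasure lborel (ball x0 e) = 0"
    by (subst (asm) AE_iff_measurable[OF _ refl]) (auto simp: ball_def)
  moreover have "0 < unit_ball_vol (real DIM('a))" by simp
  ultimately show False
    using zero_less_power[OF assms(2), of "DIM('a)"]
    assms(2) by (auto simp: emeasure_ball ennreal_eq_0_iff mult_le_0_iff)
qed

lemma Dsp_borel:
  fixes w :: "'a::euclidean_space \<Rightarrow> real"
  assumes w[measurable]: "w \<in> borel_measurable borel"
  shows "Dsp s p w x = (LINT y|lborel. Dsp_integrand s p w x y)"
    and "integrable lebesgue (Dsp_integrand s p w x) \<longleftrightarrow> integrable lborel (Dsp_integrand s p w x)"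
    and "Dsp s p w \<in> borel_measurable borel"
proof -
  have m: "Dsp_integrand s p w x \<in> borel_measurable borel" for x
    unfolding Dsp_integrand_def[abs_def] by measurable
  show e: "Dsp s p w x = (LINT y|lborel. Dsp_integrand s p w x y)" for x
    unfolding Dsp_def using m[of x] by (intro integral_completion) simp
  show "integrable lebesgue (Dsp_integrand s p w x) \<longleftrightarrow> integrable lborel (Dsp_integrand s p w x)"
    using m[of x] by (intro integrable_completion) simp
  have "(\<lambda>x. LINT y|lborel. Dsp_integrand s p w x y) \<in> borel_measurable lborel"
    unfolding Dsp_integrand_def[abs_def] by measurable
  then show "Dsp s p w \<in> borel_measurable borel" using e by (simp add: e[abs_def] fun_eq_iff cong: measurable_cong)
qed

lemma (in singular_kernel) tail_bound_add:
  assumes g: "tail_bound q g" and "0 \<le> q" "0 \<le> M"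
  shows "tail_bound q (\<lambda>y. g y + M)"
proof -
  have [measurable]: "g \<in> borel_measurable borel" and g0: "\<And>y. 0 \<le> g y" using g by (auto simp: tail_bound_def)
  have "integrable lborel (\<lambda>y. (g y + M) powr q * weight y)"
  proof (rule Bochner_Integration.integrable_bound[OF tail_bound_majorant[OF g, of M]])
    show "AE y in lborel. norm ((g y + M) powr q * weight y) \<le> norm (2 powr q * (M powr q + g y powr q) * weight y)"
    proof (intro always_eventually allI)
      fix y
      have "(g y + M) powr q \<le> 2 powr q * (g y powr q + M powr q)" by (rule powr_add_le) (use g0 assms in auto)
      then have "(g y + M) powr q * weight y \<le> 2 powr q * (M powr q + g y powr q) * weight y"
        using weight_pos[of y] by (intro mult_right_mono) (auto simp: add.commute)
      then show "norm ((g y + M) powr q * weight y) \<le> norm (2 powr q * (M powr q + g y powr q) * weight y)"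
        using weight_pos[of y] by (simp add: abs_of_pos)
    qed
  qed measurable
  then show ?thesis using g0 assms by (simp add: tail_bound_def)
qed

text \<open>Finiteness of D_s^p at a single point yields tail integrability with the power p: the
  inequality |x0 - y| <= (1 + |x0|) (1 + |y|) bounds the weight by a multiple of |x0 - y|^(-N-sp),
  and w(y) = w(x0) - (w(x0) - w(y)).\<close>

lemma (in singular_kernel) tail_bound_of_Dsp:
  assumes w[measurable]: "w \<in> borel_measurable borel" and i: "integrable lborel (Dsp_integrand s p w x0)"
  shows "tail_bound p (\<lambda>y. \<bar>w y\<bar>)"
proof -
  define \<beta> where "\<beta> = real DIM('a) + s * p"
  have \<beta>: "0 \<le> \<beta>" using s p by (simp add: \<beta>_def)
  define c where "c = (1 + norm x0) powr \<beta>"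
  have AEnz: "AE y in lborel. y \<noteq> x0" by (rule AE_lborel_singleton)
  have wt: "weight y \<le> c * norm (x0 - y) powr (- \<beta>)" if "y \<noteq> x0" for y
  proof -
    have pos: "0 < norm (x0 - y)" using that by simp
    have "norm (x0 - y) \<le> norm x0 + norm y" by (rule norm_triangle_ineq4)
    also have "\<dots> \<le> (1 + norm x0) * (1 + norm y)" by (simp add: algebra_simps)
    finally have l: "norm (x0 - y) \<le> (1 + norm x0) * (1 + norm y)" .
    have p1: "0 < 1 + norm x0" "0 < 1 + norm y" by (auto simp: add_pos_nonneg)
    have "weight y = c * ((1 + norm x0) * (1 + norm y)) powr (- \<beta>)"
      using p1 by (simp add: weight_def c_def \<beta>_def[symmetric] powr_mult powr_minus)
    also have "\<dots> \<le> c * norm (x0 - y) powr (- \<beta>)"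
      using l pos \<beta> by (intro mult_left_mono powr_mono2') (auto simp: c_def)
    finally show ?thesis .
  qed
  have "integrable lborel (\<lambda>y. \<bar>w y\<bar> powr p * weight y)"
  proof (rule Bochner_Integration.integrable_bound)
    show "integrable lborel (\<lambda>y. 2 powr p * (\<bar>w x0\<bar> powr p * weight y + c * Dsp_integrand s p w x0 y))"
      by (intro integrable_mult_right Bochner_Integration.integrable_add weight_integrable i)
    show "AE y in lborel. norm (\<bar>w y\<bar> powr p * weight y) \<le> norm (2 powr p * (\<bar>w x0\<bar> powr p * weight y + c * Dsp_integrand s p w x0 y))"
      using AEnz
    proof eventually_elim
      case (elim y)
      have "\<bar>w y\<bar> powr p = \<bar>w x0 - (w x0 - w y)\<bar> powr p" by simp
      also have "\<dots> \<le> 2 powr p * (\<bar>w x0\<bar> powr p + \<bar>w x0 - w y\<bar> powr p)"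
        by (rule abs_diff_powr_le) (use p in auto)
      finally have A: "\<bar>w y\<bar> powr p \<le> 2 powr p * (\<bar>w x0\<bar> powr p + \<bar>w x0 - w y\<bar> powr p)" .
      have 1: "\<bar>w y\<bar> powr p * weight y \<le> 2 powr p * (\<bar>w x0\<bar> powr p * weight y + \<bar>w x0 - w y\<bar> powr p * weight y)"
        using mult_right_mono[OF A less_imp_le[OF weight_pos[of y]]] by (simp add: algebra_simps)
      have "\<bar>w x0 - w y\<bar> powr p * weight y \<le> \<bar>w x0 - w y\<bar> powr p * (c * norm (x0 - y) powr (- \<beta>))"
        by (intro mult_left_mono wt elim) auto
      also have "\<dots> = c * Dsp_integrand s p w x0 y"
        unfolding Dsp_integrand_def \<beta>_def powr_minus divide_inverse by simp
      finally have 2: "\<bar>w x0 - w y\<bar> powr p * weight y \<le> c * Dsp_integrand s p w x0 y" .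
      have "2 powr p * (\<bar>w x0\<bar> powr p * weight y + \<bar>w x0 - w y\<bar> powr p * weight y)
          \<le> 2 powr p * (\<bar>w x0\<bar> powr p * weight y + c * Dsp_integrand s p w x0 y)"
        using 2 by (intro mult_left_mono add_left_mono) auto
      with 1 have "\<bar>w y\<bar> powr p * weight y \<le> 2 powr p * (\<bar>w x0\<bar> powr p * weight y + c * Dsp_integrand s p w x0 y)" by linarith
      moreover have "0 \<le> \<bar>w y\<bar> powr p * weight y" using weight_pos[of y] by simp
      ultimately show ?case by simp
    qed
  qed measurable
  then show ?thesis by (simp add: tail_bound_def)
qed

subsection \<open>The viscosity inequality at a touching point\<close>

text \<open>The touching function enters through a second-order expansion at x0, with gradient
  \<open>\<xi>\<close> and symmetric B, and lies below u almost everywhere. In this form the lemma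
  applies to a Borel representative of the test function.\<close>

lemma (in singular_kernel) touching_inequality:
  fixes u \<psi> :: "'a \<Rightarrow> real" and f :: "'a \<Rightarrow> real \<Rightarrow> 'a \<Rightarrow> real \<Rightarrow> real"
  assumes K: "\<And>x y. K x y = k (y - x)"
    and \<Omega>: "open \<Omega>" "cball x0 R0 \<subseteq> \<Omega>" "0 < R0"
    and f: "continuous_on (\<Omega> \<times> UNIV \<times> UNIV \<times> UNIV) (\<lambda>(x, t, \<eta>, \<zeta>). f x t \<eta> \<zeta>)"
    and comp: "\<And>\<Omega>'. open \<Omega>' \<Longrightarrow> \<Omega>' \<subseteq> \<Omega> \<Longrightarrow> comparison_principle s p K f \<Omega>'"
    and u: "continuous_on UNIV u" "weak_supersolution s p K f \<Omega> u"
    and \<psi>[measurable]: "\<psi> \<in> borel_measurable borel" and tb: "tail_bound (p - 1) (\<lambda>y. \<bar>\<psi> y\<bar>)"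
    and touch: "AE y in lborel. \<psi> y \<le> u y" "\<psi> x0 = u x0"
    and mean: "integrable lborel (Dsp_integrand s p \<psi> x0) \<or> (\<forall>z\<in>\<Omega>. \<forall>t \<eta> \<zeta>\<^sub>1 \<zeta>\<^sub>2. f z t \<eta> \<zeta>\<^sub>1 = f z t \<eta> \<zeta>\<^sub>2)"
    and B: "symmetric_map B"
    and taylor: "\<And>\<epsilon>. 0 < \<epsilon> \<Longrightarrow> \<exists>\<delta>>0. \<forall>z. norm z < \<delta> \<longrightarrow> \<bar>\<psi> (x0 + z) - quad (\<psi> x0) \<xi> B x0 (x0 + z)\<bar> \<le> \<epsilon> * (norm z)\<^sup>2"
  shows "f x0 (\<psi> x0) \<xi> (Dsp s p \<psi> x0) \<le> - (\<Sum>b\<in>Basis. p_power_deriv p \<xi> (B b) \<bullet> b) + nonlocal_op \<psi> x0"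
proof (rule ccontr)
  assume "\<not> ?thesis"
  then have neg: "- (\<Sum>b\<in>Basis. p_power_deriv p \<xi> (B b) \<bullet> b) + nonlocal_op \<psi> x0 < f x0 (\<psi> x0) \<xi> (Dsp s p \<psi> x0)" by simp
  have x0: "x0 \<in> \<Omega>" using \<Omega> by auto
  define c1 where "c1 \<longleftrightarrow> integrable lborel (Dsp_integrand s p \<psi> x0)"
  \<comment> \<open>If \<open>D\<^sub>s\<^sup>p \<psi>(x0)\<close> diverges, \<open>f\<close> ignores its last argument, and the junk value of \<open>Dsp\<close> is replaced
    by \<open>0\<close> so that \<open>Z\<close> depends continuously on its arguments in both cases.\<close>
  define Z where "Z w x = (if c1 then Dsp s p w x else 0)" for w and x :: 'a
  have fZ: "f x t \<eta> (Dsp s p w x) = f x t \<eta> (Z w x)" if "x \<in> \<Omega>" for x t \<eta> w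
    using mean that unfolding Z_def c1_def by auto
  have inv0: "(\<lambda>n. 1 / (real n + 1)) \<longlonglongrightarrow> 0"
    using LIMSEQ_inverse_real_of_nat by (simp add: inverse_eq_divide add.commute)
  have fl: "(\<lambda>n. f (X n) (t n) (e n) (z n)) \<longlonglongrightarrow> f x t' e' z'"
    if "X \<longlonglongrightarrow> x" "t \<longlonglongrightarrow> t'" "e \<longlonglongrightarrow> e'" "z \<longlonglongrightarrow> z'" "x \<in> \<Omega>" "\<And>n. X n \<in> \<Omega>" for X t e z x t' e' z'
  proof -
    have "(\<lambda>n. (X n, t n, e n, z n)) \<longlonglongrightarrow> (x, t', e', z')" by (intro tendsto_Pair that)
    moreover have "\<forall>\<^sub>F n in sequentially. (X n, t n, e n, z n) \<in> \<Omega> \<times> UNIV \<times> UNIV \<times> UNIV"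
      using that(6) by simp
    ultimately show ?thesis
      using continuous_on_tendsto_compose[OF f, of "\<lambda>n. (X n, t n, e n, z n)" "(x, t', e', z')"] that(5) by simp
  qed

  \<comment> \<open>The polynomial halves the quadratic form, so lowering the Hessian by 4
    \<open>\<epsilon>\<close> subtracts 2 \<open>\<epsilon>\<close> |z|^2.\<close>
  define B' where "B' \<epsilon> h = B h + (- (4 * \<epsilon>)) *\<^sub>R h" for \<epsilon> h
  interpret B: symmetric_map B by (rule B)
  have B': "symmetric_map (B' \<epsilon>)" for \<epsilon>
  proof (rule symmetric_map.intro)
    show "linear (B' \<epsilon>)" unfolding B'_def[abs_def]
      by (intro linear_compose_add B.lin linear_scale_self)
    show "B' \<epsilon> x \<bullet> y = x \<bullet> B' \<epsilon> y" for x y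
      using B.sym[of x y] by (simp add: B'_def inner_diff_left inner_diff_right)
  qed
  \<comment> \<open>The local operator at x0 depends continuously on the Hessian, so the strict
    inequality survives for some \<open>\<epsilon>\<close> = 1 / (n0 + 1).\<close>
  define L where "L \<epsilon> = (\<Sum>b\<in>(Basis::'a set). p_power_deriv p \<xi> (B' \<epsilon> b) \<bullet> b)" for \<epsilon>
  have "(\<lambda>n. L (1 / (real n + 1))) \<longlonglongrightarrow> (\<Sum>b\<in>Basis. p_power_deriv p \<xi> (B b) \<bullet> b)"
    unfolding L_def
  proof (intro tendsto_sum tendsto_inner tendsto_const tendsto_p_power_deriv[OF p])
    fix b :: 'a
    have "(\<lambda>n. B b + (- (4 * (1 / (real n + 1)))) *\<^sub>R b) \<longlonglongrightarrow> B b + (- (4 * 0)) *\<^sub>R b"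
      by (intro tendsto_intros inv0)
    then show "(\<lambda>n. B' (1 / (real n + 1)) b) \<longlonglongrightarrow> B b" by (simp add: B'_def)
  qed
  then have "(\<lambda>n. - L (1 / (real n + 1)) + nonlocal_op \<psi> x0) \<longlonglongrightarrow> - (\<Sum>b\<in>Basis. p_power_deriv p \<xi> (B b) \<bullet> b) + nonlocal_op \<psi> x0"
    by (intro tendsto_intros)
  from order_tendstoD(2)[OF this neg]
  obtain n0 :: nat where n0: "- L (1 / (real n0 + 1)) + nonlocal_op \<psi> x0 < f x0 (\<psi> x0) \<xi> (Dsp s p \<psi> x0)"
    by (auto simp: eventually_sequentially)
  define \<epsilon> where "\<epsilon> = 1 / (real n0 + 1)"
  have \<epsilon>: "0 < \<epsilon>" by (simp add: \<epsilon>_def)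
  interpret Q: singular_kernel_quad s p k \<Lambda> "B' \<epsilon>"
    by (intro singular_kernel_quad.intro singular_kernel_axioms B')
  define q where "q = quad (\<psi> x0) \<xi> (B' \<epsilon>) x0"
  define gq where "gq = quad_grad \<xi> (B' \<epsilon>) x0"
  have gq0: "gq x0 = \<xi>" using Q.lin by (simp add: gq_def quad_grad_def linear_0)
  have q0: "q x0 = \<psi> x0" by (simp add: q_def quad_def)
  have qc: "continuous_on S q" for S unfolding q_def by (rule Q.quad_continuous)
  have gqc: "continuous_on S gq" for S unfolding gq_def by (rule Q.quad_grad_continuous)
  have [measurable]: "q \<in> borel_measurable borel" "gq \<in> borel_measurable borel"
    by (rule borel_measurable_continuous_onI, rule qc gqc)+
  have qq: "q (x0 + z) = quad (\<psi> x0) \<xi> B x0 (x0 + z) - 2 * \<epsilon> * (norm z)\<^sup>2" for z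
    by (simp add: q_def quad_def B'_def inner_diff_left power2_norm_eq_inner field_simps)
  have Lq: "Q.local_op p \<xi> x0 x0 = L \<epsilon>" by (simp add: Q.local_op_def L_def gq0[unfolded gq_def])
  obtain \<delta>1 where \<delta>1: "0 < \<delta>1" "\<And>z. norm z < \<delta>1 \<Longrightarrow> \<bar>\<psi> (x0 + z) - quad (\<psi> x0) \<xi> B x0 (x0 + z)\<bar> \<le> \<epsilon> * (norm z)\<^sup>2"
    using taylor[OF \<epsilon>] by blast
  define \<delta>0 where "\<delta>0 = min \<delta>1 (min 1 R0)"
  have \<delta>0: "0 < \<delta>0" "\<delta>0 \<le> 1" "\<delta>0 \<le> R0" "\<delta>0 \<le> \<delta>1" using \<delta>1 \<Omega> by (auto simp: \<delta>0_def)
  have below: "q (x0 + z) + \<epsilon> * (norm z)\<^sup>2 \<le> \<psi> (x0 + z)" and close: "\<bar>\<psi> (x0 + z) - q (x0 + z)\<bar> \<le> 3 * \<epsilon> * (norm z)\<^sup>2"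
    if "norm z < \<delta>0" for z
  proof -
    have n0: "0 \<le> \<epsilon> * (norm z)\<^sup>2" using \<epsilon> by simp
    have 1: "\<bar>\<psi> (x0 + z) - quad (\<psi> x0) \<xi> B x0 (x0 + z)\<bar> \<le> \<epsilon> * (norm z)\<^sup>2" using \<delta>1(2)[of z] that \<delta>0 by simp
    have 2: "q (x0 + z) = quad (\<psi> x0) \<xi> B x0 (x0 + z) - 2 * (\<epsilon> * (norm z)\<^sup>2)" using qq[of z] by simp
    show "q (x0 + z) + \<epsilon> * (norm z)\<^sup>2 \<le> \<psi> (x0 + z)" using 1 2 by linarith
    have "\<bar>\<psi> (x0 + z) - q (x0 + z)\<bar> \<le> 3 * (\<epsilon> * (norm z)\<^sup>2)" using 1 2 n0 by linarith
    then show "\<bar>\<psi> (x0 + z) - q (x0 + z)\<bar> \<le> 3 * \<epsilon> * (norm z)\<^sup>2" by simp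
  qed
  obtain C where C: "0 \<le> C"
    "\<And>x y. x \<in> ball x0 \<delta>0 \<Longrightarrow> y \<in> ball x0 \<delta>0 \<Longrightarrow> \<bar>q x - q y\<bar> \<le> C * norm (x - y)"
    "\<And>x z. \<bar>2 * q x - q (x + z) - q (x - z)\<bar> \<le> C * (norm z)\<^sup>2"
    using Q.quad_differences[OF \<delta>0(1), of x0 "\<psi> x0" \<xi>] unfolding q_def by blast
  obtain Mq where Mq: "0 \<le> Mq" "\<And>x. x \<in> cball x0 \<delta>0 \<Longrightarrow> \<bar>q x\<bar> \<le> Mq"
    using bounded_on_compact[OF qc compact_cball] by metis
  \<comment> \<open>One majorant for every function below: it covers \<open>\<psi>\<close> outside
    the glued ball and q plus a lift of at most \<open>\<epsilon>\<close> inside.\<close>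
  define G where "G y = \<bar>\<psi> y\<bar> + (Mq + \<epsilon>)" for y
  have G: "tail_bound (p - 1) G" unfolding G_def[abs_def]
    by (rule tail_bound_add[OF tb]) (use p Mq \<epsilon> in auto)
  have [measurable]: "G \<in> borel_measurable borel" using G by (simp add: tail_bound_def)
  have Gp: "integrable lborel (\<lambda>y. G y powr p * (1 + norm y) powr (- (real DIM('a) + s * p)))" if c1
    using tail_bound_add[OF tail_bound_of_Dsp[OF \<psi> that[unfolded c1_def]], of "Mq + \<epsilon>"] p Mq \<epsilon>
    by (simp add: tail_bound_def G_def weight_def)

  \<comment> \<open>The gluing radii shrink to 0. The value at x0 is always that of
    \<open>\<psi>\<close>, so convergence to \<open>\<psi>\<close> holds at every point, and the
    differences at x0 are controlled uniformly in n.\<close>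
  define wn where "wn n y = (if y \<in> ball x0 (\<delta>0 / (real n + 1)) then q y else \<psi> y)" for n :: nat and y
  have wm[measurable]: "wn n \<in> borel_measurable borel" for n unfolding wn_def[abs_def] by measurable
  have dn: "0 < \<delta>0 / (real n + 1)" "\<delta>0 / (real n + 1) \<le> \<delta>0" for n :: nat using \<delta>0 by (auto simp: divide_simps)
  have wn0: "wn n x0 = \<psi> x0" for n using dn(1)[of n] by (simp add: wn_def q0)
  have wnG: "\<bar>wn n y\<bar> \<le> G y" for n y
  proof (cases "y \<in> ball x0 (\<delta>0 / (real n + 1))")
    case True
    then have "y \<in> cball x0 \<delta>0" using dn(2)[of n] by auto
    from Mq(2)[OF this] show ?thesis using True \<epsilon> by (simp add: wn_def G_def)
  qed (use Mq \<epsilon> in \<open>simp add: wn_def G_def\<close>)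
  have wev: "\<forall>\<^sub>F n in sequentially. \<psi> y = wn n y" if "y \<noteq> x0" for y
  proof -
    have "(\<lambda>n. \<delta>0 * (1 / (real n + 1))) \<longlonglongrightarrow> \<delta>0 * 0" by (intro tendsto_intros inv0)
    then have "(\<lambda>n. \<delta>0 / (real n + 1)) \<longlonglongrightarrow> 0" by simp
    then have "\<forall>\<^sub>F n in sequentially. \<delta>0 / (real n + 1) < dist x0 y"
      by (rule order_tendstoD(2)) (use that in simp)
    then show ?thesis by eventually_elim (simp add: wn_def)
  qed
  have wlim: "(\<lambda>n. wn n y) \<longlonglongrightarrow> \<psi> y" for y
  proof (cases "y = x0")
    case False
    show ?thesis by (rule Lim_transform_eventually[OF tendsto_const wev[OF False]])
  qed (simp add: wn0)
  \<comment> \<open>C comes from q; \<open>\<psi>\<close> differs from q by at most 3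
    \<open>\<epsilon>\<close> |z|^2, and the second difference contains two such values.\<close>
  define C' where "C' = C + 6 * \<epsilon>"
  have C'0: "0 \<le> C'" using C \<epsilon> by (simp add: C'_def)
  have qd: "\<bar>q x0 - q (x0 + z)\<bar> \<le> C * norm z" if "norm z < \<delta>0" for z
    using C(2)[of x0 "x0 + z"] that \<delta>0 by (simp add: dist_norm)
  have z2: "(norm z)\<^sup>2 \<le> norm z" if "norm z < \<delta>0" for z :: 'a
    using that \<delta>0 mult_left_mono[of "norm z" 1 "norm z"] by (simp add: power2_eq_square)
  have wd1: "\<bar>wn n x0 - wn n (x0 + z)\<bar> \<le> C' * norm z" if z: "norm z < \<delta>0" for n z
  proof -
    have "\<bar>q x0 - \<psi> (x0 + z)\<bar> \<le> C * norm z + 3 * \<epsilon> * (norm z)\<^sup>2"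
      using qd[OF z] close[OF z] by linarith
    also have "\<dots> \<le> C * norm z + 3 * \<epsilon> * norm z" using z2[OF z] \<epsilon> by (intro add_left_mono mult_left_mono) auto
    finally have 1: "\<bar>q x0 - \<psi> (x0 + z)\<bar> \<le> (C + 3 * \<epsilon>) * norm z" by (simp add: algebra_simps)
    have e: "(C + 3 * \<epsilon>) * norm z \<le> C' * norm z" "C * norm z \<le> C' * norm z"
      using \<epsilon> by (auto intro!: mult_right_mono simp: C'_def)
    show ?thesis unfolding wn0 unfolding wn_def using 1 e qd[OF z] q0 by auto
  qed
  have wd2: "\<bar>2 * wn n x0 - wn n (x0 + z) - wn n (x0 - z)\<bar> \<le> C' * (norm z)\<^sup>2" if z: "norm z < \<delta>0" for n z
  proof -
    have b: "x0 + z \<in> ball x0 t \<longleftrightarrow> norm z < t" "x0 - z \<in> ball x0 t \<longleftrightarrow> norm z < t" for t by (auto simp: dist_norm)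
    have z0: "0 \<le> \<epsilon> * (norm z)\<^sup>2" using \<epsilon> by simp
    have c2: "\<bar>\<psi> (x0 - z) - q (x0 - z)\<bar> \<le> 3 * \<epsilon> * (norm z)\<^sup>2" using close[of "- z"] z by simp
    have e: "C' * (norm z)\<^sup>2 = C * (norm z)\<^sup>2 + 6 * \<epsilon> * (norm z)\<^sup>2" by (simp add: C'_def algebra_simps)
    show ?thesis unfolding wn0 unfolding wn_def b
      using C(3)[of x0 z] close[OF z] c2 z0 q0 e by auto
  qed
  have N1: "(\<lambda>n. nonlocal_op (wn n) x0) \<longlonglongrightarrow> nonlocal_op \<psi> x0"
  proof (rule nonlocal_op_tendsto(1)[OF \<delta>0(1) tendsto_const wm \<psi> C'0 wd1 wd2 wlim _ _ G wnG])
    show "(\<lambda>n. wn n x0) \<longlonglongrightarrow> \<psi> x0" by (rule wlim)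
    show "AE y in lborel. (\<lambda>n. wn n y) \<longlonglongrightarrow> \<psi> y" using wlim by simp
    show "\<bar>\<psi> y\<bar> \<le> G y" for y using Mq \<epsilon> by (simp add: G_def)
  qed
  have Z1: "(\<lambda>n. Z (wn n) x0) \<longlonglongrightarrow> Z \<psi> x0"
  proof (cases c1)
    case True
    have "(\<lambda>n. LINT y|lborel. Dsp_integrand s p (wn n) x0 y) \<longlonglongrightarrow> (LINT y|lborel. Dsp_integrand s p \<psi> x0 y)"
    proof (rule Dsp_tendsto(1)[OF s p \<delta>0(1) tendsto_const wm \<psi> C'0 wd1 wlim _ _ _ Gp[OF True] wnG])
      show "(\<lambda>n. wn n x0) \<longlonglongrightarrow> \<psi> x0" by (rule wlim)
      show "AE y in lborel. (\<lambda>n. wn n y) \<longlonglongrightarrow> \<psi> y" using wlim by simp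
    qed measurable
    then show ?thesis using True by (simp add: Z_def Dsp_borel(1)[OF wm] Dsp_borel(1)[OF \<psi>])
  qed (simp add: Z_def)
  have f1: "(\<lambda>n. f x0 (\<psi> x0) \<xi> (Z (wn n) x0) - (- L \<epsilon> + nonlocal_op (wn n) x0)) \<longlonglongrightarrow> f x0 (\<psi> x0) \<xi> (Z \<psi> x0) - (- L \<epsilon> + nonlocal_op \<psi> x0)"
    by (intro tendsto_diff tendsto_add tendsto_const fl Z1 N1 x0)
  have "0 < f x0 (\<psi> x0) \<xi> (Z \<psi> x0) - (- L \<epsilon> + nonlocal_op \<psi> x0)"
    using n0 fZ[OF x0, of "\<psi> x0" \<xi> \<psi>] by (simp add: \<epsilon>_def)
  from order_tendstoD(1)[OF f1 this]
  obtain n1 where n1: "0 < f x0 (\<psi> x0) \<xi> (Z (wn n1) x0) - (- L \<epsilon> + nonlocal_op (wn n1) x0)"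
    by (auto simp: eventually_sequentially)
  define \<delta> where "\<delta> = \<delta>0 / (real n1 + 1)"
  have \<delta>: "0 < \<delta>" "\<delta> \<le> \<delta>0" using dn by (auto simp: \<delta>_def)
  define w0 where "w0 = wn n1"
  have w0e: "w0 y = (if y \<in> ball x0 \<delta> then q y else \<psi> y)" for y by (simp add: w0_def wn_def \<delta>_def)
  have [measurable]: "w0 \<in> borel_measurable borel" by (simp add: w0_def)

  \<comment> \<open>The factor 1/2 gives 2 r <= \<open>\<delta>\<close>, the separation asked for by
    \<open>weak_subsolution_ball\<close>; r <= 1 makes the lift at most \<open>\<epsilon>\<close>,
    as allowed for in G.\<close>
  define r where "r m = \<delta> / 2 * (1 / (real m + 1))" for m :: nat
  have r: "0 < r m" "2 * r m \<le> \<delta>" "r m \<le> 1" for m using \<delta> \<delta>0 by (auto simp: r_def divide_simps)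
  have r0: "r \<longlonglongrightarrow> 0" unfolding r_def[abs_def] using tendsto_mult[OF tendsto_const inv0, of "\<delta> / 2"] by simp
  define \<theta> where "\<theta> m = \<epsilon> * (r m)\<^sup>2" for m
  have \<theta>: "0 < \<theta> m" "\<theta> m \<le> \<epsilon>" for m
  proof -
    show "0 < \<theta> m" using \<epsilon> r[of m] by (simp add: \<theta>_def)
    have "(r m)\<^sup>2 \<le> 1" using r[of m] by (simp add: power_le_one)
    then show "\<theta> m \<le> \<epsilon>" using \<epsilon> by (simp add: \<theta>_def)
  qed
  have \<theta>0: "\<theta> \<longlonglongrightarrow> 0" unfolding \<theta>_def[abs_def] using tendsto_mult[OF tendsto_const tendsto_power[OF r0, of 2], of \<epsilon>] by simp
  define W where "W m y = (if y \<in> ball x0 \<delta> then q y + \<theta> m else \<psi> y)" for m y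
  have Wm[measurable]: "W m \<in> borel_measurable borel" for m unfolding W_def[abs_def] by measurable
  have WG: "\<bar>W m y\<bar> \<le> G y" for m y
  proof (cases "y \<in> ball x0 \<delta>")
    case True
    then have "y \<in> cball x0 \<delta>0" using \<delta>(2) by auto
    from Mq(2)[OF this] show ?thesis using True \<theta>[of m] by (simp add: W_def G_def)
  qed (use Mq \<epsilon> in \<open>simp add: W_def G_def\<close>)
  have Wl: "(\<lambda>m. W m y) \<longlonglongrightarrow> w0 y" for y
  proof (cases "y \<in> ball x0 \<delta>")
    case True
    then show ?thesis using tendsto_add[OF tendsto_const \<theta>0, of "q y"] by (simp add: W_def w0e)
  qed (simp add: W_def w0e)
  \<comment> \<open>Beside the strict inequality: a bound on Z, from which f is bounded along
    \<open>W m\<close>, and integrability, which makes the right-hand side meaningful at each point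
    of the ball.\<close>
  define good where "good m x \<longleftrightarrow> - Q.local_op p \<xi> x0 x + nonlocal_op (W m) x < f x (W m x) (gq x) (Z (W m) x)
      \<and> \<bar>Z (W m) x\<bar> \<le> \<bar>Z w0 x0\<bar> + 1 \<and> (c1 \<longrightarrow> integrable lborel (Dsp_integrand s p (W m) x))" for m x
  have "\<exists>m. \<forall>x\<in>ball x0 (r m). good m x"
  proof (rule ccontr)
    assume "\<not> ?thesis"
    then have "\<forall>m. \<exists>x\<in>ball x0 (r m). \<not> good m x" by blast
    \<comment> \<open>The bad points tend to x0. Along them the two sides of the inequality and Z
      converge to their values for w0 at x0, where the inequality is strict; the integrability holds
      at each of them.\<close>
    then obtain X where X: "\<And>m. X m \<in> ball x0 (r m)" "\<And>m. \<not> good m (X m)" by metis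
    have Xl: "X \<longlonglongrightarrow> x0"
    proof -
      have "(\<lambda>m. dist (X m) x0) \<longlonglongrightarrow> 0"
        by (rule Lim_null_comparison[OF _ r0]) (use X(1) in \<open>auto simp: dist_commute intro!: always_eventually less_imp_le\<close>)
      then show ?thesis by (rule tendsto_dist_iff[THEN iffD2])
    qed
    have Xb: "X m + z \<in> ball x0 \<delta>" "X m - z \<in> ball x0 \<delta>" if "norm z < \<delta> / 2" for m z
    proof -
      have "dist x0 (X m) < \<delta> / 2" using X(1)[of m] r(2)[of m] by simp
      moreover have "dist x0 (X m + z) \<le> dist x0 (X m) + norm z" "dist x0 (X m - z) \<le> dist x0 (X m) + norm z"
        using dist_triangle[of x0 "X m + z" "X m"] dist_triangle[of x0 "X m - z" "X m"] by (auto simp: dist_norm)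
      ultimately show "X m + z \<in> ball x0 \<delta>" "X m - z \<in> ball x0 \<delta>" using that by auto
    qed
    have XX: "X m \<in> ball x0 \<delta>" for m using Xb(1)[of 0 m] \<delta> by simp
    have X\<Omega>: "X m \<in> \<Omega>" for m using XX[of m] \<delta> \<delta>0 \<Omega>(2) by (auto simp: subset_iff)
    have \<delta>2: "0 < \<delta> / 2" using \<delta> by simp
    have sub: "y \<in> ball x0 \<delta> \<Longrightarrow> y \<in> ball x0 \<delta>0" for y using \<delta>(2) by simp
    have d1: "\<bar>W m (X m) - W m (X m + z)\<bar> \<le> C * norm z" if z: "norm z < \<delta> / 2" for m z
      using C(2)[OF sub[OF XX[of m]] sub[OF Xb(1)[OF z, of m]]] XX[of m] Xb(1)[OF z, of m] by (simp add: W_def)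
    have d2: "\<bar>2 * W m (X m) - W m (X m + z) - W m (X m - z)\<bar> \<le> C * (norm z)\<^sup>2" if z: "norm z < \<delta> / 2" for m z
      using C(3)[of "X m" z] XX[of m] Xb[OF z, of m] by (simp add: W_def)
    have ql: "(\<lambda>m. q (X m + z)) \<longlonglongrightarrow> q (x0 + z)" for z
      by (rule continuous_on_tendsto_compose[OF qc[of UNIV] tendsto_add[OF Xl tendsto_const]]) auto
    have l1: "(\<lambda>m. W m (X m + z)) \<longlonglongrightarrow> w0 (x0 + z)" if z: "norm z < \<delta> / 2" for z
    proof -
      have "(\<lambda>m. q (X m + z) + \<theta> m) \<longlonglongrightarrow> q (x0 + z) + 0" by (intro tendsto_intros ql \<theta>0)
      moreover have "W m (X m + z) = q (X m + z) + \<theta> m" for m using Xb(1)[OF z, of m] by (simp add: W_def)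
      moreover have "w0 (x0 + z) = q (x0 + z)" using z \<delta> by (simp add: w0e dist_norm)
      ultimately show ?thesis by simp
    qed
    have l0: "(\<lambda>m. W m (X m)) \<longlonglongrightarrow> w0 x0" using l1[of 0] \<delta> by simp
    have lAE: "AE y in lborel. (\<lambda>m. W m y) \<longlonglongrightarrow> w0 y" using Wl by simp
    have w0G: "\<bar>w0 y\<bar> \<le> G y" for y using wnG by (simp add: w0_def)
    have w0m: "w0 \<in> borel_measurable borel" by measurable
    have N2: "(\<lambda>m. nonlocal_op (W m) (X m)) \<longlonglongrightarrow> nonlocal_op w0 x0"
      by (rule nonlocal_op_tendsto(1)[OF \<delta>2 Xl Wm w0m C(1) d1 d2 l1 l0 lAE G WG w0G])
    have Z2: "(\<lambda>m. Z (W m) (X m)) \<longlonglongrightarrow> Z w0 x0"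
      and I2: "c1 \<Longrightarrow> integrable lborel (Dsp_integrand s p (W m) (X m))" for m
    proof -
      have Gm: "G \<in> borel_measurable borel" by measurable
      show "c1 \<Longrightarrow> integrable lborel (Dsp_integrand s p (W m) (X m))"
        using Dsp_tendsto(2)[OF s p \<delta>2 Xl Wm w0m C(1) d1 l1 l0 lAE Gm Gp WG] by simp
      show "(\<lambda>m. Z (W m) (X m)) \<longlonglongrightarrow> Z w0 x0"
      proof (cases c1)
        case True
        show ?thesis
          using Dsp_tendsto(1)[OF s p \<delta>2 Xl Wm w0m C(1) d1 l1 l0 lAE Gm Gp[OF True] WG] True
          by (simp add: Z_def Dsp_borel(1)[OF Wm] Dsp_borel(1)[OF w0m])
      qed (simp add: Z_def)
    qed
    have gl: "(\<lambda>m. gq (X m)) \<longlonglongrightarrow> \<xi>"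
      using continuous_on_tendsto_compose[OF gqc[of UNIV] Xl] by (simp add: gq0)
    have Ll: "(\<lambda>m. Q.local_op p \<xi> x0 (X m)) \<longlonglongrightarrow> L \<epsilon>"
      using continuous_on_tendsto_compose[OF Q.local_op_continuous[OF p, where S=UNIV and \<xi>=\<xi> and ?x0.0=x0] Xl] by (simp add: Lq)
    have w0x0: "w0 x0 = \<psi> x0" by (simp add: w0_def wn0)
    have lim: "(\<lambda>m. f (X m) (W m (X m)) (gq (X m)) (Z (W m) (X m)) - (- Q.local_op p \<xi> x0 (X m) + nonlocal_op (W m) (X m)))
        \<longlonglongrightarrow> f x0 (\<psi> x0) \<xi> (Z w0 x0) - (- L \<epsilon> + nonlocal_op w0 x0)"
      using l0 unfolding w0x0
      by (intro tendsto_diff tendsto_add tendsto_minus fl Xl gl Z2 N2 Ll x0 X\<Omega>)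
    have e1: "\<forall>\<^sub>F m in sequentially. 0 < f (X m) (W m (X m)) (gq (X m)) (Z (W m) (X m)) - (- Q.local_op p \<xi> x0 (X m) + nonlocal_op (W m) (X m))"
      by (rule order_tendstoD(1)[OF lim]) (use n1 in \<open>simp add: w0_def\<close>)
    have e2: "\<forall>\<^sub>F m in sequentially. \<bar>Z (W m) (X m)\<bar> < \<bar>Z w0 x0\<bar> + 1"
      by (rule order_tendstoD(2)[OF tendsto_rabs[OF Z2]]) simp
    have "\<forall>\<^sub>F m in sequentially. good m (X m)"
      using e1 e2 by eventually_elim (use I2 in \<open>auto simp: good_def\<close>)
    then show False using X(2) by (simp add: eventually_sequentially)
  qed
  then obtain m where m: "\<And>x. x \<in> ball x0 (r m) \<Longrightarrow> good m x" by blast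
  let ?U = "ball x0 (r m)"
  have U: "?U \<subseteq> \<Omega>" "cball x0 (r m) \<subseteq> \<Omega>" 
    using r[of m] \<delta> \<delta>0 \<Omega>(2) subset_cball[of "r m" R0 x0] ball_subset_cball[of x0 "r m"] by force+
  have WU: "W m x = q x + \<theta> m" if "x \<in> ball x0 \<delta>" for x using that by (simp add: W_def)
  have U\<delta>: "x \<in> ?U \<Longrightarrow> x \<in> ball x0 \<delta>" for x using r[of m] by simp
  have Zm[measurable]: "Z (W m) \<in> borel_measurable borel"
    unfolding Z_def[abs_def] using Dsp_borel(3)[OF Wm] by (cases c1) auto
  define Zb where "Zb = \<bar>Z w0 x0\<bar> + 1"
  \<comment> \<open>The last argument of f is replaced by a free variable in a compact interval,
    because \<open>Z (W m)\<close> is known only to be measurable and bounded.\<close>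
  have cont: "continuous_on (cball x0 (r m) \<times> cball 0 Zb) (\<lambda>P::'a \<times> real. (\<lambda>(x, t, \<eta>, \<zeta>). f x t \<eta> \<zeta>) (fst P, q (fst P) + \<theta> m, gq (fst P), snd P))"
  proof (rule continuous_on_compose2[OF f])
    show "continuous_on (cball x0 (r m) \<times> cball 0 Zb) (\<lambda>P::'a \<times> real. (fst P, q (fst P) + \<theta> m, gq (fst P), snd P))"
      by (intro continuous_intros continuous_on_compose2[OF qc[of UNIV]] continuous_on_compose2[OF gqc[of UNIV]]) auto
  qed (use U in auto)
  obtain MF where "\<And>P. P \<in> cball x0 (r m) \<times> cball 0 Zb \<Longrightarrow> \<bar>(\<lambda>(x, t, \<eta>, \<zeta>). f x t \<eta> \<zeta>) (fst P, q (fst P) + \<theta> m, gq (fst P), snd P)\<bar> \<le> MF"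
    using bounded_on_compact[OF cont compact_Times[OF compact_cball compact_cball]] by metis
  then have MF: "\<bar>f x (q x + \<theta> m) (gq x) z\<bar> \<le> MF" if "x \<in> cball x0 (r m)" "\<bar>z\<bar> \<le> Zb" for x z
    using that by (force simp: dist_norm)
  have sub: "weak_subsolution s p K f ?U (W m)"
  proof (rule Q.weak_subsolution_ball[OF K Wm G WG r(1) r(2)])
    show "W m x = quad (\<psi> x0 + \<theta> m) \<xi> (B' \<epsilon>) x0 x" if "x \<in> ball x0 \<delta>" for x
      using WU[OF that] by (simp add: q_def quad_def)
    fix x assume x: "x \<in> ?U"
    then have x\<Omega>: "x \<in> \<Omega>" using U by blast
    show "- Q.local_op p \<xi> x0 x + nonlocal_op (W m) x \<le> f x (W m x) (quad_grad \<xi> (B' \<epsilon>) x0 x) (Dsp s p (W m) x)"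
      using m[OF x] fZ[OF x\<Omega>] by (simp add: good_def gq_def)
    show "rhs_meaningful s p f ?U (W m) x"
    proof (cases c1)
      case True
      then have "integrable lborel (Dsp_integrand s p (W m) x)" using m[OF x] by (simp add: good_def)
      then show ?thesis by (simp add: rhs_meaningful_def Dsp_borel(2)[OF Wm])
    next
      case False
      then have "\<forall>z\<in>\<Omega>. \<forall>t \<eta> \<zeta>\<^sub>1 \<zeta>\<^sub>2. f z t \<eta> \<zeta>\<^sub>1 = f z t \<eta> \<zeta>\<^sub>2" using mean by (simp add: c1_def)
      then show ?thesis unfolding rhs_meaningful_def using U(1) by blast
    qed
  next
    \<comment> \<open>f is continuous only over \<open>\<Omega>\<close>; multiplying by the
      indicator of the open product set makes a globally Borel function, which can be
      composed.\<close>
    define F where "F P = (case P of (x, t, \<eta>, \<zeta>) \<Rightarrow> f x t \<eta> \<zeta>)" for P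
    have "open (\<Omega> \<times> (UNIV::real set) \<times> (UNIV::'a set) \<times> (UNIV::real set))" by (intro open_Times \<Omega>(1) open_UNIV)
    then have "(\<lambda>P. indicator (\<Omega> \<times> UNIV \<times> UNIV \<times> UNIV) P *\<^sub>R F P) \<in> borel_measurable borel"
      by (intro borel_measurable_continuous_on_indicator borel_open) (use f in \<open>simp_all add: F_def[abs_def]\<close>)
    moreover have "(\<lambda>x. (x, q x + \<theta> m, gq x, Z (W m) x)) \<in> borel_measurable borel" by measurable
    ultimately have "(\<lambda>x. indicator (\<Omega> \<times> UNIV \<times> UNIV \<times> UNIV) (x, q x + \<theta> m, gq x, Z (W m) x) *\<^sub>R F (x, q x + \<theta> m, gq x, Z (W m) x)) \<in> borel_measurable borel"
      by (rule measurable_compose[rotated])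
    then have "(\<lambda>x. indicator ?U x * (indicator (\<Omega> \<times> UNIV \<times> UNIV \<times> UNIV) (x, q x + \<theta> m, gq x, Z (W m) x) *\<^sub>R F (x, q x + \<theta> m, gq x, Z (W m) x))) \<in> borel_measurable borel"
      by (intro borel_measurable_times borel_measurable_indicator) auto
    also have "(\<lambda>x. indicator ?U x * (indicator (\<Omega> \<times> UNIV \<times> UNIV \<times> UNIV) (x, q x + \<theta> m, gq x, Z (W m) x) *\<^sub>R F (x, q x + \<theta> m, gq x, Z (W m) x)))
        = (\<lambda>x. indicator ?U x * f x (W m x) (quad_grad \<xi> (B' \<epsilon>) x0 x) (Dsp s p (W m) x))"
    proof
      fix x
      show "indicator ?U x * (indicator (\<Omega> \<times> UNIV \<times> UNIV \<times> UNIV) (x, q x + \<theta> m, gq x, Z (W m) x) *\<^sub>R F (x, q x + \<theta> m, gq x, Z (W m) x))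
        = indicator ?U x * f x (W m x) (quad_grad \<xi> (B' \<epsilon>) x0 x) (Dsp s p (W m) x)"
      proof (cases "x \<in> ?U")
        case True
        then have "x \<in> \<Omega>" using U by blast
        then show ?thesis using WU[OF U\<delta>[OF True]] fZ[OF \<open>x \<in> \<Omega>\<close>] by (simp add: F_def gq_def)
      qed simp
    qed
    finally show "(\<lambda>x. indicator ?U x * f x (W m x) (quad_grad \<xi> (B' \<epsilon>) x0 x) (Dsp s p (W m) x)) \<in> borel_measurable borel" .
  next
    show "\<bar>f x (W m x) (quad_grad \<xi> (B' \<epsilon>) x0 x) (Dsp s p (W m) x)\<bar> \<le> MF" if x: "x \<in> ?U" for x
    proof -
      have "x \<in> \<Omega>" using x U by blast
      have "\<bar>f x (q x + \<theta> m) (gq x) (Z (W m) x)\<bar> \<le> MF"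
        using m[OF x] x by (intro MF) (auto simp: good_def Zb_def)
      then show ?thesis using WU[OF U\<delta>[OF x]] fZ[OF \<open>x \<in> \<Omega>\<close>] by (simp add: gq_def)
    qed
  qed
  have sup: "weak_supersolution s p K f ?U u"
    by (rule weak_supersolution_ball[OF u(2) U(1) r(1)])
  have "AE x in lborel. x \<notin> ?U \<longrightarrow> W m x \<le> u x"
    using touch(1)
  proof eventually_elim
    case (elim x)
    show ?case
    proof
      assume x: "x \<notin> ?U"
      show "W m x \<le> u x"
      proof (cases "x \<in> ball x0 \<delta>")
        case True
        define z where "z = x - x0"
        have xz: "x = x0 + z" by (simp add: z_def)
        have nz: "r m \<le> norm z" "norm z < \<delta>0" using x True \<delta> by (auto simp: z_def dist_norm norm_minus_commute)
        have "(r m)\<^sup>2 \<le> (norm z)\<^sup>2" using nz r(1)[of m] by (intro power_mono) auto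
        then have "\<theta> m \<le> \<epsilon> * (norm z)\<^sup>2" using \<epsilon> by (simp add: \<theta>_def)
        then have "q x + \<theta> m \<le> \<psi> x" using below[OF nz(2)] unfolding xz by linarith
        then show ?thesis using elim WU[OF True] by simp
      qed (use elim in \<open>simp add: W_def\<close>)
    qed
  qed
  then have out: "AE x in lebesgue. x \<notin> ?U \<longrightarrow> W m x \<le> u x" by (rule AE_completion)
  have "AE x in lebesgue. W m x \<le> u x"
    using comp[of ?U] U sup sub out unfolding comparison_principle_def satisfies_comparison_def by blast
  then have ae: "AE x in lborel. W m x \<le> u x" by (simp add: AE_completion_iff)
  \<comment> \<open>The comparison principle gives \<open>W m\<close> <= u only almost everywhere.
    The contradiction therefore has to come from a whole ball about x0 on which, by continuity,
    \<open>W m\<close> > u.\<close>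
  have "isCont (\<lambda>x. q x + \<theta> m - u x) x0"
    using qc[of UNIV] u(1) by (intro continuous_intros) (simp_all add: continuous_on_eq_continuous_at)
  then have "\<forall>\<^sub>F x in at x0. 0 < q x + \<theta> m - u x"
    unfolding isCont_def by (rule order_tendstoD(1)) (use \<theta>[of m] in \<open>simp add: q0 touch(2)\<close>)
  then obtain e where e: "0 < e" "\<And>x. x \<noteq> x0 \<Longrightarrow> dist x x0 < e \<Longrightarrow> 0 < q x + \<theta> m - u x"
    unfolding eventually_at by blast
  obtain x where x: "x \<in> ball x0 (min e \<delta>)" "W m x \<le> u x"
    using AE_meets_ball[OF ae, of "min e \<delta>" x0] e \<delta> by auto
  have "W m x = q x + \<theta> m" using x \<delta> by (intro WU) auto
  moreover have "0 < q x + \<theta> m - u x"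
    using e(2)[of x] x \<theta>[of m] by (cases "x = x0") (auto simp: q0 touch(2) dist_commute)
  ultimately show False using x(2) by simp
qed

subsection \<open>Second-order behaviour of a test function\<close>

definition hessian :: "('a::euclidean_space \<Rightarrow> real) \<Rightarrow> 'a \<Rightarrow> 'a \<Rightarrow> 'a" where
  "hessian \<psi> x h = (\<Sum>b\<in>Basis. frechet_derivative (\<lambda>y. frechet_derivative \<psi> (at y) b) (at x) h *\<^sub>R b)"

lemma
  assumes \<psi>: "Ck_on 2 \<psi> U"
  shows C2_has_derivative: "x \<in> U \<Longrightarrow> (\<psi> has_derivative (\<lambda>h. gradient \<psi> x \<bullet> h)) (at x)"
    and gradient_has_derivative: "x \<in> U \<Longrightarrow> (gradient \<psi> has_derivative hessian \<psi> x) (at x)"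
    and hessian_continuous: "b \<in> Basis \<Longrightarrow> continuous_on U (\<lambda>x. hessian \<psi> x b)"
proof -
  have c: "Ck_on (Suc 0) (\<lambda>x. frechet_derivative \<psi> (at x) b) U" if "b \<in> Basis" for b
    using \<psi> that by (simp add: numeral_2_eq_2)
  show "(\<psi> has_derivative (\<lambda>h. gradient \<psi> x \<bullet> h)) (at x)" if x: "x \<in> U"
  proof -
    have d: "(\<psi> has_derivative frechet_derivative \<psi> (at x)) (at x)"
      using \<psi> x by (simp add: numeral_2_eq_2 flip: frechet_derivative_works)
    have "frechet_derivative \<psi> (at x) h = gradient \<psi> x \<bullet> h" for h
    proof -
      have "frechet_derivative \<psi> (at x) h = frechet_derivative \<psi> (at x) (\<Sum>b\<in>Basis. (h \<bullet> b) *\<^sub>R b)"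
        by (simp only: euclidean_representation)
      also have "\<dots> = (\<Sum>b\<in>Basis. (h \<bullet> b) * frechet_derivative \<psi> (at x) b)"
        using has_derivative_linear[OF d] by (simp add: linear_sum linear_cmul)
      also have "\<dots> = gradient \<psi> x \<bullet> h"
        by (simp add: gradient_def inner_sum_left inner_commute[of h] mult.commute)
      finally show ?thesis .
    qed
    then show ?thesis using d by (metis (no_types, lifting) ext)
  qed
  show "(gradient \<psi> has_derivative hessian \<psi> x) (at x)" if x: "x \<in> U"
    unfolding gradient_def[abs_def] hessian_def[abs_def]
    by (intro has_derivative_sum has_derivative_scaleR_left Ck_on_has_derivative[OF c x])
  show "continuous_on U (\<lambda>x. hessian \<psi> x b)" if "b \<in> Basis"
    unfolding hessian_def using c that by (intro continuous_on_sum continuous_on_scaleR continuous_on_const) auto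
qed

lemma p_laplacian_eq:
  assumes "2 \<le> p" "Ck_on 2 \<psi> U" "x \<in> U"
  shows "p_laplacian p \<psi> x = (\<Sum>b\<in>Basis. p_power_deriv p (gradient \<psi> x) (hessian \<psi> x b) \<bullet> b)"
proof -
  have "((\<lambda>z. p_power p (gradient \<psi> z)) has_derivative (\<lambda>h. p_power_deriv p (gradient \<psi> x) (hessian \<psi> x h))) (at x)"
    by (rule has_derivative_compose[OF gradient_has_derivative[OF assms(2,3)] has_derivative_p_power[OF assms(1)]])
  from frechet_derivative_at[OF this] show ?thesis
    unfolding p_laplacian_def divergence_def by (metis (no_types, lifting))
qed

text \<open>For p >= 2 the expanded p-Laplacian is a continuous expression in gradient and Hessian
  even where the gradient vanishes. Hence the limit of suprema in the viscosity definition is the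
  value at the point.\<close>

lemma p_laplacian_tendsto:
  assumes "2 \<le> p" "Ck_on 2 \<psi> U" "open U" "x \<in> U"
  shows "(p_laplacian p \<psi> \<longlongrightarrow> p_laplacian p \<psi> x) (at x)"
proof -
  have g: "(gradient \<psi> \<longlongrightarrow> gradient \<psi> x) (at x)"
    using has_derivative_continuous[OF gradient_has_derivative[OF assms(2,4)]] by (simp add: isCont_def)
  have h: "((\<lambda>y. hessian \<psi> y b) \<longlongrightarrow> hessian \<psi> x b) (at x)" if "b \<in> Basis" for b
    using hessian_continuous[OF assms(2) that] assms(3,4) by (simp add: continuous_on_eq_continuous_at isCont_def)
  have "((\<lambda>y. \<Sum>b\<in>Basis. p_power_deriv p (gradient \<psi> y) (hessian \<psi> y b) \<bullet> b)
      \<longlongrightarrow> (\<Sum>b\<in>Basis. p_power_deriv p (gradient \<psi> x) (hessian \<psi> x b) \<bullet> b)) (at x)"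
    by (intro tendsto_sum tendsto_inner tendsto_const tendsto_p_power_deriv[OF assms(1)] g h)
  then have "((\<lambda>y. \<Sum>b\<in>Basis. p_power_deriv p (gradient \<psi> y) (hessian \<psi> y b) \<bullet> b) \<longlongrightarrow> p_laplacian p \<psi> x) (at x)"
    unfolding p_laplacian_eq[OF assms(1,2,4)] .
  moreover have "\<forall>\<^sub>F y in at x. y \<in> U" using assms(3,4) by (rule eventually_at_in_open')
  then have "\<forall>\<^sub>F y in at x. (\<Sum>b\<in>Basis. p_power_deriv p (gradient \<psi> y) (hessian \<psi> y b) \<bullet> b) = p_laplacian p \<psi> y"
    by eventually_elim (simp add: p_laplacian_eq[OF assms(1,2)])
  ultimately show ?thesis by (rule Lim_transform_eventually)
qed

lemma Lim_SUP_punctured_ball: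
  fixes g :: "'a::euclidean_space \<Rightarrow> real"
  assumes g: "(g \<longlongrightarrow> l) (at x0)"
  shows "Lim (at_right 0) (\<lambda>\<rho>. SUP x\<in>ball x0 \<rho> - {x0}. ereal (g x)) = ereal l"
proof (rule tendsto_Lim)
  show "((\<lambda>\<rho>. SUP x\<in>ball x0 \<rho> - {x0}. ereal (g x)) \<longlongrightarrow> ereal l) (at_right 0)"
  proof (rule order_tendstoI)
    fix a assume "a < ereal l"
    then obtain c where c: "a < ereal c" "c < l" using ereal_dense2[of a "ereal l"] by auto
    obtain d where d: "0 < d" "\<And>x. x \<noteq> x0 \<Longrightarrow> dist x x0 < d \<Longrightarrow> c < g x"
      using order_tendstoD(1)[OF g c(2)] unfolding eventually_at by blast
    have "a < (SUP x\<in>ball x0 \<rho> - {x0}. ereal (g x))" if \<rho>: "0 < \<rho>" "\<rho> < d" for \<rho>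
    proof -
      obtain b :: 'a where b: "b \<in> Basis" using nonempty_Basis by blast
      \<comment> \<open>A point of the punctured ball: over an empty set the supremum would be minus
        infinity.\<close>
      define x where "x = x0 + (\<rho> / 2) *\<^sub>R b"
      have x: "x \<noteq> x0" "dist x x0 = \<rho> / 2" using \<rho> b by (auto simp: x_def dist_norm nonzero_Basis)
      have "a < ereal c" by (rule c)
      also have "ereal c < ereal (g x)" using d(2)[of x] x \<rho> by simp
      also have "\<dots> \<le> (SUP x\<in>ball x0 \<rho> - {x0}. ereal (g x))"
        by (rule SUP_upper) (use x \<rho> in \<open>simp add: dist_commute\<close>)
      finally show ?thesis .
    qed
    then show "\<forall>\<^sub>F \<rho> in at_right 0. a < (SUP x\<in>ball x0 \<rho> - {x0}. ereal (g x))"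
      unfolding eventually_at_right_field using d(1) by blast
  next
    fix a assume "ereal l < a"
    then obtain c where c: "ereal c < a" "l < c" using ereal_dense2[of "ereal l" a] by auto
    obtain d where d: "0 < d" "\<And>x. x \<noteq> x0 \<Longrightarrow> dist x x0 < d \<Longrightarrow> g x < c"
      using order_tendstoD(2)[OF g c(2)] unfolding eventually_at by blast
    have "(SUP x\<in>ball x0 \<rho> - {x0}. ereal (g x)) < a" if \<rho>: "0 < \<rho>" "\<rho> < d" for \<rho>
    proof -
      have "(SUP x\<in>ball x0 \<rho> - {x0}. ereal (g x)) \<le> ereal c"
        by (rule SUP_least) (use d(2) \<rho> in \<open>force simp: dist_commute less_imp_le\<close>)
      then show ?thesis using c(1) by simp
    qed
    then show "\<forall>\<^sub>F \<rho> in at_right 0. (SUP x\<in>ball x0 \<rho> - {x0}. ereal (g x)) < a"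
      unfolding eventually_at_right_field using d(1) by blast
  qed
qed simp

text \<open>Only the symmetric part of the Hessian enters the operator and the Taylor polynomial, so its
  symmetry need not be known.\<close>

definition sym_part :: "('a::euclidean_space \<Rightarrow> 'a) \<Rightarrow> 'a \<Rightarrow> 'a" where
  "sym_part H h = (1 / 2) *\<^sub>R (H h + adjoint H h)"

lemma sym_part_symmetric: "linear H \<Longrightarrow> symmetric_map (sym_part H)"
proof (rule symmetric_map.intro)
  assume H: "linear H"
  show "linear (sym_part H)" unfolding sym_part_def[abs_def]
    by (intro linear_compose_scale_right linear_compose_add H adjoint_linear)
  show "sym_part H x \<bullet> y = x \<bullet> sym_part H y" for x y
    using adjoint_works[OF H, of x y] adjoint_works[OF H, of y x]
    by (simp add: sym_part_def inner_add_left inner_add_right inner_commute)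
qed

lemma sym_part_quadratic: "linear H \<Longrightarrow> sym_part H z \<bullet> z = H z \<bullet> z"
  using adjoint_works[of H z z] by (simp add: sym_part_def inner_add_left inner_commute[of "adjoint H z" z])

text \<open>The sum sees the linear map only through its trace and its quadratic form at
  \<open>\<xi>\<close>, and both depend on the symmetric part alone.\<close>

lemma sum_p_power_deriv_sym_part:
  assumes H: "linear H"
  shows "(\<Sum>b\<in>Basis. p_power_deriv p \<xi> (sym_part H b) \<bullet> b) = (\<Sum>b\<in>Basis. p_power_deriv p \<xi> (H b) \<bullet> b)"
proof -
  have tr: "(\<Sum>b\<in>Basis. sym_part H b \<bullet> b) = (\<Sum>b\<in>Basis. H b \<bullet> b)"
    by (simp add: sym_part_quadratic[OF H])
  have rank1: "(\<Sum>b\<in>Basis. (\<xi> \<bullet> A b) * (\<xi> \<bullet> b)) = \<xi> \<bullet> A \<xi>" if A: "linear A" for A :: "'a \<Rightarrow> 'a"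
  proof -
    have "A \<xi> = A (\<Sum>b\<in>Basis. (\<xi> \<bullet> b) *\<^sub>R b)" by (simp only: euclidean_representation)
    also have "\<dots> = (\<Sum>b\<in>Basis. (\<xi> \<bullet> b) *\<^sub>R A b)" using A by (simp add: linear_sum linear_cmul)
    finally show ?thesis by (simp add: inner_sum_right mult.commute)
  qed
  have r: "(\<Sum>b\<in>Basis. (\<xi> \<bullet> sym_part H b) * (\<xi> \<bullet> b)) = (\<Sum>b\<in>Basis. (\<xi> \<bullet> H b) * (\<xi> \<bullet> b))"
    using rank1[OF H] rank1[OF symmetric_map.lin[OF sym_part_symmetric[OF H]]] sym_part_quadratic[OF H, of \<xi>]
    by (simp add: inner_commute)
  have e: "(\<Sum>b\<in>Basis. p_power_deriv p \<xi> (A b) \<bullet> b) = (if p = 2 then (\<Sum>b\<in>Basis. A b \<bullet> b)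
      else norm \<xi> powr (p - 2) * (\<Sum>b\<in>Basis. A b \<bullet> b) + (p - 2) * norm \<xi> powr (p - 4) * (\<Sum>b\<in>Basis. (\<xi> \<bullet> A b) * (\<xi> \<bullet> b)))" for A
    by (simp add: p_power_deriv_def inner_add_left sum.distrib sum_distrib_left mult.assoc)
  show ?thesis unfolding e tr r ..
qed

text \<open>The mean value theorem is applied to \<open>\<kappa>\<close>, which up to a constant is
  the Taylor remainder along the segment from x0 to x0 + z. Its derivative is the first-order
  remainder of the gradient tested with z, and differentiability of the gradient at x0 bounds it by
  \<open>\<epsilon>\<close> |z|^2.\<close>

lemma C2_taylor:
  assumes \<psi>: "Ck_on 2 \<psi> (ball x0 r)" "0 < r" and \<epsilon>: "0 < \<epsilon>"
  shows "\<exists>\<delta>>0. \<forall>z. norm z < \<delta> \<longrightarrow>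
    \<bar>\<psi> (x0 + z) - quad (\<psi> x0) (gradient \<psi> x0) (sym_part (hessian \<psi> x0)) x0 (x0 + z)\<bar> \<le> \<epsilon> * (norm z)\<^sup>2"
proof -
  let ?\<xi> = "gradient \<psi> x0" and ?H = "hessian \<psi> x0"
  have H: "(gradient \<psi> has_derivative ?H) (at x0)" using gradient_has_derivative[OF \<psi>(1)] \<psi>(2) by simp
  then have linH: "linear ?H" by (rule has_derivative_linear)
  obtain d where d: "0 < d" "\<And>y. norm (y - x0) < d \<Longrightarrow> norm (gradient \<psi> y - ?\<xi> - ?H (y - x0)) \<le> \<epsilon> * norm (y - x0)"
    using H \<epsilon> unfolding has_derivative_at_alt by blast
  have "\<bar>\<psi> (x0 + z) - quad (\<psi> x0) ?\<xi> (sym_part ?H) x0 (x0 + z)\<bar> \<le> \<epsilon> * (norm z)\<^sup>2" if z: "norm z < min d r" for z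
  proof -
    define \<kappa> where "\<kappa> t = \<psi> (x0 + t *\<^sub>R z) - t * (?\<xi> \<bullet> z) - t\<^sup>2 / 2 * (?H z \<bullet> z)" for t :: real
    define \<kappa>' where "\<kappa>' t = (gradient \<psi> (x0 + t *\<^sub>R z) - ?\<xi> - ?H (t *\<^sub>R z)) \<bullet> z" for t :: real
    have tz: "norm (t *\<^sub>R z) \<le> norm z" if "0 \<le> t" "t \<le> 1" for t
      using that by (simp add: mult_left_le_one_le)
    have "(\<kappa> has_real_derivative \<kappa>' t) (at t)" if t: "0 \<le> t" "t \<le> 1" for t
    proof -
      have 1: "((\<lambda>t. x0 + t *\<^sub>R z) has_derivative (\<lambda>h. h *\<^sub>R z)) (at t)" by (auto intro!: derivative_eq_intros)
      have "x0 + t *\<^sub>R z \<in> ball x0 r" using tz[OF t] z by (simp add: dist_norm)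
      from has_derivative_compose[OF 1 C2_has_derivative[OF \<psi>(1) this]]
      have "((\<lambda>t. \<psi> (x0 + t *\<^sub>R z)) has_real_derivative gradient \<psi> (x0 + t *\<^sub>R z) \<bullet> z) (at t)"
        unfolding has_field_derivative_def by (rule has_derivative_eq_rhs) (simp add: fun_eq_iff mult.commute)
      then have "(\<kappa> has_real_derivative gradient \<psi> (x0 + t *\<^sub>R z) \<bullet> z - ?\<xi> \<bullet> z - t * (?H z \<bullet> z)) (at t)"
        unfolding \<kappa>_def[abs_def] by (auto intro!: derivative_eq_intros)
      then show ?thesis using linH by (simp add: \<kappa>'_def inner_diff_left linear_cmul)
    qed
    then obtain t where t: "0 < t" "t < 1" "\<kappa> 1 - \<kappa> 0 = (1 - 0) * \<kappa>' t"
      using MVT2[of 0 1 \<kappa> \<kappa>'] by auto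
    have tz': "norm (t *\<^sub>R z) \<le> norm z" using tz[of t] t by simp
    have "\<bar>\<kappa>' t\<bar> \<le> norm (gradient \<psi> (x0 + t *\<^sub>R z) - ?\<xi> - ?H (t *\<^sub>R z)) * norm z"
      unfolding \<kappa>'_def by (rule Cauchy_Schwarz_ineq2)
    also have "\<dots> \<le> (\<epsilon> * norm z) * norm z"
    proof (rule mult_right_mono)
      have "norm (gradient \<psi> (x0 + t *\<^sub>R z) - ?\<xi> - ?H (t *\<^sub>R z)) \<le> \<epsilon> * norm (t *\<^sub>R z)"
        using d(2)[of "x0 + t *\<^sub>R z"] tz' z by simp
      also have "\<dots> \<le> \<epsilon> * norm z" using tz' \<epsilon> by (intro mult_left_mono) auto
      finally show "norm (gradient \<psi> (x0 + t *\<^sub>R z) - ?\<xi> - ?H (t *\<^sub>R z)) \<le> \<epsilon> * norm z" .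
    qed simp
    finally have "\<bar>\<kappa> 1 - \<kappa> 0\<bar> \<le> \<epsilon> * (norm z)\<^sup>2" using t(3) by (simp add: power2_eq_square mult.assoc)
    moreover have "\<kappa> 1 - \<kappa> 0 = \<psi> (x0 + z) - quad (\<psi> x0) ?\<xi> (sym_part ?H) x0 (x0 + z)"
      by (simp add: \<kappa>_def quad_def sym_part_quadratic[OF linH])
    ultimately show ?thesis by simp
  qed
  then show ?thesis using d(1) \<psi>(2) by (intro exI[of _ "min d r"]) auto
qed

subsection \<open>The tail space\<close>

lemma Lp_loc_measurable:
  fixes h :: "'a::euclidean_space \<Rightarrow> real"
  assumes "Lp_loc q UNIV h"
  shows "h \<in> borel_measurable lebesgue"
proof (rule borel_measurable_LIMSEQ_real)
  show "(\<lambda>x. indicator (cball 0 (real n)) x *\<^sub>R h x) \<in> borel_measurable lebesgue" for n :: nat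
    using assms by (simp add: Lp_loc_def Lp_on_def set_borel_measurable_def)
  show "(\<lambda>n. indicator (cball 0 (real n)) x *\<^sub>R h x) \<longlonglongrightarrow> h x" for x
  proof (rule tendsto_eventually)
    obtain N :: nat where "norm x \<le> N" using real_arch_simple by blast
    then show "\<forall>\<^sub>F n in sequentially. indicator (cball 0 (real n)) x *\<^sub>R h x = h x"
      by (intro eventually_sequentiallyI[of N]) simp
  qed
qed

lemma tail_space_mono:
  fixes h h' :: "'a::euclidean_space \<Rightarrow> real"
  assumes h: "h \<in> tail_space s p" and m: "h' \<in> borel_measurable lebesgue" and le: "\<And>x. \<bar>h' x\<bar> \<le> \<bar>h x\<bar>" and p: "1 \<le> p"
  shows "h' \<in> tail_space s p"
proof -
  have pw: "\<bar>h' x\<bar> powr (p - 1) \<le> \<bar>h x\<bar> powr (p - 1)" for x using le p by (intro powr_mono2) auto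
  have "Lp_loc (p - 1) UNIV h'" unfolding Lp_loc_def Lp_on_def
  proof (intro allI impI conjI)
    fix C :: "'a set" assume C: "compact C \<and> C \<subseteq> UNIV"
    have CL: "C \<in> sets lebesgue" using C lmeasurable_compact fmeasurableD by blast
    show "set_borel_measurable lebesgue C h'" unfolding set_borel_measurable_def
      using CL m by (intro borel_measurable_scaleR borel_measurable_indicator)
    have i: "integrable lebesgue (\<lambda>x. indicator C x *\<^sub>R norm (h x) powr (p - 1))"
      using h C by (simp add: tail_space_def Lp_loc_def Lp_on_def set_integrable_def)
    have mm: "(\<lambda>x. indicator C x *\<^sub>R norm (h' x) powr (p - 1)) \<in> borel_measurable lebesgue"
      using CL m by (intro borel_measurable_scaleR borel_measurable_indicator powr_real_measurable) auto
    show "set_integrable lebesgue C (\<lambda>x. norm (h' x) powr (p - 1))" unfolding set_integrable_def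
      by (rule Bochner_Integration.integrable_bound[OF i mm]) (use pw in \<open>auto simp: indicator_def\<close>)
  qed
  moreover have "integrable lebesgue (\<lambda>x. \<bar>h' x\<bar> powr (p - 1) / (1 + norm x) powr (real DIM('a) + s * p))"
  proof (rule Bochner_Integration.integrable_bound)
    show "integrable lebesgue (\<lambda>x. \<bar>h x\<bar> powr (p - 1) / (1 + norm x) powr (real DIM('a) + s * p))"
      using h by (simp add: tail_space_def)
    have nm: "(\<lambda>x::'a. (1 + norm x) powr (real DIM('a) + s * p)) \<in> borel_measurable lebesgue"
      by (intro measurable_completion) measurable
    show "(\<lambda>x. \<bar>h' x\<bar> powr (p - 1) / (1 + norm x) powr (real DIM('a) + s * p)) \<in> borel_measurable lebesgue"
      by (rule borel_measurable_divide[OF measurable_abs_powr[OF m] nm])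
    show "AE x in lebesgue. norm (\<bar>h' x\<bar> powr (p - 1) / (1 + norm x) powr (real DIM('a) + s * p))
        \<le> norm (\<bar>h x\<bar> powr (p - 1) / (1 + norm x) powr (real DIM('a) + s * p))"
      using pw by (intro always_eventually allI) (auto intro!: divide_right_mono)
  qed
  ultimately show ?thesis by (simp add: tail_space_def)
qed

text \<open>The integrability part of \<open>nonlocal_op_tendsto\<close> for constant sequences; the
  difference bounds are those of the quadratic polynomial plus errors of size |z|^2.\<close>

lemma (in singular_kernel) nonlocal_op_integrable_C2:
  assumes w: "w \<in> borel_measurable borel" and g: "tail_bound (p - 1) (\<lambda>y. \<bar>w y\<bar>)" and B: "symmetric_map B"
    and "0 < \<delta>" and t: "\<And>z. norm z < \<delta> \<Longrightarrow> \<bar>w (x0 + z) - quad (w x0) \<xi> B x0 (x0 + z)\<bar> \<le> (norm z)\<^sup>2"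
  shows "integrable lborel (\<lambda>z. sd w x0 z * k z)"
proof -
  interpret symmetric_map B by (rule B)
  let ?q = "quad (w x0) \<xi> B x0"
  obtain C where C: "0 \<le> C"
    "\<And>x y. x \<in> ball x0 1 \<Longrightarrow> y \<in> ball x0 1 \<Longrightarrow> \<bar>?q x - ?q y\<bar> \<le> C * norm (x - y)"
    "\<And>x z. \<bar>2 * ?q x - ?q (x + z) - ?q (x - z)\<bar> \<le> C * (norm z)\<^sup>2"
    using quad_differences[OF zero_less_one, of x0 "w x0" \<xi>] by blast
  have q0: "?q x0 = w x0" by (simp add: quad_def)
  define \<rho> where "\<rho> = min \<delta> 1"
  have \<rho>: "0 < \<rho>" using \<open>0 < \<delta>\<close> by (simp add: \<rho>_def)
  have d1: "\<bar>w x0 - w (x0 + z)\<bar> \<le> (C + 2) * norm z" if z: "norm z < \<rho>" for z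
  proof -
    have "\<bar>?q x0 - ?q (x0 + z)\<bar> \<le> C * norm z" using C(2)[of x0 "x0 + z"] z by (simp add: \<rho>_def dist_norm)
    moreover have "(norm z)\<^sup>2 \<le> norm z" using z mult_left_mono[of "norm z" 1 "norm z"] by (simp add: \<rho>_def power2_eq_square)
    moreover have "\<bar>w (x0 + z) - ?q (x0 + z)\<bar> \<le> (norm z)\<^sup>2" using t z by (simp add: \<rho>_def)
    ultimately have "\<bar>w x0 - w (x0 + z)\<bar> \<le> C * norm z + norm z" using q0 by linarith
    then show ?thesis unfolding distrib_right using norm_ge_zero[of z] by linarith
  qed
  have d2: "\<bar>2 * w x0 - w (x0 + z) - w (x0 - z)\<bar> \<le> (C + 2) * (norm z)\<^sup>2" if z: "norm z < \<rho>" for z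
  proof -
    have "\<bar>w (x0 + z) - ?q (x0 + z)\<bar> \<le> (norm z)\<^sup>2" "\<bar>w (x0 - z) - ?q (x0 - z)\<bar> \<le> (norm z)\<^sup>2"
      using t[of z] t[of "- z"] z by (auto simp: \<rho>_def)
    then have "\<bar>2 * w x0 - w (x0 + z) - w (x0 - z)\<bar> \<le> C * (norm z)\<^sup>2 + 2 * (norm z)\<^sup>2"
      using C(3)[of x0 z] q0 by linarith
    then show ?thesis by (simp add: algebra_simps)
  qed
  show ?thesis
    by (rule nonlocal_op_tendsto(2)[OF \<rho> tendsto_const[of x0] w w _ d1 d2 tendsto_const tendsto_const _ g]) (use C in auto)
qed

text \<open>The test function is replaced by a Borel function w equal to it everywhere on the ball
  and almost everywhere outside. Values and derivatives at x0 are untouched, and all integrals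
  agree.\<close>

lemma viscosity_inequality:
  fixes \<psi> u :: "'a::euclidean_space \<Rightarrow> real"
  assumes k: "singular_kernel s p k \<Lambda>" and K: "\<And>x y. K x y = k (y - x)"
    and \<Omega>: "open \<Omega>" "ball x0 r \<subseteq> \<Omega>" "0 < r"
    and f: "continuous_on (\<Omega> \<times> UNIV \<times> UNIV \<times> UNIV) (\<lambda>(x, t, \<eta>, \<zeta>). f x t \<eta> \<zeta>)"
    and comp: "\<And>\<Omega>'. open \<Omega>' \<Longrightarrow> \<Omega>' \<subseteq> \<Omega> \<Longrightarrow> comparison_principle s p K f \<Omega>'"
    and u: "continuous_on UNIV u" "weak_supersolution s p K f \<Omega> u"
    and \<psi>: "Ck_on 2 \<psi> (ball x0 r)" "\<psi> \<in> tail_space s p" "\<And>x. \<psi> x \<le> u x" "\<psi> x0 = u x0"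
    and mean: "rhs_meaningful s p f \<Omega> \<psi> x0"
  shows "f x0 (\<psi> x0) (gradient \<psi> x0) (Dsp s p \<psi> x0) \<le> - p_laplacian p \<psi> x0 + frac_p_laplacian p K \<psi> x0"
proof -
  interpret singular_kernel s p k \<Lambda> by (rule k)
  let ?B = "ball x0 r"
  have "\<psi> \<in> borel_measurable lebesgue" using \<psi>(2) by (auto simp: tail_space_def intro: Lp_loc_measurable)
  then obtain \<psi>1 where \<psi>1[measurable]: "\<psi>1 \<in> borel_measurable borel" and ae1: "AE x in lborel. \<psi> x = \<psi>1 x"
    by (rule lebesgue_borel_version)
  define w where "w x = (if x \<in> ?B then \<psi> x else \<psi>1 x)" for x
  have c\<psi>: "continuous_on ?B \<psi>"
    using C2_has_derivative[OF \<psi>(1)] by (meson continuous_at_imp_continuous_on has_derivative_continuous)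
  have "(\<lambda>x. indicator ?B x *\<^sub>R \<psi> x + indicator (- ?B) x * \<psi>1 x) \<in> borel_measurable borel"
    by (intro borel_measurable_add borel_measurable_times borel_measurable_indicator
        borel_measurable_continuous_on_indicator[OF _ c\<psi>] \<psi>1) auto
  also have "(\<lambda>x. indicator ?B x *\<^sub>R \<psi> x + indicator (- ?B) x * \<psi>1 x) = w" by (auto simp: w_def indicator_def)
  finally have w[measurable]: "w \<in> borel_measurable borel" .
  have ae: "AE x in lborel. \<psi> x = w x" using ae1 by eventually_elim (simp add: w_def)
  have wx0: "w x0 = \<psi> x0" using \<Omega> by (simp add: w_def)
  have tb: "tail_bound (p - 1) (\<lambda>y. \<bar>w y\<bar>)"
  proof -
    have i: "integrable lebesgue (\<lambda>x. \<bar>\<psi> x\<bar> powr (p - 1) / (1 + norm x) powr (real DIM('a) + s * p))"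
      using \<psi>(2) by (simp add: tail_space_def)
    have a: "AE x in lborel. \<bar>\<psi> x\<bar> powr (p - 1) / (1 + norm x) powr (real DIM('a) + s * p) = \<bar>w x\<bar> powr (p - 1) * weight x"
      using ae unfolding weight_def powr_minus divide_inverse by eventually_elim simp
    have m: "(\<lambda>x. \<bar>w x\<bar> powr (p - 1) * weight x) \<in> borel_measurable borel" by measurable
    have "integrable lborel (\<lambda>x. \<bar>w x\<bar> powr (p - 1) * weight x)"
      using i unfolding integrable_lebesgue_lborel[OF m a] .
    then show ?thesis by (simp add: tail_bound_def)
  qed
  let ?\<xi> = "gradient \<psi> x0" and ?S = "sym_part (hessian \<psi> x0)"
  have x0: "x0 \<in> ?B" using \<Omega>(3) by simp
  have linH: "linear (hessian \<psi> x0)" by (rule has_derivative_linear[OF gradient_has_derivative[OF \<psi>(1) x0]])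
  have S: "symmetric_map ?S" by (rule sym_part_symmetric[OF linH])
  have taylor: "\<exists>\<delta>>0. \<forall>z. norm z < \<delta> \<longrightarrow> \<bar>w (x0 + z) - quad (w x0) ?\<xi> ?S x0 (x0 + z)\<bar> \<le> \<epsilon> * (norm z)\<^sup>2" if \<epsilon>: "0 < \<epsilon>" for \<epsilon>
  proof -
    obtain \<delta> where \<delta>: "0 < \<delta>" "\<And>z. norm z < \<delta> \<Longrightarrow> \<bar>\<psi> (x0 + z) - quad (\<psi> x0) ?\<xi> ?S x0 (x0 + z)\<bar> \<le> \<epsilon> * (norm z)\<^sup>2"
      using C2_taylor[OF \<psi>(1) \<Omega>(3) \<epsilon>] by blast
    have "w (x0 + z) = \<psi> (x0 + z)" if "norm z < r" for z using that by (simp add: w_def dist_norm)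
    then show ?thesis using \<delta> \<Omega>(3) wx0 by (intro exI[of _ "min \<delta> r"]) auto
  qed
  have Dae: "AE y in lborel. Dsp_integrand s p \<psi> x0 y = Dsp_integrand s p w x0 y"
    using ae by eventually_elim (simp add: Dsp_integrand_def wx0)
  have Dm: "Dsp_integrand s p w x0 \<in> borel_measurable borel" unfolding Dsp_integrand_def[abs_def] by measurable
  have Dsp: "Dsp s p \<psi> x0 = Dsp s p w x0"
    unfolding Dsp_borel(1)[OF w] unfolding Dsp_def by (rule integral_lebesgue_lborel[OF Dm Dae])
  have mean': "integrable lborel (Dsp_integrand s p w x0) \<or> (\<forall>z\<in>\<Omega>. \<forall>t \<eta> \<zeta>\<^sub>1 \<zeta>\<^sub>2. f z t \<eta> \<zeta>\<^sub>1 = f z t \<eta> \<zeta>\<^sub>2)"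
    using mean integrable_lebesgue_lborel[OF Dm Dae] by (simp add: rhs_meaningful_def)
  obtain \<delta> where \<delta>: "0 < \<delta>" "\<And>z. norm z < \<delta> \<Longrightarrow> \<bar>w (x0 + z) - quad (w x0) ?\<xi> ?S x0 (x0 + z)\<bar> \<le> (norm z)\<^sup>2"
    using taylor[OF zero_less_one] by auto
  have sdi: "integrable lborel (\<lambda>z. sd w x0 z * k z)"
    by (rule nonlocal_op_integrable_C2[OF w tb S \<delta>])
  have frac: "frac_p_laplacian p K \<psi> x0 = nonlocal_op w x0"
  proof (rule frac_p_laplacian_eq[OF w ae wx0[symmetric] tb _ sdi])
    show "K x0 y = k (y - x0)" for y by (rule K)
  qed simp
  have cb: "cball x0 (r / 2) \<subseteq> \<Omega>" "0 < r / 2" using \<Omega>(2,3) by (auto simp: subset_iff)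
  have "f x0 (w x0) ?\<xi> (Dsp s p w x0) \<le> - (\<Sum>b\<in>Basis. p_power_deriv p ?\<xi> (?S b) \<bullet> b) + nonlocal_op w x0"
  proof (rule touching_inequality[OF K \<Omega>(1) cb f comp u w tb _ _ mean' S taylor])
    show "AE y in lborel. w y \<le> u y" using ae by eventually_elim (use \<psi>(3) in metis)
    show "w x0 = u x0" using wx0 \<psi>(4) by simp
  qed
  also have "(\<Sum>b\<in>Basis. p_power_deriv p ?\<xi> (?S b) \<bullet> b) = p_laplacian p \<psi> x0"
    unfolding sum_p_power_deriv_sym_part[OF linH] p_laplacian_eq[OF p \<psi>(1) x0] ..
  finally show ?thesis by (simp add: frac Dsp wx0)
qed

text \<open>Symmetry and translation by -x give K x y = K y x = K (y - x) 0, so K is a function of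
  the displacement and its symmetry becomes evenness.\<close>

lemma admissible_kernel_singular:
  fixes K :: "'a::euclidean_space \<Rightarrow> 'a \<Rightarrow> real"
  assumes K: "admissible_kernel s p K" and sp: "0 < s" "s < 1" "2 \<le> p"
  obtains \<Lambda> where "singular_kernel s p (\<lambda>z. K z 0) \<Lambda>" "\<And>x y. K x y = K (y - x) 0"
proof -
  obtain \<Lambda> where \<Lambda>: "0 < \<Lambda>" "\<And>x y. x \<noteq> y \<Longrightarrow> inverse \<Lambda> * norm (x - y) powr (- real DIM('a) - p * s) \<le> K x y"
      "\<And>x y. x \<noteq> y \<Longrightarrow> K x y \<le> \<Lambda> * norm (x - y) powr (- real DIM('a) - p * s)"
    using K unfolding admissible_kernel_def by blast
  have sym: "K x y = K y x" and tr: "K (x + z) (y + z) = K x y" for x y z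
    using K unfolding admissible_kernel_def by blast+
  have e: "K x y = K (y - x) 0" for x y using sym[of x y] tr[of "y - x" x 0] by simp
  have "singular_kernel s p (\<lambda>z. K z 0) \<Lambda>"
  proof
    show "K (- z) 0 = K z 0" for z using e[of z 0] by (simp add: sym)
    show "0 \<le> K z 0" if "z \<noteq> 0" for z
      using \<Lambda>(1) \<Lambda>(2)[OF that] by (meson inverse_nonnegative_iff_nonnegative less_imp_le mult_nonneg_nonneg order_trans powr_ge_zero)
    show "K z 0 \<le> \<Lambda> * norm z powr - (real DIM('a) + s * p)" if "z \<noteq> 0" for z
      using \<Lambda>(3)[OF that] by (simp add: mult.commute)
    show "continuous_on (- {0}) (\<lambda>z. K z 0)"
      using K unfolding admissible_kernel_def Compl_eq_Diff_UNIV by blast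
  qed (use sp \<Lambda> in auto)
  then show ?thesis using that e by blast
qed

theorem theorem1p2:
  fixes \<Omega> :: "'a::euclidean_space set"
    and s p :: real
    and K :: "'a \<Rightarrow> 'a \<Rightarrow> real"
    and f :: "'a \<Rightarrow> real \<Rightarrow> 'a \<Rightarrow> real \<Rightarrow> real"
  assumes "2 \<le> DIM('a)"
    and "open \<Omega>" "connected \<Omega>" "\<Omega> \<noteq> {}" "bounded \<Omega>" "lipschitz_boundary \<Omega>"
    and "0 < s" "s < 1" "2 \<le> p"
    and "admissible_kernel s p K"
    and "continuous_on (\<Omega> \<times> UNIV \<times> UNIV \<times> UNIV) (\<lambda>(x, t, \<eta>, \<zeta>). f x t \<eta> \<zeta>)"
    and "\<exists>L>0. \<forall>x\<in>\<Omega>. \<forall>t \<eta>\<^sub>1 \<eta>\<^sub>2 \<zeta>\<^sub>1 \<zeta>\<^sub>2.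
           \<bar>f x t \<eta>\<^sub>1 \<zeta>\<^sub>1 - f x t \<eta>\<^sub>2 \<zeta>\<^sub>2\<bar> \<le> L * (norm (\<eta>\<^sub>1 - \<eta>\<^sub>2) + \<bar>\<zeta>\<^sub>1 - \<zeta>\<^sub>2\<bar>)"
    and "\<And>\<Omega>'. open \<Omega>' \<Longrightarrow> \<Omega>' \<subseteq> \<Omega> \<Longrightarrow> comparison_principle s p K f \<Omega>'"
  shows "\<forall>u. continuous_on UNIV u \<and> weak_supersolution s p K f \<Omega> u \<longrightarrow>
           viscosity_supersolution s p K f \<Omega> (\<lambda>x. ereal (u x))"
proof (intro allI impI)
  fix u :: "'a \<Rightarrow> real"
  assume u: "continuous_on UNIV u \<and> weak_supersolution s p K f \<Omega> u"
  obtain \<Lambda> where k: "singular_kernel s p (\<lambda>z. K z 0) \<Lambda>" "\<And>x y. K x y = K (y - x) 0"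
    using admissible_kernel_singular[OF assms(10,7-9)] by blast
  have neg: "real_of_ereal (max 0 (- ereal (u x))) = max 0 (- u x)" for x
    by (simp add: max_def)
  show "viscosity_supersolution s p K f \<Omega> (\<lambda>x. ereal (u x))"
    unfolding viscosity_supersolution_def
  proof (intro conjI allI impI ballI)
    show "lower_semicontinuous (\<lambda>x. ereal (u x))"
      unfolding lower_semicontinuous_def
    proof
      fix t
      have "continuous_on UNIV (\<lambda>x. ereal (u x))" using u by (intro continuous_intros) auto
      then show "open {x. t < ereal (u x)}" by (intro open_Collect_less continuous_on_const)
    qed
    show "AE x in lebesgue. max 0 (- ereal (u x)) < \<infinity>" by (simp add: max_def)
    show "(\<lambda>x. real_of_ereal (max 0 (- ereal (u x)))) \<in> tail_space s p"
      unfolding neg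
    proof (rule tail_space_mono[of u])
      show "u \<in> tail_space s p" using u by (simp add: weak_supersolution_def)
      have "u \<in> borel_measurable borel" using u by (intro borel_measurable_continuous_onI) auto
      then show "(\<lambda>x. max 0 (- u x)) \<in> borel_measurable lebesgue"
        by (intro measurable_completion) simp
    qed (use assms(9) in auto)
    show "AE x in lebesgue. ereal (u x) < \<infinity>" "- \<infinity> < ereal (u x)" for x by auto
    fix x0 r \<psi>
    assume H: "0 < r \<and> ball x0 r \<subseteq> \<Omega> \<and> Ck_on 2 \<psi> (ball x0 r) \<and> \<psi> \<in> tail_space s p \<and>
        (\<forall>x. ereal (\<psi> x) \<le> ereal (u x)) \<and> ereal (\<psi> x0) = ereal (u x0) \<and> rhs_meaningful s p f \<Omega> \<psi> x0"
    have "f x0 (\<psi> x0) (gradient \<psi> x0) (Dsp s p \<psi> x0) \<le> - p_laplacian p \<psi> x0 + frac_p_laplacian p K \<psi> x0"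
      by (rule viscosity_inequality[OF k assms(2) _ _ assms(11,13), where u=u and r=r]) (use u H in auto)
    moreover have "((\<lambda>x. - p_laplacian p \<psi> x) \<longlongrightarrow> - p_laplacian p \<psi> x0) (at x0)"
      using H assms(9) by (intro tendsto_minus p_laplacian_tendsto[of p \<psi> "ball x0 r"]) auto
    then have "Lim (at_right 0) (\<lambda>\<rho>. SUP x\<in>ball x0 \<rho> - {x0}. ereal (- p_laplacian p \<psi> x)) = ereal (- p_laplacian p \<psi> x0)"
      by (rule Lim_SUP_punctured_ball)
    ultimately show "ereal (f x0 (\<psi> x0) (gradient \<psi> x0) (Dsp s p \<psi> x0))
        \<le> Lim (at_right 0) (\<lambda>\<rho>. SUP x\<in>ball x0 \<rho> - {x0}. ereal (- p_laplacian p \<psi> x)) + ereal (frac_p_laplacian p K \<psi> x0)"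
      by simp
  qed
qed

end
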